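(* Let $K,K_1,\ldots,K_n$ be nonnegative matrices that define operators on $l^2(R)$ and let $\alpha,\beta$ be nonnegative numbers with $\alpha+\beta\ge1$. (1) For all $\rho\in\{r,\|\cdot\|\}$, $$\rho\big(S_{\alpha,\beta}(K_1)\cdots S_{\alpha,\beta}(K_n)\big)\le\rho\Big((K_1\cdots K_n)^{(\alpha)}\circ((K_n\cdots K_1)^* )^{(\beta)}\Big)\le\rho(K_1\cdots K_n)^\alpha\rho(K_n\cdots K_1)^\beta,$$ $$\rho(S_{\alpha,\beta}(K))\le\rho(K)^{\alpha+\beta},$$ $$\rho\big(S_{\alpha,\beta}(K_1)+\cdots+S_{\alpha,\beta}(K_n)\big)\le\rho\big(S_{\alpha,\beta}(K_1+\cdots+K_n)\big)\le\rho(K_1+\cdots+K_n)^{\alpha+\beta}.$$ (2) For nonnegative matrices $K_1,K_2$ that define operators on $l^2(R)$, $r\big(S_{\alpha,\beta}(K_1)S_{\alpha,\beta}(K_2)\big)\le r(K_1K_2)^{\alpha+\beta}$. (3) For all $\rho\in\{r,r_{ess},\gamma,\|\cdot\|,w\}$, with $\delta=\max\{\|K_1\cdots K_n\|_\infty,\|K_n\cdots K_1\|_\infty\}^{\alpha+\beta-1}$, $$\rho\big(S_{\alpha,\beta}(K_1)\cdots S_{\alpha,\beta}(K_n)\big)\le\rho\Big((K_1\cdots K_n)^{(\alpha)}\circ((K_n\cdots K_1)^* )^{(\beta)}\Big)$$ $$\le\delta\,\rho\Big((K_1\cdots K_n)^{(\frac{\alpha}{\alpha+\beta})}\circ((K_n\cdots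 K_1)^* )^{(\frac{\beta}{\alpha+\beta})}\Big)\le\delta\,\rho(K_1\cdots K_n)^{\frac{\alpha}{\alpha+\beta}}\rho(K_n\cdots K_1)^{\frac{\beta}{\alpha+\beta}},$$ $$\rho(S_{\alpha,\beta}(K))\le\|K\|_\infty^{\alpha+\beta-1}\rho\big(S_{\frac{\alpha}{\alpha+\beta}}(K)\big)\le\|K\|_\infty^{\alpha+\beta-1}\rho(K),$$ $$\rho\big(S_{\alpha,\beta}(K_1)+\cdots+S_{\alpha,\beta}(K_n)\big)\le\rho\big(S_{\alpha,\beta}(K_1+\cdots+K_n)\big)$$ $$\le\|K_1+\cdots+K_n\|_\infty^{\alpha+\beta-1}\rho\big(S_{\frac{\alpha}{\alpha+\beta}}(K_1+\cdots+K_n)\big)\le\|K_1+\cdots+K_n\|_\infty^{\alpha+\beta-1}\rho(K_1+\cdots+K_n).$$ (4) For all $\rho\in\{r,r_{ess}\}$ and nonnegative matrices $K_1,K_2$ that define operators on $l^2(R)$, with $\eta=\max\{\|K_1K_2\|_\infty,\|K_2K_1\|_\infty\}^{\alpha+\beta-1}$, $$\rho\big(S_{\alpha,\beta}(K_1)S_{\alpha,\beta}(K_2)\big)\le\rho\Big((K_1K_2)^{(\alpha)}\circ((K_2K_1)^* )^{(\beta)}\Big)$$ $$\le\eta\,\rho\Big((K_1K_2)^{(\frac{\alpha}{\alpha+\beta})}\circ((K_2K_1)^* )^{(\frac{\beta}{\alpha+\beta})}\Big)\le\eta\,\rho(K_1K_2).$$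
   Context: $R$ is $\{1,\ldots,N\}$ for some $N\in\mathbb N$ or $R=\mathbb N$; $l^2(R)$ is the complex Hilbert space of square summable sequences on $R$. A matrix $K=[k(i,j)]_{i,j\in R}$ is nonnegative if all entries are $\ge0$; it defines an operator on $l^2(R)$ if $Kx\in l^2(R)$ for all $x\in l^2(R)$, where $(Kx)_i=\sum_j k(i,j)x_j$ (such an operator is automatically bounded). $\|K\|_\infty=\sup_{i,j\in R}k(i,j)$ (finite, since $\|K\|_\infty\le\|K\|$). $K^*$ is the transpose. The Hadamard product $\circ$ is entrywise, and $K^{(t)}=[k(i,j)^t]$ for $t\ge0$ (convention $0^0=1$). $S_{\alpha,\beta}(K)=K^{(\alpha)}\circ(K^* )^{(\beta)}$ for $\alpha,\beta\ge0$ with $\alpha+\beta\ge1$ (it defines an operator on $l^2(R)$), and $S_\alpha(K)=K^{(\alpha)}\circ(K^* )^{(1-\alpha)}$ for $\alpha\in[0,1]$. $r$ is the spectral radius, $\|\cdot\|$ the operator norm, $w(K)=\sup\{|\langle Kf,f\rangle|:\|f\|_2=1\}$ the numerical radius, $\gamma(K)$ the Hausdorff measure of noncompactness, i.e. the infimum of all $\delta>0$ such that $K(D)\subset M+\delta D$ for some finite set $M$, where $D$ is the closed unit ball, and $r_{ess}(K)=\lim_{j\to\infty}\gamma(K^j)^{1/j}$ the essential spectral radius (the spectral radius of the image of $K$ in the Calkin algebra). *)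

theory Defs
  imports "HOL-Analysis.Analysis"
begin

definition index_set :: "nat set \<Rightarrow> bool" where
  "index_set R \<longleftrightarrow> (\<exists>N\<ge>1. R = {1..N}) \<or> R = {1..}"


subsection \<open>The Hilbert space of square summable sequences\<close>

text \<open>A sequence on \<open>R\<close> is a function on \<^typ>\<open>nat\<close> that vanishes outside \<open>R\<close>, so that equality of
  sequences is equality of functions.\<close>

definition l2 :: "nat set \<Rightarrow> (nat \<Rightarrow> complex) set" where
  "l2 R = {x. (\<forall>i. i \<notin> R \<longrightarrow> x i = 0) \<and> (\<lambda>i. (cmod (x i))\<^sup>2) summable_on R}"

definition l2_norm :: "nat set \<Rightarrow> (nat \<Rightarrow> complex) \<Rightarrow> real" where
  "l2_norm R x = sqrt (\<Sum>\<^sub>\<infinity>i\<in>R. (cmod (x i))\<^sup>2)"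

definition l2_inner :: "nat set \<Rightarrow> (nat \<Rightarrow> complex) \<Rightarrow> (nat \<Rightarrow> complex) \<Rightarrow> complex" where
  "l2_inner R x y = (\<Sum>\<^sub>\<infinity>i\<in>R. x i * cnj (y i))"

definition l2_ball :: "nat set \<Rightarrow> (nat \<Rightarrow> complex) set" where
  "l2_ball R = {x \<in> l2 R. l2_norm R x \<le> 1}"


subsection \<open>Quantities attached to an operator\<close>

type_synonym operator = "(nat \<Rightarrow> complex) \<Rightarrow> (nat \<Rightarrow> complex)"

definition bounded_operator :: "nat set \<Rightarrow> operator \<Rightarrow> bool" where
  "bounded_operator R T \<longleftrightarrow>
     (\<forall>x\<in>l2 R. T x \<in> l2 R) \<and>
     (\<forall>x\<in>l2 R. \<forall>y\<in>l2 R. T (\<lambda>i. x i + y i) = (\<lambda>i. T x i + T y i)) \<and>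
     (\<forall>c. \<forall>x\<in>l2 R. T (\<lambda>i. c * x i) = (\<lambda>i. c * T x i)) \<and>
     (\<exists>C. \<forall>x\<in>l2 R. l2_norm R (T x) \<le> C * l2_norm R x)"

definition op_norm :: "nat set \<Rightarrow> operator \<Rightarrow> real" where
  "op_norm R T = Sup {l2_norm R (T x) | x. x \<in> l2_ball R}"

definition spectrum :: "nat set \<Rightarrow> operator \<Rightarrow> complex set" where
  "spectrum R T = {z. \<not> (\<exists>S. bounded_operator R S \<and>
     (\<forall>x\<in>l2 R. S (\<lambda>i. z * x i - T x i) = x \<and> (\<lambda>i. z * S x i - T (S x) i) = x))}"

definition spectral_radius :: "nat set \<Rightarrow> operator \<Rightarrow> real" where
  "spectral_radius R T = Sup {cmod z | z. z \<in> spectrum R T}"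

definition numerical_radius :: "nat set \<Rightarrow> operator \<Rightarrow> real" where
  "numerical_radius R T = Sup {cmod (l2_inner R (T f) f) | f. f \<in> l2 R \<and> l2_norm R f = 1}"

definition noncompactness :: "nat set \<Rightarrow> operator \<Rightarrow> real" where
  "noncompactness R T = Inf {\<delta>. \<delta> > 0 \<and> (\<exists>M. finite M \<and> M \<subseteq> l2 R \<and>
     T ` l2_ball R \<subseteq> {\<lambda>i. m i + complex_of_real \<delta> * d i | m d. m \<in> M \<and> d \<in> l2_ball R})}"

definition ess_spectral_radius :: "nat set \<Rightarrow> operator \<Rightarrow> real" where
  "ess_spectral_radius R T = lim (\<lambda>j. root j (noncompactness R (T ^^ j)))"


subsection \<open>Matrices\<close>

text \<open>Only the entries \<open>K i j\<close> with \<open>i, j \<in> R\<close> are relevant.\<close>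

type_synonym matrix = "nat \<Rightarrow> nat \<Rightarrow> real"

definition nonneg_matrix :: "nat set \<Rightarrow> matrix \<Rightarrow> bool" where
  "nonneg_matrix R K \<longleftrightarrow> (\<forall>i\<in>R. \<forall>j\<in>R. 0 \<le> K i j)"

definition mat_op :: "nat set \<Rightarrow> matrix \<Rightarrow> operator" where
  "mat_op R K x = (\<lambda>i. if i \<in> R then \<Sum>\<^sub>\<infinity>j\<in>R. complex_of_real (K i j) * x j else 0)"

text \<open>Convergence of the row sums is demanded explicitly, because \<^const>\<open>infsum\<close> is \<open>0\<close> on
  families that are not summable. For nonnegative \<open>K\<close>, unconditional convergence for all \<open>x\<close> is the
  same as convergence of the series for all \<open>x\<close>, since \<open>x\<close> can be replaced by its modulus.\<close>

definition defines_operator :: "nat set \<Rightarrow> matrix \<Rightarrow> bool" where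
  "defines_operator R K \<longleftrightarrow> (\<forall>x\<in>l2 R.
     (\<forall>i\<in>R. (\<lambda>j. complex_of_real (K i j) * x j) summable_on R) \<and> mat_op R K x \<in> l2 R)"

definition sup_norm :: "nat set \<Rightarrow> matrix \<Rightarrow> real" where
  "sup_norm R K = Sup {K i j | i j. i \<in> R \<and> j \<in> R}"

definition mat_mult :: "nat set \<Rightarrow> matrix \<Rightarrow> matrix \<Rightarrow> matrix" where
  "mat_mult R K L = (\<lambda>i j. \<Sum>\<^sub>\<infinity>k\<in>R. K i k * L k j)"

fun mat_prod :: "nat set \<Rightarrow> matrix list \<Rightarrow> matrix" where
  "mat_prod R [] = (\<lambda>i j. if i = j then 1 else 0)"
| "mat_prod R [K] = K"
| "mat_prod R (K # L # Ks) = mat_mult R K (mat_prod R (L # Ks))"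

definition mat_sum :: "matrix list \<Rightarrow> matrix" where
  "mat_sum Ks = (\<lambda>i j. \<Sum>K\<leftarrow>Ks. K i j)"

definition mat_adj :: "matrix \<Rightarrow> matrix" where
  "mat_adj K = (\<lambda>i j. K j i)"

definition hadamard :: "matrix \<Rightarrow> matrix \<Rightarrow> matrix" where
  "hadamard K L = (\<lambda>i j. K i j * L i j)"

text \<open>Real powers with \<open>0\<^sup>0 = 1\<close>; note that \<^term>\<open>(0::real) powr 0\<close> is \<open>0\<close>.\<close>

definition rpow :: "real \<Rightarrow> real \<Rightarrow> real" where
  "rpow x t = (if t = 0 then 1 else x powr t)"

definition hadamard_pow :: "matrix \<Rightarrow> real \<Rightarrow> matrix" where
  "hadamard_pow K t = (\<lambda>i j. rpow (K i j) t)"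

definition sym2 :: "real \<Rightarrow> real \<Rightarrow> matrix \<Rightarrow> matrix" where
  "sym2 \<alpha> \<beta> K = hadamard (hadamard_pow K \<alpha>) (hadamard_pow (mat_adj K) \<beta>)"

definition sym1 :: "real \<Rightarrow> matrix \<Rightarrow> matrix" where
  "sym1 \<alpha> K = hadamard (hadamard_pow K \<alpha>) (hadamard_pow (mat_adj K) (1 - \<alpha>))"

end

theory Submission
  imports Defs
begin

text \<open>All inequalities rest on Hoelder's inequality
  \<open>\<Sum>\<^sub>k a\<^sub>k\<^sup>\<alpha> b\<^sub>k\<^sup>\<beta> \<le> (\<Sum>\<^sub>k a\<^sub>k)\<^sup>\<alpha> (\<Sum>\<^sub>k b\<^sub>k)\<^sup>\<beta>\<close> for \<open>\<alpha> + \<beta> \<ge> 1\<close>. Applied to the entries, it shows that sums and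
  products of the matrices \<open>A\<^sub>l\<^sup>(\<^sup>\<alpha>\<^sup>) \<circ> B\<^sub>l\<^sup>(\<^sup>\<beta>\<^sup>)\<close> are dominated entrywise by
  \<open>A\<^sup>(\<^sup>\<alpha>\<^sup>) \<circ> B\<^sup>(\<^sup>\<beta>\<^sup>)\<close>, with \<open>A\<close> and \<open>B\<close> the sums and products of the \<open>A\<^sub>l\<close> and of the \<open>B\<^sub>l\<close>
  (\<open>mat_mult_hmean\<close>, \<open>mat_prod_sym2\<close>, \<open>mat_sum_sym2\<close>). It remains to see that each of the five
  quantities \<open>\<rho>\<close> is monotone and homogeneous on nonnegative matrices, invariant under transposition, and
  satisfies \<open>\<rho>(A\<^sup>(\<^sup>\<alpha>\<^sup>) \<circ> B\<^sup>(\<^sup>\<beta>\<^sup>)) \<le> \<rho>(A)\<^sup>\<alpha> \<rho>(B)\<^sup>\<beta>\<close> for \<open>\<alpha> + \<beta> = 1\<close>, in the case of the norm and the spectral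
  radius even for \<open>\<alpha> + \<beta> \<ge> 1\<close>. These properties form the locale \<open>matrix_functional\<close>. The factors \<open>\<delta>\<close> and \<open>\<eta>\<close>
  arise from \<open>a\<^sup>\<alpha> b\<^sup>\<beta> \<le> m\<^sup>\<alpha>\<^sup>+\<^sup>\<beta>\<^sup>-\<^sup>1 a\<^sup>s b\<^sup>1\<^sup>-\<^sup>s\<close> for \<open>0 \<le> a, b \<le> m\<close> and \<open>s = \<alpha>/(\<alpha>+\<beta>)\<close>.

  The norm and the numerical radius of a nonnegative matrix are the least constants \<open>C\<close> for which
  \<open>\<Sum>\<^sub>i\<^sub>j y\<^sub>i a\<^sub>i\<^sub>j x\<^sub>j \<le> C \<parallel>x\<parallel> \<parallel>y\<parallel>\<close> holds for all nonnegative finite vectors, with \<open>x = y\<close> in the case of the numerical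
  radius. For such bounds the properties follow from Hoelder's inequality for the double sum. The measure
  of noncompactness is the limit of the norms of the matrices whose first \<open>n\<close> rows are replaced by \<open>0\<close>
  (\<open>noncompactness_le_iff\<close>), so it inherits them from the norm.

  The two spectral radii are limits of \<open>g(A\<^sup>n)\<^sup>1\<^sup>/\<^sup>n\<close> for the submultiplicative functionals norm and
  noncompactness. Since powers of geometric means are dominated by geometric means of powers, such a limit
  inherits the properties of \<open>g\<close>, and it takes the same value at \<open>A B\<close> and \<open>B A\<close>. For the essential
  spectral radius the limit is the definition, its existence being Fekete's lemma. The spectral radius is
  defined through the spectrum, so Gelfand's formula is needed (\<open>spectral_radius_asymp\<close>). For a
  nonnegative matrix it has an elementary proof: the Neumann series shows that the spectrum lies in the
  disc of radius \<open>r = lim \<parallel>A\<^sup>n\<parallel>\<^sup>1\<^sup>/\<^sup>n\<close>, and \<open>r\<close> itself is in the spectrum because bounded resolvents to the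
  right of \<open>r\<close> would, by positivity, force the powers of \<open>A\<close> to be smaller than \<open>r\<close> allows
  (\<open>in_spectrum\<close>).\<close>

section \<open>Powers and Hoelder's inequality\<close>

lemma rpow_nonneg [simp]: "0 \<le> rpow x t"
  by (simp add: rpow_def)

lemma rpow_mono: "\<lbrakk>0 \<le> x; x \<le> y; 0 \<le> t\<rbrakk> \<Longrightarrow> rpow x t \<le> rpow y t"
  by (simp add: rpow_def powr_mono2)

lemma rpow_mult: "\<lbrakk>0 \<le> x; 0 \<le> y\<rbrakk> \<Longrightarrow> rpow (x * y) t = rpow x t * rpow y t"
  by (simp add: rpow_def powr_mult)

lemma rpow_one [simp]: "0 \<le> x \<Longrightarrow> rpow x 1 = x"
  by (simp add: rpow_def)

lemma rpow_1_left [simp]: "rpow 1 t = 1"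
  by (simp add: rpow_def)

lemma rpow_0_left: "rpow 0 t = (if t = 0 then 1 else 0)"
  by (simp add: rpow_def)

lemma rpow_add: "\<lbrakk>0 \<le> x; 0 \<le> s; 0 \<le> t\<rbrakk> \<Longrightarrow> rpow x (s + t) = rpow x s * rpow x t"
  by (auto simp: rpow_def powr_add)

lemma rpow_rpow: "0 \<le> x \<Longrightarrow> rpow (rpow x s) t = rpow x (s * t)"
  by (auto simp: rpow_def powr_powr)

lemma rpow_power: "0 \<le> x \<Longrightarrow> rpow x t ^ n = rpow (x ^ n) t"
  by (induction n) (auto simp: rpow_mult)

lemma rpow_root:
  assumes "0 \<le> x" "0 < n"
  shows "root n (rpow x t) = rpow (root n x) t"
  using assms rpow_power[of "root n x" t n] real_root_pos2[of n "rpow (root n x) t"]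
  by (simp add: real_root_pow_pos2)

lemma tendsto_rpow:
  assumes "X \<longlonglongrightarrow> L" "\<And>n. 0 \<le> X n" "0 \<le> t"
  shows "(\<lambda>n. rpow (X n) t) \<longlonglongrightarrow> rpow L t"
  using assms unfolding rpow_def
  by (cases "t = 0") (auto intro!: tendsto_powr' always_eventually)

lemma rpow_geometric_arithmetic:
  assumes "0 \<le> \<alpha>" "0 \<le> \<beta>" "\<alpha> + \<beta> = 1" "0 \<le> a" "0 \<le> b"
  shows "rpow a \<alpha> * rpow b \<beta> \<le> \<alpha> * a + \<beta> * b"
proof (cases "a > 0 \<and> b > 0 \<and> \<alpha> \<noteq> 0 \<and> \<beta> \<noteq> 0")
  case True
  then show ?thesis using assms Youngs_inequality_0[of \<alpha> \<beta> a b] by (simp add: rpow_def)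
next
  case False
  then show ?thesis using assms by (auto simp: rpow_def)
qed

lemma Hoelder_sum_1:
  assumes "0 \<le> \<alpha>" "0 \<le> \<beta>" "\<alpha> + \<beta> = 1"
    and ab: "\<And>i. i \<in> F \<Longrightarrow> 0 \<le> a i" "\<And>i. i \<in> F \<Longrightarrow> 0 \<le> b i" and F: "finite F"
  shows "(\<Sum>i\<in>F. rpow (a i) \<alpha> * rpow (b i) \<beta>) \<le> rpow (\<Sum>i\<in>F. a i) \<alpha> * rpow (\<Sum>i\<in>F. b i) \<beta>"
proof -
  define A B where "A = (\<Sum>i\<in>F. a i)" and "B = (\<Sum>i\<in>F. b i)"
  have AB: "0 \<le> A" "0 \<le> B" unfolding A_def B_def using ab by (auto intro: sum_nonneg)
  consider "\<alpha> = 0" | "\<beta> = 0" | "\<alpha> \<noteq> 0" "A = 0" | "\<beta> \<noteq> 0" "B = 0"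
    | "\<alpha> \<noteq> 0" "\<beta> \<noteq> 0" "A > 0" "B > 0" using AB by linarith
  then show ?thesis
  proof cases
    case 1
    then show ?thesis using assms AB by (simp add: rpow_def sum_nonneg)
  next
    case 2
    then show ?thesis using assms AB by (simp add: rpow_def sum_nonneg)
  next
    case 3
    then have "\<And>i. i \<in> F \<Longrightarrow> a i = 0" using ab F sum_nonneg_eq_0_iff[of F a] by (auto simp: A_def)
    then show ?thesis using 3 by (simp add: rpow_0_left)
  next
    case 4
    then have "\<And>i. i \<in> F \<Longrightarrow> b i = 0" using ab F sum_nonneg_eq_0_iff[of F b] by (auto simp: B_def)
    then show ?thesis using 4 by (simp add: rpow_0_left)
  next
    case 5
    \<comment> \<open>normalise both families to total mass one and sum the inequality of the means\<close>
    have "(\<Sum>i\<in>F. rpow (a i) \<alpha> * rpow (b i) \<beta>)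
        = (\<Sum>i\<in>F. rpow A \<alpha> * rpow B \<beta> * (rpow (a i / A) \<alpha> * rpow (b i / B) \<beta>))"
    proof (rule sum.cong[OF refl])
      fix i assume i: "i \<in> F"
      have "rpow (a i) \<alpha> = rpow A \<alpha> * rpow (a i / A) \<alpha>" "rpow (b i) \<beta> = rpow B \<beta> * rpow (b i / B) \<beta>"
        using 5 ab[OF i] by (simp_all flip: rpow_mult)
      then show "rpow (a i) \<alpha> * rpow (b i) \<beta>
         = rpow A \<alpha> * rpow B \<beta> * (rpow (a i / A) \<alpha> * rpow (b i / B) \<beta>)" by simp
    qed
    also have "\<dots> = rpow A \<alpha> * rpow B \<beta> * (\<Sum>i\<in>F. rpow (a i / A) \<alpha> * rpow (b i / B) \<beta>)"
      by (simp add: sum_distrib_left)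
    also have "\<dots> \<le> rpow A \<alpha> * rpow B \<beta> * (\<Sum>i\<in>F. \<alpha> * (a i / A) + \<beta> * (b i / B))"
      using 5 assms by (intro mult_left_mono sum_mono rpow_geometric_arithmetic) auto
    also have "(\<Sum>i\<in>F. \<alpha> * (a i / A) + \<beta> * (b i / B)) = \<alpha> * (A / A) + \<beta> * (B / B)"
      by (simp add: sum.distrib flip: sum_distrib_left sum_divide_distrib A_def B_def)
    also have "\<dots> = 1" using 5 assms by simp
    finally show ?thesis by (simp add: A_def B_def)
  qed
qed

lemma sum_rpow_le:
  assumes "1 \<le> s" "\<And>i. i \<in> F \<Longrightarrow> 0 \<le> c i" "finite F"
  shows "(\<Sum>i\<in>F. rpow (c i) s) \<le> rpow (\<Sum>i\<in>F. c i) s"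
proof -
  let ?C = "\<Sum>i\<in>F. c i"
  have C: "0 \<le> ?C" using assms by (auto intro: sum_nonneg)
  have split: "rpow x s = x * rpow x (s - 1)" if "0 \<le> x" for x
    using rpow_add[of x 1 "s - 1"] assms(1) that by simp
  have "(\<Sum>i\<in>F. rpow (c i) s) \<le> (\<Sum>i\<in>F. c i * rpow ?C (s - 1))"
    using assms by (auto intro!: sum_mono mult_left_mono rpow_mono member_le_sum simp: split)
  also have "\<dots> = rpow ?C s" using C by (simp add: split sum_distrib_right)
  finally show ?thesis .
qed

text \<open>The quotients \<open>\<alpha>/(\<alpha>+\<beta>)\<close> and \<open>\<beta>/(\<alpha>+\<beta>)\<close> are convex weights. This reduces inequalities for
  \<open>\<alpha> + \<beta> \<ge> 1\<close> to convex ones, followed by a power with exponent at least one.\<close>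

lemma rpow_normalise:
  assumes "0 \<le> \<alpha>" "0 \<le> \<beta>" "1 \<le> \<alpha> + \<beta>" "0 \<le> a" "0 \<le> b"
  shows "rpow a \<alpha> * rpow b \<beta> = rpow (rpow a (\<alpha>/(\<alpha>+\<beta>)) * rpow b (\<beta>/(\<alpha>+\<beta>))) (\<alpha>+\<beta>)"
  using assms by (simp add: rpow_mult rpow_rpow)

text \<open>For \<open>\<alpha> + \<beta> > 1\<close> the inequality follows from the convex case because
  the \<open>l\<^sup>1\<close> norm dominates the \<open>l\<^sup>s\<close> norm for \<open>s = \<alpha> + \<beta>\<close>.\<close>

lemma Hoelder_sum:
  assumes e: "0 \<le> \<alpha>" "0 \<le> \<beta>" "1 \<le> \<alpha> + \<beta>"
    and ab: "\<And>i. i \<in> F \<Longrightarrow> 0 \<le> a i" "\<And>i. i \<in> F \<Longrightarrow> 0 \<le> b i" and F: "finite F"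
  shows "(\<Sum>i\<in>F. rpow (a i) \<alpha> * rpow (b i) \<beta>) \<le> rpow (\<Sum>i\<in>F. a i) \<alpha> * rpow (\<Sum>i\<in>F. b i) \<beta>"
proof -
  let ?s = "\<alpha> + \<beta>"
  have "(\<Sum>i\<in>F. rpow (a i) \<alpha> * rpow (b i) \<beta>)
      = (\<Sum>i\<in>F. rpow (rpow (a i) (\<alpha>/?s) * rpow (b i) (\<beta>/?s)) ?s)"
    using e ab by (auto intro!: sum.cong rpow_normalise)
  also have "\<dots> \<le> rpow (\<Sum>i\<in>F. rpow (a i) (\<alpha>/?s) * rpow (b i) (\<beta>/?s)) ?s"
    using e F by (intro sum_rpow_le) auto
  also have "\<dots> \<le> rpow (rpow (\<Sum>i\<in>F. a i) (\<alpha>/?s) * rpow (\<Sum>i\<in>F. b i) (\<beta>/?s)) ?s"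
    using e ab F by (intro rpow_mono Hoelder_sum_1) (auto intro: sum_nonneg simp flip: add_divide_distrib)
  also have "\<dots> = rpow (\<Sum>i\<in>F. a i) \<alpha> * rpow (\<Sum>i\<in>F. b i) \<beta>"
    using e ab by (intro rpow_normalise[symmetric]) (auto intro: sum_nonneg)
  finally show ?thesis .
qed

lemma Hoelder_infsum:
  assumes e: "0 \<le> \<alpha>" "0 \<le> \<beta>" "1 \<le> \<alpha> + \<beta>"
    and ab: "\<And>i. i \<in> I \<Longrightarrow> 0 \<le> a i" "\<And>i. i \<in> I \<Longrightarrow> 0 \<le> b i"
    and s: "a summable_on I" "b summable_on I"
  shows "(\<Sum>\<^sub>\<infinity>i\<in>I. rpow (a i) \<alpha> * rpow (b i) \<beta>) \<le> rpow (\<Sum>\<^sub>\<infinity>i\<in>I. a i) \<alpha> * rpow (\<Sum>\<^sub>\<infinity>i\<in>I. b i) \<beta>"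
    and "(\<lambda>i. rpow (a i) \<alpha> * rpow (b i) \<beta>) summable_on I"
proof -
  have fin: "(\<Sum>i\<in>F. rpow (a i) \<alpha> * rpow (b i) \<beta>)
      \<le> rpow (\<Sum>\<^sub>\<infinity>i\<in>I. a i) \<alpha> * rpow (\<Sum>\<^sub>\<infinity>i\<in>I. b i) \<beta>" if F: "finite F" "F \<subseteq> I" for F
  proof -
    have "(\<Sum>i\<in>F. rpow (a i) \<alpha> * rpow (b i) \<beta>) \<le> rpow (\<Sum>i\<in>F. a i) \<alpha> * rpow (\<Sum>i\<in>F. b i) \<beta>"
      using ab F by (intro Hoelder_sum e) auto
    also have "\<dots> \<le> rpow (\<Sum>\<^sub>\<infinity>i\<in>I. a i) \<alpha> * rpow (\<Sum>\<^sub>\<infinity>i\<in>I. b i) \<beta>"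
      using ab F s e
      by (intro mult_mono rpow_mono finite_sum_le_infsum) (auto intro!: sum_nonneg)
    finally show ?thesis .
  qed
  show sm: "(\<lambda>i. rpow (a i) \<alpha> * rpow (b i) \<beta>) summable_on I"
    using fin by (intro nonneg_bdd_above_summable_on) (auto intro!: bdd_aboveI2)
  show "(\<Sum>\<^sub>\<infinity>i\<in>I. rpow (a i) \<alpha> * rpow (b i) \<beta>) \<le> rpow (\<Sum>\<^sub>\<infinity>i\<in>I. a i) \<alpha> * rpow (\<Sum>\<^sub>\<infinity>i\<in>I. b i) \<beta>"
    using sm fin by (intro infsum_le_finite_sums) auto
qed

section \<open>Bounds for the forms of a matrix on finite sections\<close>

text \<open>For nonnegative matrices the sums over finite sections determine the norm and the numerical
  radius, and no question of convergence arises in them. The relation \<open>V\<close> selects the admissible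
  pairs of vectors: all pairs give the operator norm, equal pairs the numerical radius.\<close>

definition form_bound ::
    "((nat \<Rightarrow> real) \<Rightarrow> (nat \<Rightarrow> real) \<Rightarrow> bool) \<Rightarrow> nat set \<Rightarrow> matrix \<Rightarrow> real \<Rightarrow> bool" where
  "form_bound V R A C \<longleftrightarrow> (\<forall>F x y. finite F \<and> F \<subseteq> R \<and> V x y \<and> (\<forall>i. 0 \<le> x i) \<and> (\<forall>i. 0 \<le> y i) \<longrightarrow>
     (\<Sum>i\<in>F. \<Sum>j\<in>F. y i * A i j * x j) \<le> C * (L2_set x F * L2_set y F))"

abbreviation (input) all_pairs :: "(nat \<Rightarrow> real) \<Rightarrow> (nat \<Rightarrow> real) \<Rightarrow> bool" where
  "all_pairs \<equiv> (\<lambda>_ _. True)"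

abbreviation (input) hmean :: "real \<Rightarrow> real \<Rightarrow> matrix \<Rightarrow> matrix \<Rightarrow> matrix" where
  "hmean \<alpha> \<beta> A B \<equiv> hadamard (hadamard_pow A \<alpha>) (hadamard_pow B \<beta>)"

definition le_on :: "nat set \<Rightarrow> matrix \<Rightarrow> matrix \<Rightarrow> bool" where
  "le_on R A B \<longleftrightarrow> (\<forall>i\<in>R. \<forall>j\<in>R. A i j \<le> B i j)"

lemma hmean_apply: "hmean \<alpha> \<beta> A B i j = rpow (A i j) \<alpha> * rpow (B i j) \<beta>"
  by (simp add: hadamard_def hadamard_pow_def)

lemma le_onI: "(\<And>i j. i \<in> R \<Longrightarrow> j \<in> R \<Longrightarrow> A i j \<le> B i j) \<Longrightarrow> le_on R A B"
  by (simp add: le_on_def)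

lemma le_onD: "le_on R A B \<Longrightarrow> i \<in> R \<Longrightarrow> j \<in> R \<Longrightarrow> A i j \<le> B i j"
  by (simp add: le_on_def)

lemma le_on_trans: "le_on R A B \<Longrightarrow> le_on R B C \<Longrightarrow> le_on R A C"
  unfolding le_on_def by (meson order_trans)

lemma nonneg_matrixD: "nonneg_matrix R A \<Longrightarrow> i \<in> R \<Longrightarrow> j \<in> R \<Longrightarrow> 0 \<le> A i j"
  by (simp add: nonneg_matrix_def)

lemma nonneg_matrix_hmean [simp]: "nonneg_matrix R (hmean \<alpha> \<beta> A B)"
  by (simp add: nonneg_matrix_def hmean_apply)

lemma nonneg_matrix_adj [simp]: "nonneg_matrix R (mat_adj A) \<longleftrightarrow> nonneg_matrix R A"
  by (auto simp: nonneg_matrix_def mat_adj_def)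

lemma mat_adj_adj [simp]: "mat_adj (mat_adj A) = A"
  by (simp add: mat_adj_def)

lemma form_boundD:
  "\<lbrakk>form_bound V R A C; finite F; F \<subseteq> R; V x y; \<And>i. 0 \<le> x i; \<And>i. 0 \<le> y i\<rbrakk>
    \<Longrightarrow> (\<Sum>i\<in>F. \<Sum>j\<in>F. y i * A i j * x j) \<le> C * (L2_set x F * L2_set y F)"
  by (auto simp: form_bound_def)

lemma form_boundI:
  "(\<And>F x y. \<lbrakk>finite F; F \<subseteq> R; V x y; \<And>i. 0 \<le> x i; \<And>i. 0 \<le> y i\<rbrakk>
     \<Longrightarrow> (\<Sum>i\<in>F. \<Sum>j\<in>F. y i * A i j * x j) \<le> C * (L2_set x F * L2_set y F)) \<Longrightarrow> form_bound V R A C"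
  by (auto simp: form_bound_def)

lemma form_bound_mono:
  assumes "form_bound V R B C" "le_on R A B" "C \<le> C'"
  shows "form_bound V R A C'"
proof (rule form_boundI, goal_cases)
  case *: (1 F x y)
  have "(\<Sum>i\<in>F. \<Sum>j\<in>F. y i * A i j * x j) \<le> (\<Sum>i\<in>F. \<Sum>j\<in>F. y i * B i j * x j)"
    using * assms(2) by (intro sum_mono mult_right_mono mult_left_mono le_onD[of R A B]) auto
  also have "\<dots> \<le> C * (L2_set x F * L2_set y F)"
    using * by (intro form_boundD[OF assms(1)])
  also have "\<dots> \<le> C' * (L2_set x F * L2_set y F)"
    using assms(3) by (intro mult_right_mono) auto
  finally show ?case .
qed

lemma form_bound_scale:
  assumes "form_bound V R A C" "0 \<le> c"
  shows "form_bound V R (\<lambda>i j. c * A i j) (c * C)"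
proof (rule form_boundI, goal_cases)
  case *: (1 F x y)
  have "(\<Sum>i\<in>F. \<Sum>j\<in>F. y i * (c * A i j) * x j) = c * (\<Sum>i\<in>F. \<Sum>j\<in>F. y i * A i j * x j)"
    by (simp add: sum_distrib_left mult_ac)
  also have "\<dots> \<le> c * (C * (L2_set x F * L2_set y F))"
    using * assms(2) by (intro mult_left_mono form_boundD[OF assms(1)])
  finally show ?case
    by (simp add: mult_ac)
qed

lemma form_bound_add:
  assumes "form_bound V R A C" "form_bound V R B D"
  shows "form_bound V R (\<lambda>i j. A i j + B i j) (C + D)"
proof (rule form_boundI, goal_cases)
  case *: (1 F x y)
  have "(\<Sum>i\<in>F. \<Sum>j\<in>F. y i * (A i j + B i j) * x j)
      = (\<Sum>i\<in>F. \<Sum>j\<in>F. y i * A i j * x j) + (\<Sum>i\<in>F. \<Sum>j\<in>F. y i * B i j * x j)"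
    by (simp add: sum.distrib algebra_simps)
  also have "\<dots> \<le> C * (L2_set x F * L2_set y F) + D * (L2_set x F * L2_set y F)"
    using * by (intro add_mono form_boundD[OF assms(1)] form_boundD[OF assms(2)])
  finally show ?case
    by (simp add: algebra_simps)
qed

lemma form_bound_adj:
  assumes "form_bound V R A C" "symp V"
  shows "form_bound V R (mat_adj A) C"
proof (rule form_boundI, goal_cases)
  case *: (1 F x y)
  have "(\<Sum>i\<in>F. \<Sum>j\<in>F. y i * mat_adj A i j * x j) = (\<Sum>j\<in>F. \<Sum>i\<in>F. y i * mat_adj A i j * x j)"
    by (rule sum.swap)
  also have "\<dots> = (\<Sum>j\<in>F. \<Sum>i\<in>F. x j * A j i * y i)" by (simp add: mat_adj_def mult_ac)
  also have "\<dots> \<le> C * (L2_set y F * L2_set x F)"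
    using * sympD[OF assms(2)] by (intro form_boundD[OF assms(1)])
  finally show ?case
    by (simp add: mult_ac)
qed

text \<open>The double sum of the geometric means is bounded by Hoelder's inequality on \<open>F \<times> F\<close>,
  the weights \<open>y\<^sub>i x\<^sub>j\<close> being split as \<open>(y\<^sub>i x\<^sub>j)\<^sup>\<alpha> (y\<^sub>i x\<^sub>j)\<^sup>\<beta>\<close>. The vectors do not change, so the
  argument serves the operator norm and the numerical radius alike.\<close>

lemma form_bound_hmean_1:
  assumes A: "form_bound V R A a" "nonneg_matrix R A" and B: "form_bound V R B b" "nonneg_matrix R B"
    and e: "0 \<le> \<alpha>" "0 \<le> \<beta>" "\<alpha> + \<beta> = 1" and ab: "0 \<le> a" "0 \<le> b"
  shows "form_bound V R (hmean \<alpha> \<beta> A B) (rpow a \<alpha> * rpow b \<beta>)"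
proof (rule form_boundI, goal_cases)
  case *: (1 F x y)
  define N where "N = L2_set x F * L2_set y F"
  have N: "0 \<le> N" by (simp add: N_def)
  define u where "u M = (\<lambda>(i, j). y i * M i j * x j)" for M :: matrix
  have u0: "0 \<le> u M p" if "nonneg_matrix R M" "p \<in> F \<times> F" for M p
    using that * by (auto simp: u_def intro!: mult_nonneg_nonneg nonneg_matrixD[of R M])
  have sum_u: "(\<Sum>i\<in>F. \<Sum>j\<in>F. y i * M i j * x j) = sum (u M) (F \<times> F)" for M
    by (simp add: u_def sum.cartesian_product)
  have w1: "rpow w \<alpha> * rpow w \<beta> = w" if "0 \<le> w" for w
    using rpow_add[of w \<alpha> \<beta>] that e by simp
  have "sum (u (hmean \<alpha> \<beta> A B)) (F \<times> F) = (\<Sum>p\<in>F\<times>F. rpow (u A p) \<alpha> * rpow (u B p) \<beta>)"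
  proof (rule sum.cong[OF refl])
    fix p assume "p \<in> F \<times> F"
    then obtain i j where p: "p = (i, j)" "i \<in> F" "j \<in> F" by auto
    have nn: "0 \<le> A i j" "0 \<le> B i j" using p * A B by (auto intro: nonneg_matrixD)
    have "u (hmean \<alpha> \<beta> A B) p = (rpow (y i) \<alpha> * rpow (y i) \<beta>) * (rpow (A i j) \<alpha> * rpow (B i j) \<beta>)
        * (rpow (x j) \<alpha> * rpow (x j) \<beta>)"
      using * by (simp add: u_def p hmean_apply w1)
    also have "\<dots> = rpow (u A p) \<alpha> * rpow (u B p) \<beta>"
      using * nn by (simp add: u_def p rpow_mult)
    finally show "u (hmean \<alpha> \<beta> A B) p = rpow (u A p) \<alpha> * rpow (u B p) \<beta>" .
  qed
  also have "\<dots> \<le> rpow (sum (u A) (F \<times> F)) \<alpha> * rpow (sum (u B) (F \<times> F)) \<beta>"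
    using e u0 A B * by (intro Hoelder_sum_1) auto
  also have "\<dots> \<le> rpow (a * N) \<alpha> * rpow (b * N) \<beta>"
    using form_boundD[OF A(1) *] form_boundD[OF B(1) *] e u0[OF A(2)] u0[OF B(2)]
    unfolding N_def sum_u by (intro mult_mono rpow_mono sum_nonneg) simp_all
  also have "\<dots> = rpow a \<alpha> * rpow b \<beta> * (rpow N \<alpha> * rpow N \<beta>)"
    using ab N by (simp add: rpow_mult)
  also have "\<dots> = rpow a \<alpha> * rpow b \<beta> * N" by (simp only: w1[OF N])
  finally show ?case
    by (simp add: sum_u N_def)
qed

text \<open>The vector \<open>x\<close> is the \<open>i\<close>th row itself, tested against the \<open>i\<close>th unit vector.\<close>

lemma form_bound_row:
  assumes A: "form_bound all_pairs R A C" "nonneg_matrix R A" and F: "finite F" "F \<subseteq> R" and i: "i \<in> R"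
  shows "L2_set (A i) F \<le> C"
proof -
  let ?G = "insert i F"
  define x where "x = (\<lambda>j. if j \<in> ?G then A i j else 0)"
  define y :: "nat \<Rightarrow> real" where "y = (\<lambda>k. if k = i then 1 else 0)"
  have x0: "0 \<le> x j" for j using A F i by (auto simp: x_def intro!: nonneg_matrixD[of R A])
  have y1: "L2_set y ?G = 1" using F by (simp add: L2_set_def y_def if_distrib[of "\<lambda>t. t^2"] cong: if_cong)
  have "(L2_set x ?G)\<^sup>2 = (\<Sum>j\<in>?G. (x j)\<^sup>2)" by (simp add: L2_set_def sum_nonneg)
  also have "\<dots> = (\<Sum>j\<in>?G. 1 * A i j * x j)" by (rule sum.cong) (auto simp: x_def power2_eq_square)
  also have "\<dots> = (\<Sum>k\<in>?G. if k = i then \<Sum>j\<in>?G. 1 * A k j * x j else 0)" using F by (subst sum.delta) auto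
  also have "\<dots> = (\<Sum>k\<in>?G. \<Sum>j\<in>?G. y k * A k j * x j)"
    by (rule sum.cong) (auto simp: y_def)
  also have "\<dots> \<le> C * (L2_set x ?G * L2_set y ?G)"
    using F i x0 by (intro form_boundD[OF A(1)]) (auto simp: y_def)
  finally have "L2_set x ?G * L2_set x ?G \<le> C * L2_set x ?G" by (simp add: y1 power2_eq_square)
  moreover have "0 \<le> C"
  proof -
    have "0 \<le> A i i" using A i by (auto intro: nonneg_matrixD)
    also have "\<dots> \<le> C" using form_boundD[OF A(1), of "{i}" y y] i by (simp add: y_def)
    finally show ?thesis .
  qed
  ultimately have "L2_set x ?G \<le> C" using L2_set_nonneg[of x ?G] by (cases "L2_set x ?G = 0") auto
  moreover have "L2_set (A i) F \<le> L2_set x ?G"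
    unfolding L2_set_def using F by (intro real_sqrt_le_mono) (auto intro!: sum_mono2 simp: x_def)
  ultimately show ?thesis by simp
qed

lemma form_bound_diagonal:
  assumes "form_bound V R A C" "reflp V" "i \<in> R"
  shows "A i i \<le> C"
  using form_boundD[OF assms(1), of "{i}" "\<lambda>_. 1" "\<lambda>_. 1"] assms reflpD[OF assms(2)] by simp

lemma form_bound_nonneg:
  assumes "form_bound V R A C" "reflp V" "nonneg_matrix R A" "R \<noteq> {}"
  shows "0 \<le> C"
proof -
  obtain i where i: "i \<in> R" using assms by auto
  then have "0 \<le> A i i" using assms by (auto intro: nonneg_matrixD)
  also have "\<dots> \<le> C" using form_bound_diagonal[OF assms(1,2) i] .
  finally show ?thesis .
qed

lemma form_bound_entry:
  assumes "form_bound all_pairs R A C" "nonneg_matrix R A" "i \<in> R" "j \<in> R"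
  shows "A i j \<le> C"
  using form_bound_row[OF assms(1,2), of "{j}" i] assms by (simp add: nonneg_matrixD)

text \<open>If \<open>s = \<alpha> + \<beta> > 1\<close>, the surplus power \<open>s - 1\<close> of the entries is absorbed by the bounds,
  which dominate the entries.\<close>

lemma hmean_le_scaled:
  assumes e: "0 \<le> \<alpha>" "0 \<le> \<beta>" "1 \<le> \<alpha> + \<beta>"
    and ab: "0 \<le> x" "x \<le> a" "0 \<le> y" "y \<le> b"
  shows "rpow x \<alpha> * rpow y \<beta>
    \<le> rpow (rpow a (\<alpha>/(\<alpha>+\<beta>)) * rpow b (\<beta>/(\<alpha>+\<beta>))) (\<alpha>+\<beta>-1)
        * (rpow x (\<alpha>/(\<alpha>+\<beta>)) * rpow y (\<beta>/(\<alpha>+\<beta>)))"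
proof -
  let ?g = "\<lambda>x y. rpow x (\<alpha>/(\<alpha>+\<beta>)) * rpow y (\<beta>/(\<alpha>+\<beta>))"
  have "rpow x \<alpha> * rpow y \<beta> = rpow (?g x y) (1 + (\<alpha>+\<beta>-1))"
    using rpow_normalise[OF e, of x y] ab by simp
  also have "\<dots> = ?g x y * rpow (?g x y) (\<alpha>+\<beta>-1)"
    using e by (subst rpow_add) auto
  also have "\<dots> \<le> ?g x y * rpow (?g a b) (\<alpha>+\<beta>-1)"
    using e ab by (intro mult_left_mono rpow_mono mult_mono) auto
  finally show ?thesis by (simp add: mult_ac)
qed

lemma form_bound_hmean:
  assumes A: "form_bound all_pairs R A a" "nonneg_matrix R A"
    and B: "form_bound all_pairs R B b" "nonneg_matrix R B"
    and e: "0 \<le> \<alpha>" "0 \<le> \<beta>" "1 \<le> \<alpha> + \<beta>" and ab: "0 \<le> a" "0 \<le> b"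
  shows "form_bound all_pairs R (hmean \<alpha> \<beta> A B) (rpow a \<alpha> * rpow b \<beta>)"
proof -
  let ?s = "\<alpha> + \<beta>"
  let ?g = "\<lambda>x y. rpow x (\<alpha>/?s) * rpow y (\<beta>/?s)"
  have "form_bound all_pairs R (hmean (\<alpha>/?s) (\<beta>/?s) A B) (?g a b)"
    using e by (intro form_bound_hmean_1 A B ab) (auto simp flip: add_divide_distrib)
  then have "form_bound all_pairs R (\<lambda>i j. rpow (?g a b) (?s - 1) * hmean (\<alpha>/?s) (\<beta>/?s) A B i j)
      (rpow (?g a b) (?s - 1) * ?g a b)"
    by (rule form_bound_scale) simp
  moreover have "rpow (?g a b) (?s - 1) * ?g a b = rpow (?g a b) ((?s - 1) + 1)"
    using e by (subst rpow_add) auto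
  then have "rpow (?g a b) (?s - 1) * ?g a b = rpow a \<alpha> * rpow b \<beta>"
    using rpow_normalise[OF e ab] by simp
  moreover have "le_on R (hmean \<alpha> \<beta> A B) (\<lambda>i j. rpow (?g a b) (?s - 1) * hmean (\<alpha>/?s) (\<beta>/?s) A B i j)"
    unfolding hmean_apply
    by (intro le_onI hmean_le_scaled e form_bound_entry[OF A] form_bound_entry[OF B]
        nonneg_matrixD[OF A(2)] nonneg_matrixD[OF B(2)])
  ultimately show ?thesis by (metis form_bound_mono order_refl)
qed

section \<open>Square summable sequences\<close>

lemma l2I:
  assumes "\<And>i. i \<notin> R \<Longrightarrow> x i = 0" and le: "\<And>F. finite F \<Longrightarrow> F \<subseteq> R \<Longrightarrow> L2_set (\<lambda>i. cmod (x i)) F \<le> C"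
  shows "x \<in> l2 R" "l2_norm R x \<le> C"
proof -
  have C: "0 \<le> C" using le[of "{}"] by simp
  have fin: "(\<Sum>i\<in>F. (cmod (x i))\<^sup>2) \<le> C\<^sup>2" if "finite F" "F \<subseteq> R" for F
    using le[OF that] C by (simp add: L2_set_def sum_nonneg sqrt_le_D real_le_lsqrt)
  have sm: "(\<lambda>i. (cmod (x i))\<^sup>2) summable_on R"
    using fin by (intro nonneg_bdd_above_summable_on) (auto intro!: bdd_aboveI2)
  then show "x \<in> l2 R" using assms by (simp add: l2_def)
  have "(\<Sum>\<^sub>\<infinity>i\<in>R. (cmod (x i))\<^sup>2) \<le> C\<^sup>2" using sm fin by (intro infsum_le_finite_sums) auto
  then show "l2_norm R x \<le> C" using C by (simp add: l2_norm_def real_le_lsqrt)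
qed

lemma L2_set_le_l2_norm:
  assumes "x \<in> l2 R" "finite F" "F \<subseteq> R"
  shows "L2_set (\<lambda>i. cmod (x i)) F \<le> l2_norm R x"
  using assms unfolding l2_norm_def L2_set_def
  by (intro real_sqrt_le_mono finite_sum_le_infsum) (auto simp: l2_def)

lemma l2_outside: "x \<in> l2 R \<Longrightarrow> i \<notin> R \<Longrightarrow> x i = 0"
  by (simp add: l2_def)

lemma l2_norm_nonneg [simp]: "0 \<le> l2_norm R x"
  by (simp add: l2_norm_def infsum_nonneg)

lemma cmod_le_l2_norm: "x \<in> l2 R \<Longrightarrow> cmod (x i) \<le> l2_norm R x"
  using L2_set_le_l2_norm[of x R "{i}"] by (cases "i \<in> R") (auto simp: l2_outside)

lemma l2_add:
  assumes "x \<in> l2 R" "y \<in> l2 R"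
  shows "(\<lambda>i. x i + y i) \<in> l2 R" "l2_norm R (\<lambda>i. x i + y i) \<le> l2_norm R x + l2_norm R y"
proof -
  have "L2_set (\<lambda>i. cmod (x i + y i)) F \<le> l2_norm R x + l2_norm R y" if "finite F" "F \<subseteq> R" for F
  proof -
    have "L2_set (\<lambda>i. cmod (x i + y i)) F \<le> L2_set (\<lambda>i. cmod (x i) + cmod (y i)) F"
      by (rule L2_set_mono) (auto intro: norm_triangle_ineq)
    also have "\<dots> \<le> L2_set (\<lambda>i. cmod (x i)) F + L2_set (\<lambda>i. cmod (y i)) F" by (rule L2_set_triangle_ineq)
    finally show ?thesis
      using L2_set_le_l2_norm[OF assms(1) that] L2_set_le_l2_norm[OF assms(2) that] by simp
  qed
  moreover have "x i + y i = 0" if "i \<notin> R" for i using assms that by (simp add: l2_outside)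
  moreover note l2I[of R "\<lambda>i. x i + y i" "l2_norm R x + l2_norm R y"]
  ultimately show "(\<lambda>i. x i + y i) \<in> l2 R" "l2_norm R (\<lambda>i. x i + y i) \<le> l2_norm R x + l2_norm R y"
    by blast+
qed

lemma l2_scale:
  assumes "x \<in> l2 R"
  shows "(\<lambda>i. c * x i) \<in> l2 R" "l2_norm R (\<lambda>i. c * x i) = cmod c * l2_norm R x"
proof -
  show "(\<lambda>i. c * x i) \<in> l2 R" using assms
    by (auto simp: l2_def norm_mult power_mult_distrib intro: summable_on_cmult_right)
  show "l2_norm R (\<lambda>i. c * x i) = cmod c * l2_norm R x"
    by (simp add: l2_norm_def norm_mult power_mult_distrib infsum_cmult_right' real_sqrt_mult)
qed

lemma l2_diff:
  assumes "x \<in> l2 R" "y \<in> l2 R"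
  shows "(\<lambda>i. x i - y i) \<in> l2 R" "l2_norm R (\<lambda>i. x i - y i) \<le> l2_norm R x + l2_norm R y"
  using l2_add[OF assms(1) l2_scale(1)[OF assms(2), of "-1"]] l2_scale(2)[OF assms(2), of "-1"] by auto

lemma l2_zero [simp]: "(\<lambda>_. 0) \<in> l2 R" "l2_norm R (\<lambda>_. 0) = 0"
  by (auto simp: l2_def l2_norm_def)

lemma l2_norm_eq_0: "x \<in> l2 R \<Longrightarrow> l2_norm R x = 0 \<Longrightarrow> x = (\<lambda>_. 0)"
  using cmod_le_l2_norm[of x R] by (intro ext) (simp add: order_antisym_conv)

definition modulus :: "(nat \<Rightarrow> complex) \<Rightarrow> nat \<Rightarrow> complex" where
  "modulus x = (\<lambda>i. complex_of_real (cmod (x i)))"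

lemma l2_modulus [simp]: "modulus x \<in> l2 R \<longleftrightarrow> x \<in> l2 R" "l2_norm R (modulus x) = l2_norm R x"
  by (auto simp: l2_def l2_norm_def modulus_def)

definition finite_vec :: "nat set \<Rightarrow> (nat \<Rightarrow> real) \<Rightarrow> nat \<Rightarrow> complex" where
  "finite_vec F x = (\<lambda>i. if i \<in> F then complex_of_real (x i) else 0)"

lemma finite_vec_l2:
  assumes "finite F" "F \<subseteq> R"
  shows "finite_vec F x \<in> l2 R" "l2_norm R (finite_vec F x) = L2_set x F"
proof -
  have *: "((\<lambda>i. (cmod (finite_vec F x i))\<^sup>2) has_sum (\<Sum>i\<in>F. (x i)\<^sup>2)) R"
    using assms by (intro has_sum_finite_neutralI[of F]) (auto simp: finite_vec_def)
  then show "finite_vec F x \<in> l2 R"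
    using assms by (auto simp: l2_def finite_vec_def summable_on_def)
  show "l2_norm R (finite_vec F x) = L2_set x F"
    using * by (simp add: l2_norm_def L2_set_def infsumI)
qed

abbreviation unit_vec :: "nat \<Rightarrow> nat \<Rightarrow> complex" where
  "unit_vec j \<equiv> finite_vec {j} (\<lambda>_. 1)"

lemma l2_normalise:
  assumes "x \<in> l2 R" "l2_norm R x \<noteq> 0"
  obtains u where "u \<in> l2 R" "l2_norm R u = 1" "x = (\<lambda>i. complex_of_real (l2_norm R x) * u i)"
proof
  let ?u = "\<lambda>i. complex_of_real (inverse (l2_norm R x)) * x i"
  show "?u \<in> l2 R" using assms by (intro l2_scale)
  show "l2_norm R ?u = 1" using assms l2_scale(2)[OF assms(1), of "complex_of_real (inverse (l2_norm R x))"]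
    by (simp add: norm_inverse)
  show "x = (\<lambda>i. complex_of_real (l2_norm R x) * ?u i)" using assms by (auto simp flip: of_real_mult mult.assoc)
qed

section \<open>Nonnegative matrices as operators\<close>

definition pos_op :: "nat set \<Rightarrow> matrix \<Rightarrow> bool" where
  "pos_op R A \<longleftrightarrow> nonneg_matrix R A \<and> defines_operator R A"

text \<open>The finite bounds pass to infinite double sums. Absolute convergence of the double series is
  what permits the exchange of summations for products of matrices.\<close>

lemma form_double_sum:
  assumes A: "form_bound V R A C" "nonneg_matrix R A" and C: "0 \<le> C"
    and xy: "V x y" "\<And>i. 0 \<le> x i" "\<And>i. 0 \<le> y i"
    and X: "\<And>F. finite F \<Longrightarrow> F \<subseteq> R \<Longrightarrow> L2_set x F \<le> X"
    and Y: "\<And>F. finite F \<Longrightarrow> F \<subseteq> R \<Longrightarrow> L2_set y F \<le> Y"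
  shows "(\<lambda>(i, j). y i * A i j * x j) summable_on R \<times> R"
    and "(\<Sum>\<^sub>\<infinity>i\<in>R. \<Sum>\<^sub>\<infinity>j\<in>R. y i * A i j * x j) \<le> C * (X * Y)"
proof -
  let ?f = "\<lambda>(i, j). y i * A i j * x j"
  have f0: "0 \<le> ?f p" if "p \<in> R \<times> R" for p
    using that xy by (auto intro!: mult_nonneg_nonneg nonneg_matrixD[OF A(2)])
  have fin: "sum ?f H \<le> C * (X * Y)" if H: "finite H" "H \<subseteq> R \<times> R" for H
  proof -
    define F where "F = fst ` H \<union> snd ` H"
    have F: "finite F" "F \<subseteq> R" "H \<subseteq> F \<times> F" using H by (force simp: F_def)+
    have "sum ?f H \<le> sum ?f (F \<times> F)"
      using F f0 by (intro sum_mono2) blast+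
    also have "\<dots> = (\<Sum>i\<in>F. \<Sum>j\<in>F. y i * A i j * x j)" by (simp add: sum.cartesian_product)
    also have "\<dots> \<le> C * (L2_set x F * L2_set y F)" by (rule form_boundD[OF A(1) F(1,2) xy])
    also have "\<dots> \<le> C * (X * Y)"
      using X[OF F(1,2)] Y[OF F(1,2)] order_trans[OF L2_set_nonneg X[OF F(1,2)]] C
      by (intro mult_left_mono mult_mono) auto
    finally show ?thesis .
  qed
  show s: "?f summable_on R \<times> R"
    using fin f0 by (intro nonneg_bdd_above_summable_on) (auto intro!: bdd_aboveI2[where M = "C * (X * Y)"])
  have "(\<Sum>\<^sub>\<infinity>i\<in>R. \<Sum>\<^sub>\<infinity>j\<in>R. y i * A i j * x j) = infsum ?f (R \<times> R)"
    using s by (rule infsum_Sigma'_banach)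
  also have "\<dots> \<le> C * (X * Y)" using s fin by (rule infsum_le_finite_sums)
  finally show "(\<Sum>\<^sub>\<infinity>i\<in>R. \<Sum>\<^sub>\<infinity>j\<in>R. y i * A i j * x j) \<le> C * (X * Y)" .
qed

lemma summable_on_of_real_complex_iff:
  "(\<lambda>i. complex_of_real (f i)) summable_on I \<longleftrightarrow> f summable_on I"
  using summable_on_Re[of "\<lambda>i. complex_of_real (f i)" I] summable_on_of_real[of f I] by auto

lemma infsum_of_real_complex:
  "(\<Sum>\<^sub>\<infinity>i\<in>I. complex_of_real (f i)) = complex_of_real (\<Sum>\<^sub>\<infinity>i\<in>I. f i)"
proof (cases "f summable_on I")
  case True
  then show ?thesis by (intro infsumI has_sum_of_real has_sum_infsum)
next
  case False
  then show ?thesis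
    using summable_on_of_real_complex_iff[of f I] by (simp add: infsum_not_exists)
qed

definition row_sum :: "nat set \<Rightarrow> matrix \<Rightarrow> (nat \<Rightarrow> complex) \<Rightarrow> nat \<Rightarrow> real" where
  "row_sum R A x i = (\<Sum>\<^sub>\<infinity>j\<in>R. A i j * cmod (x j))"

lemma mat_op_modulus: "i \<in> R \<Longrightarrow> mat_op R A (modulus x) i = complex_of_real (row_sum R A x i)"
  by (simp add: mat_op_def row_sum_def modulus_def infsum_of_real_complex flip: of_real_mult)

lemma pos_op_row_summable:
  assumes "pos_op R A" "x \<in> l2 R" "i \<in> R"
  shows "(\<lambda>j. A i j * cmod (x j)) summable_on R"
proof -
  have "modulus x \<in> l2 R" using assms by simp
  then have "(\<lambda>j. complex_of_real (A i j) * modulus x j) summable_on R"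
    using assms by (auto simp: pos_op_def defines_operator_def)
  then show ?thesis
    using summable_on_of_real_complex_iff[of "\<lambda>j. A i j * cmod (x j)" R] by (simp add: modulus_def)
qed

lemma row_sum_dominates:
  assumes nn: "nonneg_matrix R A" and i: "i \<in> R" and s: "(\<lambda>j. A i j * cmod (x j)) summable_on R"
  shows "(\<lambda>j. cmod (complex_of_real (A i j) * x j)) summable_on R"
    and "cmod (mat_op R A x i) \<le> row_sum R A x i"
proof -
  have eq: "cmod (complex_of_real (A i j) * x j) = A i j * cmod (x j)" if "j \<in> R" for j
    using nonneg_matrixD[OF nn i that] by (simp add: norm_mult)
  show abs: "(\<lambda>j. cmod (complex_of_real (A i j) * x j)) summable_on R"
    using s summable_on_cong[of R "\<lambda>j. cmod (complex_of_real (A i j) * x j)" "\<lambda>j. A i j * cmod (x j)"] eq by simp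
  show "cmod (mat_op R A x i) \<le> row_sum R A x i"
    using norm_infsum_bound[OF abs] i
      infsum_cong[of R "\<lambda>j. cmod (complex_of_real (A i j) * x j)" "\<lambda>j. A i j * cmod (x j)"] eq
    by (simp add: mat_op_def row_sum_def)
qed

lemma pos_op_row:
  assumes "pos_op R A" "x \<in> l2 R" "i \<in> R"
  shows pos_op_row_abs_summable: "(\<lambda>j. cmod (complex_of_real (A i j) * x j)) summable_on R"
    and cmod_mat_op_le: "cmod (mat_op R A x i) \<le> row_sum R A x i"
  using row_sum_dominates[where A = A and x = x, OF _ assms(3) pos_op_row_summable[OF assms]] assms(1)
  by (auto simp: pos_op_def)

lemma pos_op_l2: "\<lbrakk>pos_op R A; x \<in> l2 R\<rbrakk> \<Longrightarrow> mat_op R A x \<in> l2 R"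
  by (simp add: pos_op_def defines_operator_def)

lemma row_sum_nonneg: "nonneg_matrix R A \<Longrightarrow> i \<in> R \<Longrightarrow> 0 \<le> row_sum R A x i"
  unfolding row_sum_def by (intro infsum_nonneg) (auto simp: nonneg_matrixD)

lemma mat_op_outside: "i \<notin> R \<Longrightarrow> mat_op R A x i = 0"
  by (simp add: mat_op_def)

lemma mat_op_scale: "mat_op R A (\<lambda>i. c * x i) = (\<lambda>i. c * mat_op R A x i)"
  by (auto simp: mat_op_def fun_eq_iff mult.left_commute infsum_cmult_right')

lemma mat_op_linear:
  assumes A: "pos_op R A" and "x \<in> l2 R" "y \<in> l2 R"
  shows "mat_op R A (\<lambda>i. x i + y i) = (\<lambda>i. mat_op R A x i + mat_op R A y i)"
    and "mat_op R A (\<lambda>i. x i - y i) = (\<lambda>i. mat_op R A x i - mat_op R A y i)"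
proof -
  have *: "mat_op R A (\<lambda>i. u i + v i) = (\<lambda>i. mat_op R A u i + mat_op R A v i)"
    if "u \<in> l2 R" "v \<in> l2 R" for u v
  proof (rule ext)
    fix i
    show "mat_op R A (\<lambda>i. u i + v i) i = mat_op R A u i + mat_op R A v i"
      using infsum_add[OF abs_summable_summable[OF pos_op_row_abs_summable[OF A that(1)]]
          abs_summable_summable[OF pos_op_row_abs_summable[OF A that(2)]], of i]
      by (simp add: mat_op_def distrib_left)
  qed
  show "mat_op R A (\<lambda>i. x i + y i) = (\<lambda>i. mat_op R A x i + mat_op R A y i)"
    using assms by (intro *)
  show "mat_op R A (\<lambda>i. x i - y i) = (\<lambda>i. mat_op R A x i - mat_op R A y i)"
    using *[OF assms(2) l2_scale(1)[OF assms(3)], of "-1"] mat_op_scale[of R A "-1" y] by simp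
qed

lemma mat_op_finite_vec:
  assumes "finite F" "F \<subseteq> R" "i \<in> R"
  shows "mat_op R A (finite_vec F x) i = complex_of_real (\<Sum>j\<in>F. A i j * x j)"
proof -
  have "((\<lambda>j. complex_of_real (A i j) * finite_vec F x j) has_sum (\<Sum>j\<in>F. complex_of_real (A i j * x j))) R"
    using assms by (intro has_sum_finite_neutralI[of F]) (auto simp: finite_vec_def)
  then show ?thesis using assms by (simp add: mat_op_def infsumI)
qed

lemma mat_op_unit_vec: "i \<in> R \<Longrightarrow> j \<in> R \<Longrightarrow> mat_op R A (unit_vec j) i = complex_of_real (A i j)"
  by (simp add: mat_op_finite_vec)

subsection \<open>Boundedness\<close>

text \<open>Testing the form against \<open>y = |A x|\<close>, cut off to a finite set \<open>F\<close>, gives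
  \<open>\<parallel>A x\<parallel>\<^sup>2 \<le> C \<parallel>x\<parallel> \<parallel>A x\<parallel>\<close> with the norms of \<open>A x\<close> taken over \<open>F\<close>.\<close>

lemma form_bound_imp_operator:
  assumes A: "form_bound all_pairs R A C" "nonneg_matrix R A" and C: "0 \<le> C"
  shows "pos_op R A" and "x \<in> l2 R \<Longrightarrow> l2_norm R (mat_op R A x) \<le> C * l2_norm R x"
proof -
  have main: "(\<forall>i\<in>R. (\<lambda>j. complex_of_real (A i j) * x j) summable_on R) \<and>
      mat_op R A x \<in> l2 R \<and> l2_norm R (mat_op R A x) \<le> C * l2_norm R x" if x: "x \<in> l2 R" for x
  proof -
    have x': "L2_set (\<lambda>i. cmod (x i)) F \<le> l2_norm R x" if "finite F" "F \<subseteq> R" for F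
      using L2_set_le_l2_norm[OF x that] .
    have ds: "(\<lambda>(i, j). y i * A i j * cmod (x j)) summable_on R \<times> R"
      "(\<Sum>\<^sub>\<infinity>i\<in>R. \<Sum>\<^sub>\<infinity>j\<in>R. y i * A i j * cmod (x j)) \<le> C * (l2_norm R x * Y)"
      if "\<And>i. 0 \<le> y i" "\<And>F. finite F \<Longrightarrow> F \<subseteq> R \<Longrightarrow> L2_set y F \<le> Y" for y Y
      using form_double_sum[OF A C, of "\<lambda>i. cmod (x i)" y, OF _ _ that(1) x' that(2)] by auto
    have rows: "(\<lambda>j. A i j * cmod (x j)) summable_on R" if i: "i \<in> R" for i
    proof -
      define y :: "nat \<Rightarrow> real" where "y = (\<lambda>k. if k = i then 1 else 0)"
      have "L2_set y F \<le> 1" if "finite F" for F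
        using that by (simp add: L2_set_def y_def if_distrib[of "\<lambda>t. t^2"] sum.delta cong: if_cong)
      then have "(\<lambda>(k, j). y k * A k j * cmod (x j)) summable_on R \<times> R"
        by (intro ds(1)[of y 1]) (auto simp: y_def)
      then have "(\<lambda>j. y i * A i j * cmod (x j)) summable_on R"
        by (rule summable_on_SigmaD1[OF _ i])
      then show ?thesis by (simp add: y_def)
    qed
    have abs: "(\<lambda>j. cmod (complex_of_real (A i j) * x j)) summable_on R"
      and le: "cmod (mat_op R A x i) \<le> row_sum R A x i" if "i \<in> R" for i
      using row_sum_dominates[where A = A and x = x, OF A(2) that rows[OF that]] by auto+
    have fin: "L2_set (\<lambda>i. cmod (mat_op R A x i)) F \<le> C * l2_norm R x" if F: "finite F" "F \<subseteq> R" for F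
    proof -
      let ?u = "\<lambda>i. cmod (mat_op R A x i)"
      define y where "y i = (if i \<in> F then ?u i else 0)" for i
      have y0: "0 \<le> y i" for i by (simp add: y_def)
      have y: "L2_set y G \<le> L2_set ?u F" if "finite G" for G
      proof -
        have "(\<Sum>i\<in>G. (y i)\<^sup>2) = (\<Sum>i\<in>G\<inter>F. (?u i)\<^sup>2)"
          by (rule sum.mono_neutral_cong_right) (use that in \<open>auto simp: y_def\<close>)
        also have "\<dots> \<le> (\<Sum>i\<in>F. (?u i)\<^sup>2)" using F by (intro sum_mono2) auto
        finally show ?thesis by (simp add: L2_set_def)
      qed
      have "(L2_set ?u F)\<^sup>2 = (\<Sum>i\<in>F. ?u i * ?u i)" by (simp add: L2_set_def sum_nonneg power2_eq_square)
      also have "\<dots> \<le> (\<Sum>i\<in>F. y i * row_sum R A x i)"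
        using F by (intro sum_mono) (auto simp: y_def intro!: mult_left_mono le)
      also have "\<dots> = (\<Sum>i\<in>F. \<Sum>\<^sub>\<infinity>j\<in>R. y i * A i j * cmod (x j))"
        by (simp add: row_sum_def mult.assoc infsum_cmult_right')
      also have "\<dots> \<le> (\<Sum>\<^sub>\<infinity>i\<in>R. \<Sum>\<^sub>\<infinity>j\<in>R. y i * A i j * cmod (x j))"
        using F summable_on_Sigma_banach[OF ds(1)[OF y0 y]] A(2)
        by (intro finite_sum_le_infsum) (auto intro!: infsum_nonneg mult_nonneg_nonneg y0 nonneg_matrixD[OF A(2)])
      also have "\<dots> \<le> C * (l2_norm R x * L2_set ?u F)" by (rule ds(2)[OF y0 y])
      finally have "L2_set ?u F * L2_set ?u F \<le> C * l2_norm R x * L2_set ?u F"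
        by (simp add: power2_eq_square mult_ac)
      then show ?thesis
        using C L2_set_nonneg[of ?u F] by (cases "L2_set ?u F = 0") (auto intro: mult_nonneg_nonneg)
    qed
    show ?thesis
      using abs_summable_summable[OF abs] l2I[OF mat_op_outside fin] by blast
  qed
  show "pos_op R A" using main A by (auto simp: pos_op_def defines_operator_def)
  show "x \<in> l2 R \<Longrightarrow> l2_norm R (mat_op R A x) \<le> C * l2_norm R x" using main by blast
qed

text \<open>Automatic boundedness. If no bound holds, unit vectors \<open>x\<^sub>n\<close>, \<open>y\<^sub>n\<close> exist on which the form
  exceeds \<open>4\<^sup>n\<close>. Since all entries are nonnegative, the single square summable vector with
  \<open>X\<^sub>i\<^sup>2 = \<Sum>\<^sub>n 2\<^sup>-\<^sup>n (x\<^sub>n)\<^sub>i\<^sup>2\<close> dominates every \<open>2\<^sup>-\<^sup>n x\<^sub>n\<close>, so that the norm of \<open>A X\<close> exceeds every \<open>2\<^sup>n\<close>.\<close>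

lemma pos_op_form_bound:
  assumes A: "pos_op R A"
  shows "\<exists>C\<ge>0. form_bound all_pairs R A C"
proof (rule ccontr)
  assume contra: "\<not> (\<exists>C\<ge>0. form_bound all_pairs R A C)"
  have nn: "nonneg_matrix R A" using A by (simp add: pos_op_def)
  define Q where "Q n F x y \<longleftrightarrow> finite F \<and> F \<subseteq> R \<and> (\<forall>i. 0 \<le> x i) \<and> (\<forall>i. 0 \<le> y i) \<and> (\<forall>i. i \<notin> F \<longrightarrow> x i = 0)
      \<and> L2_set x F = 1 \<and> L2_set y F = 1 \<and> 4 ^ n < (\<Sum>i\<in>F. \<Sum>j\<in>F. y i * A i j * x j)"
    for n :: nat and F x y
  have "\<exists>F x y. Q n F x y" for n
  proof -
    have "\<not> form_bound all_pairs R A (4 ^ n)" using contra by auto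
    then obtain F x y where F: "finite F" "F \<subseteq> R" and xy: "\<And>i. 0 \<le> x i" "\<And>i. 0 \<le> y i"
      and gt: "4 ^ n * (L2_set x F * L2_set y F) < (\<Sum>i\<in>F. \<Sum>j\<in>F. y i * A i j * x j)"
      unfolding form_bound_def by (auto simp: not_le)
    define a b where "a = L2_set x F" and "b = L2_set y F"
    have "a \<noteq> 0"
    proof
      assume "a = 0"
      then have "\<forall>i\<in>F. x i = 0" using F by (simp add: a_def L2_set_eq_0_iff)
      then show False using gt \<open>a = 0\<close> by (simp add: a_def)
    qed
    moreover have "b \<noteq> 0"
    proof
      assume "b = 0"
      then have "\<forall>i\<in>F. y i = 0" using F by (simp add: b_def L2_set_eq_0_iff)
      then show False using gt \<open>b = 0\<close> by (simp add: b_def)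
    qed
    ultimately have ab: "0 < a" "0 < b" by (auto simp: a_def b_def less_le)
    define x' y' where "x' = (\<lambda>i. if i \<in> F then inverse a * x i else 0)" and "y' = (\<lambda>i. inverse b * y i)"
    have "L2_set x' F = L2_set (\<lambda>i. inverse a * x i) F" by (intro L2_set_cong) (auto simp: x'_def)
    then have n1: "L2_set x' F = 1"
      using ab L2_set_right_distrib[of "inverse a" x F] by (simp add: a_def)
    have n2: "L2_set y' F = 1"
      using ab L2_set_right_distrib[of "inverse b" y F] by (simp add: b_def y'_def)
    have "(\<Sum>i\<in>F. \<Sum>j\<in>F. y' i * A i j * x' j) = (\<Sum>i\<in>F. \<Sum>j\<in>F. (inverse a * inverse b) * (y i * A i j * x j))"
      by (intro sum.cong) (auto simp: x'_def y'_def)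
    also have "\<dots> = (inverse a * inverse b) * (\<Sum>i\<in>F. \<Sum>j\<in>F. y i * A i j * x j)"
      by (simp add: sum_distrib_left)
    also have "\<dots> > (inverse a * inverse b) * (4 ^ n * (a * b))"
      using ab gt by (intro mult_strict_left_mono) (auto simp: a_def b_def)
    also have "(inverse a * inverse b) * (4 ^ n * (a * b)) = 4 ^ n" using ab by (simp add: field_simps)
    finally have "4 ^ n < (\<Sum>i\<in>F. \<Sum>j\<in>F. y' i * A i j * x' j)" .
    moreover have "\<forall>i. 0 \<le> x' i" "\<forall>i. 0 \<le> y' i" "\<forall>i. i \<notin> F \<longrightarrow> x' i = 0"
      using xy ab by (auto simp: x'_def y'_def)
    ultimately show ?thesis using F n1 n2 unfolding Q_def by blast
  qed
  then have "\<forall>n. \<exists>F x y. Q n F x y" by blast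
  then obtain F x y where "\<forall>n. Q n (F n) (x n) (y n)" unfolding choice_iff by blast
  then have
    F: "\<And>n. finite (F n)" "\<And>n. F n \<subseteq> R" and
    pos: "\<And>n i. 0 \<le> x n i" "\<And>n i. 0 \<le> y n i" and
    zero: "\<And>n i. i \<notin> F n \<Longrightarrow> x n i = 0" and
    one: "\<And>n. L2_set (x n) (F n) = 1" "\<And>n. L2_set (y n) (F n) = 1" and
    gt: "\<And>n::nat. 4 ^ n < (\<Sum>i\<in>F n. \<Sum>j\<in>F n. y n i * A i j * x n j)"
    unfolding Q_def by blast+
  have sq: "(\<Sum>i\<in>G. (x n i)\<^sup>2) \<le> 1" if "finite G" for n G
  proof -
    have "(\<Sum>i\<in>G. (x n i)\<^sup>2) = (\<Sum>i\<in>G \<inter> F n. (x n i)\<^sup>2)"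
      by (rule sum.mono_neutral_cong_right) (use that zero in auto)
    also have "\<dots> \<le> (\<Sum>i\<in>F n. (x n i)\<^sup>2)" using F by (intro sum_mono2) auto
    also have "\<dots> = 1" using one(1)[of n] by (simp add: L2_set_def)
    finally show ?thesis .
  qed
  have geo: "summable (\<lambda>n. (1/2::real) ^ n)" by (rule summable_geometric) simp
  have sm: "summable (\<lambda>n. (1/2) ^ n * (x n i)\<^sup>2)" for i
    by (rule summable_comparison_test'[OF geo, of 0]) (use sq[of "{i}"] in \<open>auto simp: mult_left_le\<close>)
  define X where "X i = sqrt (\<Sum>n. (1/2) ^ n * (x n i)\<^sup>2)" for i
  have X0: "0 \<le> X i" for i unfolding X_def using sm by (auto intro!: suminf_nonneg)
  have X2: "(X i)\<^sup>2 = (\<Sum>n. (1/2) ^ n * (x n i)\<^sup>2)" for i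
    unfolding X_def using sm by (auto intro!: real_sqrt_pow2 suminf_nonneg)
  define z where "z = (\<lambda>i. if i \<in> R then complex_of_real (X i) else 0)"
  have "L2_set (\<lambda>i. cmod (z i)) G \<le> sqrt 2" if "finite G" "G \<subseteq> R" for G
  proof -
    have "(\<Sum>i\<in>G. (cmod (z i))\<^sup>2) = (\<Sum>i\<in>G. (X i)\<^sup>2)"
      using that X0 by (intro sum.cong) (auto simp: z_def)
    also have "\<dots> = (\<Sum>n. \<Sum>i\<in>G. (1/2) ^ n * (x n i)\<^sup>2)" unfolding X2 by (rule suminf_sum[symmetric]) (rule sm)
    also have "\<dots> \<le> (\<Sum>n. (1/2) ^ n)"
      using sq[OF that(1)]
      by (intro suminf_le geo summable_sum sm) (auto simp flip: sum_distrib_left simp: mult_left_le)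
    also have "\<dots> = 2" by (simp add: suminf_geometric)
    finally show ?thesis by (simp add: L2_set_def)
  qed
  then have z: "z \<in> l2 R" by (intro l2I[of R z "sqrt 2"]) (auto simp: z_def)
  define N where "N = l2_norm R (mat_op R A z)"
  have zX: "modulus z = z" using X0 by (auto simp: z_def modulus_def)
  have "2 ^ n < N" for n
  proof -
    have dom: "x n j \<le> 2 ^ n * X j" for j
    proof -
      have "((1/2) ^ n * x n j)\<^sup>2 \<le> (1/2) ^ n * (x n j)\<^sup>2"
        by (auto simp: power_mult_distrib power2_eq_square[of "(1/2)^n"] intro!: mult_left_le_one_le power_le_one)
      also have "\<dots> \<le> (\<Sum>n. (1/2) ^ n * (x n j)\<^sup>2)"
        using sum_le_suminf[OF sm, of "{n}"] by simp
      finally have "((1/2) ^ n * x n j)\<^sup>2 \<le> (X j)\<^sup>2" by (simp add: X2)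
      then have "(1/2) ^ n * x n j \<le> X j" using X0 by (rule power2_le_imp_le)
      then show ?thesis by (simp add: field_simps)
    qed
    have row: "(\<Sum>j\<in>F n. A i j * X j) \<le> cmod (mat_op R A z i)" if i: "i \<in> F n" for i
    proof -
      have iR: "i \<in> R" using i F by auto
      have "(\<Sum>j\<in>F n. A i j * X j) = (\<Sum>j\<in>F n. A i j * cmod (z j))"
        using F X0 by (intro sum.cong) (auto simp: z_def)
      also have "\<dots> \<le> row_sum R A z i"
        unfolding row_sum_def
        using F nn iR by (intro finite_sum_le_infsum pos_op_row_summable A z) (auto simp: nonneg_matrixD)
      also have "\<dots> = cmod (mat_op R A z i)"
        using mat_op_modulus[OF iR, of A z] row_sum_nonneg[OF nn iR] by (simp add: zX)
      finally show ?thesis .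
    qed
    have "4 ^ n < (\<Sum>i\<in>F n. \<Sum>j\<in>F n. y n i * A i j * x n j)" by (rule gt)
    also have "\<dots> \<le> (\<Sum>i\<in>F n. \<Sum>j\<in>F n. y n i * A i j * (2 ^ n * X j))"
      using pos F by (intro sum_mono mult_left_mono dom mult_nonneg_nonneg nonneg_matrixD[OF nn]) (auto dest: subsetD[OF F(2)])
    also have "\<dots> = 2 ^ n * (\<Sum>i\<in>F n. y n i * (\<Sum>j\<in>F n. A i j * X j))"
      by (simp add: sum_distrib_left mult_ac)
    also have "\<dots> \<le> 2 ^ n * (\<Sum>i\<in>F n. \<bar>y n i\<bar> * \<bar>cmod (mat_op R A z i)\<bar>)"
      using pos by (auto intro!: mult_left_mono sum_mono mult_mono row abs_ge_self sum_nonneg mult_nonneg_nonneg nonneg_matrixD[OF nn] X0 subsetD[OF F(2)])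
    also have "\<dots> \<le> 2 ^ n * (L2_set (y n) (F n) * L2_set (\<lambda>i. cmod (mat_op R A z i)) (F n))"
      by (intro mult_left_mono L2_set_mult_ineq) auto
    also have "\<dots> \<le> 2 ^ n * (1 * N)"
      unfolding N_def one using F z
      by (intro mult_left_mono L2_set_le_l2_norm pos_op_l2[OF A]) auto
    finally have "2 ^ n * 2 ^ n < 2 ^ n * N" by (simp flip: power_mult_distrib)
    then show ?thesis by simp
  qed
  moreover obtain n where "N < 2 ^ n" using real_arch_pow[of 2 N] by auto
  ultimately show False by (metis less_asym)
qed

subsection \<open>The norm and the numerical radius as least bounds\<close>

lemma op_norm_bdd:
  assumes "form_bound all_pairs R A C" "nonneg_matrix R A" "0 \<le> C" "x \<in> l2_ball R"
  shows "l2_norm R (mat_op R A x) \<le> C"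
proof -
  have x: "x \<in> l2 R" "l2_norm R x \<le> 1" using assms(4) by (auto simp: l2_ball_def)
  have "l2_norm R (mat_op R A x) \<le> C * l2_norm R x" using form_bound_imp_operator(2)[OF assms(1-3) x(1)] .
  also have "\<dots> \<le> C" using x assms(3) by (simp add: mult_left_le)
  finally show ?thesis .
qed

lemma l2_norm_mat_op_le:
  assumes A: "pos_op R A" and x: "x \<in> l2 R"
  shows "l2_norm R (mat_op R A x) \<le> op_norm R (mat_op R A) * l2_norm R x"
proof (cases "l2_norm R x = 0")
  case True
  then have "x = (\<lambda>_. 0)" using x l2_norm_eq_0 by blast
  then have "mat_op R A x = (\<lambda>_. 0)" by (auto simp: mat_op_def)
  then show ?thesis using True by simp
next
  case False
  then obtain u where u: "u \<in> l2 R" "l2_norm R u = 1" "x = (\<lambda>i. complex_of_real (l2_norm R x) * u i)"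
    using l2_normalise[OF x] by blast
  obtain C where C: "0 \<le> C" "form_bound all_pairs R A C" using pos_op_form_bound[OF A] by blast
  have "l2_norm R (mat_op R A u) \<le> op_norm R (mat_op R A)"
    unfolding op_norm_def
  proof (rule cSup_upper)
    show "bdd_above {l2_norm R (mat_op R A x) |x. x \<in> l2_ball R}"
      using op_norm_bdd[OF C(2) _ C(1)] A by (auto simp: pos_op_def intro!: bdd_aboveI[of _ C])
  qed (use u in \<open>auto simp: l2_ball_def\<close>)
  moreover have "mat_op R A x = (\<lambda>i. complex_of_real (l2_norm R x) * mat_op R A u i)"
    by (subst u(3)) (rule mat_op_scale)
  then have "l2_norm R (mat_op R A x) = l2_norm R x * l2_norm R (mat_op R A u)"
    using l2_scale(2)[OF pos_op_l2[OF A u(1)], of "complex_of_real (l2_norm R x)"] by simp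
  ultimately show ?thesis by (simp add: mult_right_mono mult.commute[of _ "l2_norm R x"] mult_left_mono)
qed

lemma op_norm_le:
  assumes "pos_op R A" "form_bound all_pairs R A C" "0 \<le> C"
  shows "op_norm R (mat_op R A) \<le> C"
  unfolding op_norm_def
  using assms op_norm_bdd[of R A C] by (intro cSup_least) (auto simp: pos_op_def l2_ball_def intro!: exI[of _ "\<lambda>_. 0"])

lemma op_norm_form_bound:
  assumes A: "pos_op R A"
  shows "form_bound all_pairs R A (op_norm R (mat_op R A))"
proof -
  define C where "C = op_norm R (mat_op R A)"
  have nn: "nonneg_matrix R A" using A by (simp add: pos_op_def)
  have "form_bound all_pairs R A C"
  proof (rule form_boundI)
    fix F and x y :: "nat \<Rightarrow> real"
    assume *: "finite F" "F \<subseteq> R" "\<And>i. 0 \<le> x i" "\<And>i. 0 \<le> y i"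
    let ?v = "finite_vec F x"
    have "(\<Sum>i\<in>F. \<Sum>j\<in>F. y i * A i j * x j) = (\<Sum>i\<in>F. y i * (\<Sum>j\<in>F. A i j * x j))"
      by (simp add: sum_distrib_left mult.assoc)
    also have "\<dots> \<le> (\<Sum>i\<in>F. \<bar>y i\<bar> * \<bar>cmod (mat_op R A ?v i)\<bar>)"
      using * by (intro sum_mono mult_mono) (auto simp: mat_op_finite_vec subset_iff simp del: of_real_sum intro!: sum_nonneg mult_nonneg_nonneg nonneg_matrixD[OF nn])
    also have "\<dots> \<le> L2_set y F * L2_set (\<lambda>i. cmod (mat_op R A ?v i)) F" by (rule L2_set_mult_ineq)
    also have "\<dots> \<le> L2_set y F * (C * L2_set x F)"
    proof (rule mult_left_mono)
      have "L2_set (\<lambda>i. cmod (mat_op R A ?v i)) F \<le> l2_norm R (mat_op R A ?v)"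
        using * by (intro L2_set_le_l2_norm pos_op_l2 A finite_vec_l2)
      also have "\<dots> \<le> op_norm R (mat_op R A) * l2_norm R ?v"
        using * by (intro l2_norm_mat_op_le A finite_vec_l2)
      also have "\<dots> = C * L2_set x F" using * by (simp add: finite_vec_l2 C_def)
      finally show "L2_set (\<lambda>i. cmod (mat_op R A ?v i)) F \<le> C * L2_set x F" .
    qed simp
    finally show "(\<Sum>i\<in>F. \<Sum>j\<in>F. y i * A i j * x j) \<le> C * (L2_set x F * L2_set y F)" by (simp add: mult_ac)
  qed
  then show ?thesis by (simp add: C_def)
qed

lemma numerical_radius_least:
  assumes A: "pos_op R A" and R: "R \<noteq> {}"
  shows "form_bound (=) R A (numerical_radius R (mat_op R A))"
    and "\<lbrakk>form_bound (=) R A C; 0 \<le> C\<rbrakk> \<Longrightarrow> numerical_radius R (mat_op R A) \<le> C"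
proof -
  have nn: "nonneg_matrix R A" using A by (simp add: pos_op_def)
  have upper: "cmod (l2_inner R (mat_op R A f) f) \<le> c"
    if fb: "form_bound (=) R A c" and c: "0 \<le> c" and f: "f \<in> l2 R" "l2_norm R f = 1" for f c
  proof -
    let ?x = "\<lambda>i. cmod (f i)"
    note ds = form_double_sum[OF fb nn c, of ?x ?x 1 1, simplified]
    have L: "L2_set ?x F \<le> 1" if "finite F" "F \<subseteq> R" for F using L2_set_le_l2_norm[OF f(1) that] f by simp
    have sm: "(\<lambda>i. \<Sum>\<^sub>\<infinity>j\<in>R. ?x i * A i j * ?x j) summable_on R"
      using summable_on_Sigma_banach[OF ds(1)[OF L]] by simp
    have le: "cmod (mat_op R A f i * cnj (f i)) \<le> (\<Sum>\<^sub>\<infinity>j\<in>R. ?x i * A i j * ?x j)" if "i \<in> R" for i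
      using mult_left_mono[OF cmod_mat_op_le[OF A f(1) that], of "?x i"]
      by (simp add: norm_mult row_sum_def mult.assoc infsum_cmult_right' mult.commute[of "cmod (mat_op R A f i)"])
    have abs: "(\<lambda>i. cmod (mat_op R A f i * cnj (f i))) summable_on R"
      using sm le by (rule summable_on_comparison_test) auto
    have "cmod (l2_inner R (mat_op R A f) f) \<le> (\<Sum>\<^sub>\<infinity>i\<in>R. cmod (mat_op R A f i * cnj (f i)))"
      unfolding l2_inner_def by (rule norm_infsum_bound[OF abs])
    also have "\<dots> \<le> (\<Sum>\<^sub>\<infinity>i\<in>R. \<Sum>\<^sub>\<infinity>j\<in>R. ?x i * A i j * ?x j)" by (rule infsum_mono[OF abs sm le])
    also have "\<dots> \<le> c" using ds(2)[OF L] .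
    finally show ?thesis .
  qed
  obtain i0 where i0: "i0 \<in> R" using R by auto
  have ne: "\<exists>f. f \<in> l2 R \<and> l2_norm R f = 1"
    using finite_vec_l2[of "{i0}" R "\<lambda>_. 1"] i0 by (intro exI[of _ "unit_vec i0"]) simp
  show "numerical_radius R (mat_op R A) \<le> C" if "form_bound (=) R A C" "0 \<le> C"
    unfolding numerical_radius_def using upper that ne by (intro cSup_least) auto
  define C where "C = numerical_radius R (mat_op R A)"
    obtain C0 where C0: "0 \<le> C0" "form_bound all_pairs R A C0" using pos_op_form_bound[OF A] by blast
    have C0': "form_bound (=) R A C0" using C0(2) by (auto simp: form_bound_def)
    have "form_bound (=) R A C"
    proof (rule form_boundI)
      fix F and x y :: "nat \<Rightarrow> real"
      assume *: "finite F" "F \<subseteq> R" "x = y" "\<And>i. 0 \<le> x i" "\<And>i. 0 \<le> y i"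
      define L where "L = L2_set x F"
      show "(\<Sum>i\<in>F. \<Sum>j\<in>F. y i * A i j * x j) \<le> C * (L2_set x F * L2_set y F)"
      proof (cases "L = 0")
        case True
        then have "\<forall>i\<in>F. x i = 0" using * by (simp add: L_def L2_set_eq_0_iff)
        then show ?thesis using True * by (simp add: L_def)
      next
        case False
        then have L: "0 < L" by (simp add: L_def less_le)
        let ?x = "\<lambda>i. inverse L * x i"
        let ?f = "finite_vec F ?x"
        have "L2_set ?x F = 1"
          using L L2_set_right_distrib[of "inverse L" x F] by (simp flip: L_def)
        then have f: "?f \<in> l2 R" "l2_norm R ?f = 1"
          using finite_vec_l2[OF *(1,2), of ?x] by auto
        let ?S = "\<Sum>i\<in>F. \<Sum>j\<in>F. y i * A i j * x j"
        have "((\<lambda>i. mat_op R A ?f i * cnj (?f i)) has_sum (\<Sum>i\<in>F. mat_op R A ?f i * cnj (?f i))) R"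
          using * by (intro has_sum_finite_neutralI[of F]) (auto simp: finite_vec_def)
        then have "l2_inner R (mat_op R A ?f) ?f = (\<Sum>i\<in>F. mat_op R A ?f i * cnj (?f i))"
          by (simp add: l2_inner_def infsumI)
        also have "\<dots> = (\<Sum>i\<in>F. complex_of_real (\<Sum>j\<in>F. inverse L * inverse L * (y i * A i j * x j)))"
        proof (rule sum.cong[OF refl])
          fix i assume i: "i \<in> F"
          have "mat_op R A ?f i * cnj (?f i) = complex_of_real ((\<Sum>j\<in>F. A i j * ?x j) * ?x i)"
            using * i by (subst mat_op_finite_vec) (auto simp: finite_vec_def)
          also have "(\<Sum>j\<in>F. A i j * ?x j) * ?x i = (\<Sum>j\<in>F. inverse L * inverse L * (y i * A i j * x j))"
            using *(3) by (simp add: sum_distrib_left sum_distrib_right mult_ac)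
          finally show "mat_op R A ?f i * cnj (?f i)
            = complex_of_real (\<Sum>j\<in>F. inverse L * inverse L * (y i * A i j * x j))" .
        qed
        also have "\<dots> = complex_of_real (inverse L * inverse L * ?S)"
          by (simp only: of_real_sum[symmetric] sum_distrib_left[symmetric])
        finally have "inverse L * inverse L * ?S \<le> cmod (l2_inner R (mat_op R A ?f) ?f)"
          by (simp only: norm_of_real abs_ge_self)
        also have "\<dots> \<le> numerical_radius R (mat_op R A)"
          unfolding numerical_radius_def
        proof (rule cSup_upper)
          show "bdd_above {cmod (l2_inner R (mat_op R A f) f) |f. f \<in> l2 R \<and> l2_norm R f = 1}"
            using upper[OF C0' C0(1)] by (auto intro!: bdd_aboveI[of _ C0])
        qed (use f in blast)
        finally have "inverse L * inverse L * ?S \<le> C" by (simp add: C_def)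
        then have "?S \<le> C * (L * L)" using L by (simp add: field_simps)
        then show ?thesis using *(3) by (simp add: L_def)
      qed
    qed
    then show "form_bound (=) R A (numerical_radius R (mat_op R A))" by (simp add: C_def)
qed

section \<open>The algebra of nonnegative matrices\<close>

definition eq_on :: "nat set \<Rightarrow> matrix \<Rightarrow> matrix \<Rightarrow> bool" where
  "eq_on R A B \<longleftrightarrow> (\<forall>i\<in>R. \<forall>j\<in>R. A i j = B i j)"

lemma eq_on_imp_le_on: "eq_on R A B \<Longrightarrow> le_on R A B" "eq_on R A B \<Longrightarrow> le_on R B A"
  by (auto simp: eq_on_def le_on_def)

lemma pos_op_dominated:
  assumes "pos_op R B" "nonneg_matrix R A" "le_on R A B"
  shows "pos_op R A"
  using pos_op_form_bound[OF assms(1)] form_bound_imp_operator(1)[OF _ assms(2)]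
    form_bound_mono[OF _ assms(3)] by blast

lemma pos_op_adj: "pos_op R A \<Longrightarrow> pos_op R (mat_adj A)"
  using pos_op_form_bound[of R A] form_bound_imp_operator(1)[of R "mat_adj A"]
    form_bound_adj[of all_pairs R A] by (auto simp: pos_op_def symp_def)

lemma pos_op_scale:
  assumes "pos_op R A" "0 \<le> c"
  shows "pos_op R (\<lambda>i j. c * A i j)"
proof -
  obtain C where "0 \<le> C" "form_bound all_pairs R A C" using pos_op_form_bound[OF assms(1)] by blast
  then show ?thesis
    using assms by (intro form_bound_imp_operator(1)[OF form_bound_scale]) (auto simp: pos_op_def nonneg_matrix_def)
qed

lemma pos_op_add:
  assumes "pos_op R A" "pos_op R B"
  shows "pos_op R (\<lambda>i j. A i j + B i j)"
proof -
  obtain C D where "0 \<le> C" "form_bound all_pairs R A C" "0 \<le> D" "form_bound all_pairs R B D"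
    using pos_op_form_bound[OF assms(1)] pos_op_form_bound[OF assms(2)] by blast
  then show ?thesis
    using assms by (intro form_bound_imp_operator(1)[OF form_bound_add]) (auto simp: pos_op_def nonneg_matrix_def)
qed

lemma pos_op_zero: "pos_op R (\<lambda>i j. 0)"
  by (rule form_bound_imp_operator(1)[of _ _ 0]) (auto simp: form_bound_def nonneg_matrix_def)

lemma pos_op_hmean:
  assumes "pos_op R A" "pos_op R B" "0 \<le> \<alpha>" "0 \<le> \<beta>" "1 \<le> \<alpha> + \<beta>"
  shows "pos_op R (hmean \<alpha> \<beta> A B)"
proof -
  obtain C D where "0 \<le> C" "form_bound all_pairs R A C" "0 \<le> D" "form_bound all_pairs R B D"
    using pos_op_form_bound[OF assms(1)] pos_op_form_bound[OF assms(2)] by blast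
  then show ?thesis
    using assms by (intro form_bound_imp_operator(1)[OF form_bound_hmean[where a = C and b = D]]) (auto simp: pos_op_def)
qed

lemma pos_op_nonneg: "pos_op R A \<Longrightarrow> i \<in> R \<Longrightarrow> j \<in> R \<Longrightarrow> 0 \<le> A i j"
  by (auto simp: pos_op_def intro: nonneg_matrixD)

lemma mat_mult_summable:
  assumes A: "pos_op R A" and B: "pos_op R B" and ij: "i \<in> R" "j \<in> R"
  shows "(\<lambda>k. A i k * B k j) summable_on R"
proof -
  have "mat_op R B (unit_vec j) \<in> l2 R" using ij by (intro pos_op_l2 B finite_vec_l2) auto
  from pos_op_row_summable[OF A this ij(1)]
  show ?thesis
    by (rule summable_on_cong[THEN iffD1, rotated]) (use ij B in \<open>simp add: mat_op_unit_vec pos_op_nonneg\<close>)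
qed

text \<open>The exchange of the two sums in \<open>\<Sum>\<^sub>k a\<^sub>i\<^sub>k \<Sum>\<^sub>j b\<^sub>k\<^sub>j x\<^sub>j\<close> is justified by the bound for the form of \<open>B\<close>,
  evaluated at \<open>|x|\<close> and the \<open>i\<close>th row of \<open>A\<close>, which is square summable.\<close>

lemma mat_op_mat_mult:
  assumes A: "pos_op R A" and B: "pos_op R B"
  shows "x \<in> l2 R \<Longrightarrow> mat_op R (mat_mult R A B) x = mat_op R A (mat_op R B x)"
    and "pos_op R (mat_mult R A B)"
proof -
  obtain C where C: "0 \<le> C" "form_bound all_pairs R A C" using pos_op_form_bound[OF A] by blast
  obtain D where D: "0 \<le> D" "form_bound all_pairs R B D" using pos_op_form_bound[OF B] by blast
  have nn: "nonneg_matrix R A" "nonneg_matrix R B" using A B by (auto simp: pos_op_def)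
  have main: "mat_op R (mat_mult R A B) x i = mat_op R A (mat_op R B x) i"
    "(\<lambda>j. complex_of_real (mat_mult R A B i j) * x j) summable_on R"
    if x: "x \<in> l2 R" and i: "i \<in> R" for x i
  proof -
    define y where "y k = (if k \<in> R then A i k else 0)" for k
    have y: "0 \<le> y k" for k using nn i by (simp add: y_def nonneg_matrixD)
    have Y: "L2_set y F \<le> C" if "finite F" "F \<subseteq> R" for F
    proof -
      have "L2_set y F = L2_set (A i) F" using that by (intro L2_set_cong) (auto simp: y_def)
      then show ?thesis using form_bound_row[OF C(2) nn(1) that i] by simp
    qed
    have "(\<lambda>(k, j). y k * B k j * cmod (x j)) summable_on R \<times> R"
      using form_double_sum(1)[OF D(2) nn(2) D(1), of "\<lambda>j. cmod (x j)" y "l2_norm R x" C] y Y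
        L2_set_le_l2_norm[OF x] by simp
    also have "(\<lambda>(k, j). y k * B k j * cmod (x j)) summable_on R \<times> R \<longleftrightarrow>
      (\<lambda>p. cmod ((\<lambda>(k, j). complex_of_real (A i k) * (complex_of_real (B k j) * x j)) p)) summable_on R \<times> R"
      using nn i by (intro summable_on_cong) (auto simp: y_def norm_mult nonneg_matrixD)
    finally have s: "(\<lambda>(k, j). complex_of_real (A i k) * (complex_of_real (B k j) * x j)) summable_on R \<times> R"
      by (rule abs_summable_summable)
    have entry: "(\<Sum>\<^sub>\<infinity>k\<in>R. complex_of_real (A i k) * (complex_of_real (B k j) * x j))
        = complex_of_real (mat_mult R A B i j) * x j" for j
      by (simp add: mat_mult_def infsum_cmult_left' flip: infsum_of_real_complex mult.assoc)
    have "mat_op R A (mat_op R B x) i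
        = (\<Sum>\<^sub>\<infinity>k\<in>R. \<Sum>\<^sub>\<infinity>j\<in>R. complex_of_real (A i k) * (complex_of_real (B k j) * x j))"
      using i by (auto simp: mat_op_def infsum_cmult_right' intro!: infsum_cong)
    also have "\<dots> = (\<Sum>\<^sub>\<infinity>j\<in>R. \<Sum>\<^sub>\<infinity>k\<in>R. complex_of_real (A i k) * (complex_of_real (B k j) * x j))"
      using s by (rule infsum_swap_banach)
    also have "\<dots> = mat_op R (mat_mult R A B) x i" using i by (simp add: entry mat_op_def)
    finally show "mat_op R (mat_mult R A B) x i = mat_op R A (mat_op R B x) i" by simp
    have "(\<lambda>(j, k). complex_of_real (A i k) * (complex_of_real (B k j) * x j)) summable_on R \<times> R"
      using s summable_on_swap[of "\<lambda>(k, j). complex_of_real (A i k) * (complex_of_real (B k j) * x j)" R R] by simp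
    then show "(\<lambda>j. complex_of_real (mat_mult R A B i j) * x j) summable_on R"
      using summable_on_Sigma_banach by (fastforce simp: entry)
  qed
  show eq: "mat_op R (mat_mult R A B) x = mat_op R A (mat_op R B x)" if "x \<in> l2 R" for x
    using main(1)[OF that] by (intro ext) (metis mat_op_outside)
  show "pos_op R (mat_mult R A B)"
    unfolding pos_op_def defines_operator_def
    using main(2) eq nn by (auto simp: pos_op_l2 A B nonneg_matrix_def mat_mult_def intro!: infsum_nonneg)
qed

lemmas pos_op_mat_mult = mat_op_mat_mult(2)

text \<open>Associativity and the laws of powers hold for the operators trivially. This lemma transfers them
  to the entries.\<close>

lemma eq_on_operatorI:
  assumes "\<And>x. x \<in> l2 R \<Longrightarrow> mat_op R A x = mat_op R B x"
  shows "eq_on R A B"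
  unfolding eq_on_def
proof (intro ballI)
  fix i j assume ij: "i \<in> R" "j \<in> R"
  have "mat_op R A (unit_vec j) i = mat_op R B (unit_vec j) i"
    using assms finite_vec_l2[of "{j}" R] ij by simp
  then show "A i j = B i j" using ij by (simp add: mat_op_unit_vec)
qed

lemma mat_mult_mono:
  assumes "le_on R A A'" "le_on R B B'" "pos_op R A" "pos_op R B"
    "pos_op R A'" "pos_op R B'"
  shows "le_on R (mat_mult R A B) (mat_mult R A' B')"
  unfolding mat_mult_def using assms
  by (intro le_onI infsum_mono mat_mult_summable mult_mono) (auto simp: le_on_def pos_op_nonneg)

lemma mat_mult_adj: "mat_mult R (mat_adj A) (mat_adj B) = mat_adj (mat_mult R B A)"
  by (simp add: mat_mult_def mat_adj_def mult.commute)

text \<open>Products of geometric means are dominated by geometric means of products: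
  Hoelder's inequality for the sum over the intermediate index.\<close>

lemma mat_mult_hmean:
  assumes e: "0 \<le> \<alpha>" "0 \<le> \<beta>" "1 \<le> \<alpha> + \<beta>"
    and P: "pos_op R A" "pos_op R B" "pos_op R C" "pos_op R D"
  shows "le_on R (mat_mult R (hmean \<alpha> \<beta> A B) (hmean \<alpha> \<beta> C D))
    (hmean \<alpha> \<beta> (mat_mult R A C) (mat_mult R B D))"
proof (rule le_onI)
  fix i j assume ij: "i \<in> R" "j \<in> R"
  have "mat_mult R (hmean \<alpha> \<beta> A B) (hmean \<alpha> \<beta> C D) i j
      = (\<Sum>\<^sub>\<infinity>k\<in>R. rpow (A i k * C k j) \<alpha> * rpow (B i k * D k j) \<beta>)"
    unfolding mat_mult_def hmean_apply using ij P
    by (intro infsum_cong) (simp add: rpow_mult pos_op_nonneg)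
  also have "\<dots> \<le> hmean \<alpha> \<beta> (mat_mult R A C) (mat_mult R B D) i j"
    unfolding hmean_apply mat_mult_def using ij P
    by (intro Hoelder_infsum(1) e mat_mult_summable) (auto simp: pos_op_nonneg)
  finally show "mat_mult R (hmean \<alpha> \<beta> A B) (hmean \<alpha> \<beta> C D) i j
      \<le> hmean \<alpha> \<beta> (mat_mult R A C) (mat_mult R B D) i j" .
qed

subsection \<open>Powers\<close>

primrec mat_pow :: "nat set \<Rightarrow> matrix \<Rightarrow> nat \<Rightarrow> matrix" where
  "mat_pow R A 0 = (\<lambda>i j. if i = j then 1 else 0)"
| "mat_pow R A (Suc n) = mat_mult R A (mat_pow R A n)"

lemma pos_op_one: "pos_op R (\<lambda>i j. if i = j then 1 else 0)"
proof (rule form_bound_imp_operator(1)[of _ _ 1])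
  show "form_bound all_pairs R (\<lambda>i j. if i = j then 1 else 0) 1"
  proof (rule form_boundI)
    fix F :: "nat set" and x y :: "nat \<Rightarrow> real"
    assume *: "finite F" "\<And>i. 0 \<le> x i" "\<And>i. 0 \<le> y i"
    have "(\<Sum>i\<in>F. \<Sum>j\<in>F. y i * (if i = j then 1 else 0) * x j) = (\<Sum>i\<in>F. \<bar>x i\<bar> * \<bar>y i\<bar>)"
      using * by (intro sum.cong) (auto simp: if_distrib[of "\<lambda>t. _ * t"] if_distrib[of "\<lambda>t. t * _"] sum.delta mult.commute cong: if_cong)
    then show "(\<Sum>i\<in>F. \<Sum>j\<in>F. y i * (if i = j then 1 else 0) * x j) \<le> 1 * (L2_set x F * L2_set y F)"
      using L2_set_mult_ineq[of x y F] by simp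
  qed
qed (auto simp: nonneg_matrix_def)

lemma mat_op_one:
  assumes "x \<in> l2 R"
  shows "mat_op R (\<lambda>i j. if i = j then 1 else 0) x = x"
proof
  fix i
  have "(\<Sum>\<^sub>\<infinity>j\<in>R. complex_of_real (if i = j then 1 else 0) * x j) = x i" if "i \<in> R"
  proof (rule infsumI)
    show "((\<lambda>j. complex_of_real (if i = j then 1 else 0) * x j) has_sum x i) R"
      by (rule has_sum_finite_neutralI[of "{i}"]) (use that in auto)
  qed
  then show "mat_op R (\<lambda>i j. if i = j then 1 else 0) x i = x i"
    using assms by (auto simp: mat_op_def l2_outside)
qed

context
  fixes R and A :: matrix
  assumes A: "pos_op R A"
begin

lemma pos_op_mat_pow: "pos_op R (mat_pow R A n)"
  by (induction n) (auto intro: pos_op_one pos_op_mat_mult A)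

lemma funpow_l2: "x \<in> l2 R \<Longrightarrow> (mat_op R A ^^ n) x \<in> l2 R"
  by (induction n) (auto intro: pos_op_l2 A)

lemma mat_op_mat_pow: "x \<in> l2 R \<Longrightarrow> mat_op R (mat_pow R A n) x = (mat_op R A ^^ n) x"
  by (induction n) (auto simp: mat_op_one mat_op_mat_mult A pos_op_mat_pow)

lemma mat_pow_add: "eq_on R (mat_pow R A (m + n)) (mat_mult R (mat_pow R A m) (mat_pow R A n))"
  by (rule eq_on_operatorI)
    (simp add: mat_op_mat_mult pos_op_mat_pow mat_op_mat_pow funpow_l2 funpow_add)

end

lemma mat_pow_scale: "mat_pow R (\<lambda>i j. c * A i j) n = (\<lambda>i j. c ^ n * mat_pow R A n i j)"
proof (induction n)
  case (Suc n)
  have "mat_mult R (\<lambda>i j. c * A i j) (\<lambda>i j. c ^ n * mat_pow R A n i j) i j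
      = c ^ Suc n * mat_mult R A (mat_pow R A n) i j" for i j
  proof -
    have "(\<Sum>\<^sub>\<infinity>k\<in>R. c * A i k * (c ^ n * mat_pow R A n k j))
        = (\<Sum>\<^sub>\<infinity>k\<in>R. c ^ Suc n * (A i k * mat_pow R A n k j))" by (simp add: mult_ac)
    then show ?thesis by (simp add: mat_mult_def infsum_cmult_right')
  qed
  then show ?case by (simp add: Suc fun_eq_iff)
qed (simp add: fun_eq_iff)

lemma mat_pow_adj:
  assumes A: "pos_op R A"
  shows "eq_on R (mat_pow R (mat_adj A) n) (mat_adj (mat_pow R A n))"
proof (induction n)
  case (Suc n)
  have comm: "eq_on R (mat_pow R A (Suc n)) (mat_mult R (mat_pow R A n) A)"
    by (rule eq_on_operatorI)
      (simp add: mat_op_mat_mult A pos_op_mat_pow mat_op_mat_pow pos_op_l2 funpow_swap1)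
  have "eq_on R (mat_pow R (mat_adj A) (Suc n)) (mat_mult R (mat_adj A) (mat_adj (mat_pow R A n)))"
    using Suc by (auto simp: eq_on_def mat_mult_def intro!: infsum_cong)
  then have "eq_on R (mat_pow R (mat_adj A) (Suc n)) (mat_adj (mat_mult R (mat_pow R A n) A))"
    by (simp only: mat_mult_adj)
  then show ?case using comm by (simp add: eq_on_def mat_adj_def)
qed (auto simp: eq_on_def mat_adj_def)

lemma mat_pow_mono:
  assumes "le_on R A B" "pos_op R A" "pos_op R B"
  shows "le_on R (mat_pow R A n) (mat_pow R B n)"
  using assms by (induction n) (auto intro!: mat_mult_mono pos_op_mat_pow simp: le_on_def[of _ "\<lambda>i j. if i = j then 1 else 0"])

lemma mat_pow_hmean:
  assumes e: "0 \<le> \<alpha>" "0 \<le> \<beta>" "1 \<le> \<alpha> + \<beta>" and A: "pos_op R A" and B: "pos_op R B"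
  shows "le_on R (mat_pow R (hmean \<alpha> \<beta> A B) n) (hmean \<alpha> \<beta> (mat_pow R A n) (mat_pow R B n))"
proof (induction n)
  case 0
  show ?case using e by (auto simp: le_on_def hmean_apply)
next
  case (Suc n)
  note P = pos_op_hmean[OF A B e] pos_op_mat_pow[OF A] pos_op_mat_pow[OF B]
  have "le_on R (mat_pow R (hmean \<alpha> \<beta> A B) (Suc n))
      (mat_mult R (hmean \<alpha> \<beta> A B) (hmean \<alpha> \<beta> (mat_pow R A n) (mat_pow R B n)))"
    using Suc P pos_op_mat_pow[OF P(1)] by (auto intro!: mat_mult_mono pos_op_hmean e simp: le_on_def[of _ "hmean \<alpha> \<beta> A B"])
  also note mat_mult_hmean[OF e A B P(2,3)]
  finally (le_on_trans) show ?case by simp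
qed

lemma mat_pow_rotate:
  assumes A: "pos_op R A" and B: "pos_op R B"
  shows "eq_on R (mat_pow R (mat_mult R A B) (Suc n))
    (mat_mult R A (mat_mult R (mat_pow R (mat_mult R B A) n) B))"
proof (rule eq_on_operatorI)
  fix x assume x: "x \<in> l2 R"
  note P = A B pos_op_mat_mult[OF A B] pos_op_mat_mult[OF B A]
  have rot: "(mat_op R (mat_mult R A B) ^^ n) (mat_op R A y) = mat_op R A ((mat_op R (mat_mult R B A) ^^ n) y)"
    if "y \<in> l2 R" for y
    using that by (induction n) (simp_all add: mat_op_mat_mult P pos_op_l2 funpow_l2)
  have "mat_op R (mat_pow R (mat_mult R A B) (Suc n)) x = (mat_op R (mat_mult R A B) ^^ n) (mat_op R (mat_mult R A B) x)"
    using x P by (simp add: mat_op_mat_pow funpow_swap1 del: mat_pow.simps)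
  also have "\<dots> = mat_op R A ((mat_op R (mat_mult R B A) ^^ n) (mat_op R B x))"
    using x P by (simp add: mat_op_mat_mult rot pos_op_l2)
  also have "\<dots> = mat_op R (mat_mult R A (mat_mult R (mat_pow R (mat_mult R B A) n) B)) x"
    using x P by (simp add: mat_op_mat_pow mat_op_mat_mult pos_op_mat_mult pos_op_mat_pow pos_op_l2)
  finally show "mat_op R (mat_pow R (mat_mult R A B) (Suc n)) x
      = mat_op R (mat_mult R A (mat_mult R (mat_pow R (mat_mult R B A) n) B)) x" .
qed

subsection \<open>Products and sums of lists\<close>

lemma mat_prod_Cons: "Ks \<noteq> [] \<Longrightarrow> mat_prod R (K # Ks) = mat_mult R K (mat_prod R Ks)"
  by (cases Ks) auto

lemma pos_op_mat_prod:
  "\<forall>K\<in>set Ks. pos_op R K \<Longrightarrow> pos_op R (mat_prod R Ks)"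
  by (induction R Ks rule: mat_prod.induct) (auto intro: pos_op_one pos_op_mat_mult)

lemma mat_prod_snoc:
  assumes "Ks \<noteq> []" "\<forall>K\<in>set (Ks @ [L]). pos_op R K"
  shows "eq_on R (mat_prod R (Ks @ [L])) (mat_mult R (mat_prod R Ks) L)"
  using assms
proof (induction Ks rule: list_nonempty_induct)
  case (single K)
  then show ?case by (simp add: eq_on_def)
next
  case (cons K Ks)
  note P = pos_op_mat_prod[of Ks R]
  have "eq_on R (mat_prod R ((K # Ks) @ [L])) (mat_mult R K (mat_mult R (mat_prod R Ks) L))"
    using cons by (auto simp: mat_prod_Cons eq_on_def mat_mult_def[of R K] intro!: infsum_cong)
  moreover have "eq_on R (mat_mult R K (mat_mult R (mat_prod R Ks) L)) (mat_mult R (mat_mult R K (mat_prod R Ks)) L)"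
    using cons P by (intro eq_on_operatorI) (simp add: mat_op_mat_mult pos_op_mat_mult pos_op_l2)
  ultimately show ?case using cons by (simp add: mat_prod_Cons eq_on_def)
qed

lemma sym2_hmean: "sym2 \<alpha> \<beta> K = hmean \<alpha> \<beta> K (mat_adj K)"
  by (simp add: sym2_def)

text \<open>Since \<open>(K\<^sub>1)\<^sup>* \<cdots> (K\<^sub>n)\<^sup>* = (K\<^sub>n \<cdots> K\<^sub>1)\<^sup>*\<close>, the second factors of the geometric means multiply to the
  adjoint of the reversed product.\<close>

lemma mat_prod_sym2:
  assumes "Ks \<noteq> []" "\<forall>K\<in>set Ks. pos_op R K" and e: "0 \<le> \<alpha>" "0 \<le> \<beta>" "1 \<le> \<alpha> + \<beta>"
  shows "le_on R (mat_prod R (map (sym2 \<alpha> \<beta>) Ks)) (hmean \<alpha> \<beta> (mat_prod R Ks) (mat_adj (mat_prod R (rev Ks))))"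
  using assms(1,2)
proof (induction Ks rule: list_nonempty_induct)
  case (single K)
  then show ?case by (simp add: sym2_hmean le_on_def)
next
  case (cons K Ks)
  let ?P = "mat_prod R Ks" and ?Q = "mat_prod R (rev Ks)"
  have K: "pos_op R K" and P: "pos_op R ?P" and Q: "pos_op R ?Q"
    using cons by (auto intro: pos_op_mat_prod)
  have S: "pos_op R (sym2 \<alpha> \<beta> L)" if "L \<in> set (K # Ks)" for L
    unfolding sym2_hmean using that cons by (intro pos_op_hmean pos_op_adj e) auto
  have IH: "le_on R (mat_prod R (map (sym2 \<alpha> \<beta>) Ks)) (hmean \<alpha> \<beta> ?P (mat_adj ?Q))" using cons by simp
  have "le_on R (mat_prod R (map (sym2 \<alpha> \<beta>) (K # Ks)))
      (mat_mult R (hmean \<alpha> \<beta> K (mat_adj K)) (hmean \<alpha> \<beta> ?P (mat_adj ?Q)))"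
    using cons.hyps cons.prems IH K S e
    by (auto simp: mat_prod_Cons sym2_hmean le_on_def[of _ "hmean \<alpha> \<beta> K (mat_adj K)"]
      intro!: mat_mult_mono pos_op_hmean pos_op_adj P Q pos_op_mat_prod)
  also have "le_on R \<dots> (hmean \<alpha> \<beta> (mat_mult R K ?P) (mat_mult R (mat_adj K) (mat_adj ?Q)))"
    by (intro mat_mult_hmean e K P Q pos_op_adj)
  also (le_on_trans) have "le_on R \<dots> (hmean \<alpha> \<beta> (mat_prod R (K # Ks)) (mat_adj (mat_prod R (rev (K # Ks)))))"
    using mat_prod_snoc[of "rev Ks" K R] cons unfolding mat_mult_adj
    by (auto simp: mat_prod_Cons eq_on_def le_on_def hmean_apply mat_adj_def)
  finally (le_on_trans) show ?case .
qed

lemma pos_op_mat_sum: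
  "\<forall>K\<in>set Ks. pos_op R K \<Longrightarrow> pos_op R (mat_sum Ks)"
  by (induction Ks) (auto simp: mat_sum_def intro: pos_op_zero pos_op_add)

lemma mat_sum_sym2:
  assumes K: "\<forall>K\<in>set Ks. pos_op R K" and e: "0 \<le> \<alpha>" "0 \<le> \<beta>" "1 \<le> \<alpha> + \<beta>"
  shows "le_on R (mat_sum (map (sym2 \<alpha> \<beta>) Ks)) (sym2 \<alpha> \<beta> (mat_sum Ks))"
proof (rule le_onI)
  fix i j assume "i \<in> R" "j \<in> R"
  then have nn: "0 \<le> (Ks ! n) i j" "0 \<le> (Ks ! n) j i" if "n \<in> {0..<length Ks}" for n
    using K that by (auto intro!: pos_op_nonneg)
  have "mat_sum (map (sym2 \<alpha> \<beta>) Ks) i j = (\<Sum>n\<in>{0..<length Ks}. rpow ((Ks ! n) i j) \<alpha> * rpow ((Ks ! n) j i) \<beta>)"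
    by (simp add: mat_sum_def sum_list_sum_nth sym2_hmean hmean_apply mat_adj_def)
  also have "\<dots> \<le> rpow (\<Sum>n\<in>{0..<length Ks}. (Ks ! n) i j) \<alpha> * rpow (\<Sum>n\<in>{0..<length Ks}. (Ks ! n) j i) \<beta>"
    using nn by (intro Hoelder_sum e) auto
  also have "\<dots> = sym2 \<alpha> \<beta> (mat_sum Ks) i j"
    by (simp add: mat_sum_def sum_list_sum_nth sym2_hmean hmean_apply mat_adj_def)
  finally show "mat_sum (map (sym2 \<alpha> \<beta>) Ks) i j \<le> sym2 \<alpha> \<beta> (mat_sum Ks) i j" .
qed

section \<open>The Hausdorff measure of noncompactness\<close>

definition ball_cover :: "nat set \<Rightarrow> operator \<Rightarrow> real \<Rightarrow> bool" where
  "ball_cover R T \<delta> \<longleftrightarrow> (\<exists>M. finite M \<and> M \<subseteq> l2 R \<and>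
     T ` l2_ball R \<subseteq> {\<lambda>i. m i + complex_of_real \<delta> * d i | m d. m \<in> M \<and> d \<in> l2_ball R})"

lemma noncompactness_ball_cover: "noncompactness R T = Inf {\<delta>. 0 < \<delta> \<and> ball_cover R T \<delta>}"
  by (simp add: noncompactness_def ball_cover_def)

lemma ball_coverI:
  assumes "finite M" "M \<subseteq> l2 R" "0 < \<delta>"
    and "\<And>f. f \<in> l2_ball R \<Longrightarrow> T f \<in> l2 R"
    and "\<And>f. f \<in> l2_ball R \<Longrightarrow> \<exists>m\<in>M. l2_norm R (\<lambda>i. T f i - m i) \<le> \<delta>"
  shows "ball_cover R T \<delta>"
  unfolding ball_cover_def
proof (intro exI[of _ M] conjI assms subsetI)
  fix h assume "h \<in> T ` l2_ball R"
  then obtain f where f: "f \<in> l2_ball R" "h = T f" by auto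
  then obtain m where m: "m \<in> M" "l2_norm R (\<lambda>i. T f i - m i) \<le> \<delta>" using assms(5) by blast
  define d where "d = (\<lambda>i. complex_of_real (inverse \<delta>) * (T f i - m i))"
  have df: "(\<lambda>i. T f i - m i) \<in> l2 R" using assms(2,4) f m by (intro l2_diff) auto
  have "l2_norm R d = inverse \<delta> * l2_norm R (\<lambda>i. T f i - m i)"
    unfolding d_def l2_scale(2)[OF df] norm_of_real using assms(3) by simp
  then have "l2_norm R d \<le> 1" using m(2) assms(3) by (simp add: inverse_eq_divide divide_le_eq)
  then have "d \<in> l2_ball R"
    unfolding l2_ball_def using l2_scale(1)[OF df] by (simp add: d_def)
  moreover have "h = (\<lambda>i. m i + complex_of_real \<delta> * d i)"
    using assms(3) f by (auto simp: d_def simp flip: of_real_mult mult.assoc)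
  ultimately show "h \<in> {\<lambda>i. m i + complex_of_real \<delta> * d i | m d. m \<in> M \<and> d \<in> l2_ball R}"
    using m by blast
qed

lemma ball_coverE:
  assumes "ball_cover R T \<delta>" "0 < \<delta>"
  obtains M where "finite M" "M \<subseteq> l2 R"
    "\<And>f. f \<in> l2_ball R \<Longrightarrow> \<exists>m\<in>M. \<exists>d\<in>l2_ball R. T f = (\<lambda>i. m i + complex_of_real \<delta> * d i)"
proof -
  obtain M where M: "finite M" "M \<subseteq> l2 R"
    "T ` l2_ball R \<subseteq> {\<lambda>i. m i + complex_of_real \<delta> * d i | m d. m \<in> M \<and> d \<in> l2_ball R}"
    using assms unfolding ball_cover_def by blast
  have "\<exists>m\<in>M. \<exists>d\<in>l2_ball R. T f = (\<lambda>i. m i + complex_of_real \<delta> * d i)" if "f \<in> l2_ball R" for f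
    using subsetD[OF M(3) imageI[OF that]] by blast
  then show ?thesis using that M by blast
qed

lemma ball_cover_norm:
  assumes A: "pos_op R A" and \<delta>: "op_norm R (mat_op R A) \<le> \<delta>" "0 < \<delta>"
  shows "ball_cover R (mat_op R A) \<delta>"
proof (rule ball_coverI[of "{\<lambda>_. 0}"])
  fix f assume f: "f \<in> l2_ball R"
  then show "mat_op R A f \<in> l2 R" by (intro pos_op_l2 A) (simp add: l2_ball_def)
  have "form_bound all_pairs R A \<delta>"
    by (rule form_bound_mono[OF op_norm_form_bound[OF A] _ \<delta>(1)]) (simp add: le_on_def)
  then show "\<exists>m\<in>{\<lambda>_. 0}. l2_norm R (\<lambda>i. mat_op R A f i - m i) \<le> \<delta>"
    using op_norm_bdd[OF _ _ _ f, of A \<delta>] A \<delta> by (simp add: pos_op_def)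
qed (use \<delta> in auto)

lemma ball_cover_exists: "pos_op R A \<Longrightarrow> \<exists>\<delta>>0. ball_cover R (mat_op R A) \<delta>"
  using ball_cover_norm[of R A "max 1 (op_norm R (mat_op R A))"] by (intro exI[of _ "max 1 (op_norm R (mat_op R A))"]) auto

lemma noncompactness_nonneg: "pos_op R A \<Longrightarrow> 0 \<le> noncompactness R (mat_op R A)"
  unfolding noncompactness_ball_cover using ball_cover_exists[of R A] by (intro cInf_greatest) auto

lemma noncompactness_le: "0 < \<delta> \<Longrightarrow> ball_cover R T \<delta> \<Longrightarrow> noncompactness R T \<le> \<delta>"
  unfolding noncompactness_ball_cover by (intro cInf_lower bdd_belowI[of _ 0]) auto

lemma noncompactness_cong:
  assumes "\<And>f. f \<in> l2 R \<Longrightarrow> S f = T f"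
  shows "noncompactness R S = noncompactness R T"
proof -
  have "S ` l2_ball R = T ` l2_ball R" using assms by (intro image_cong) (auto simp: l2_ball_def)
  then show ?thesis by (simp add: noncompactness_def)
qed

text \<open>A covering of \<open>B(D)\<close> with radius \<open>\<delta>'\<close> followed by a covering of \<open>A(D)\<close> with radius \<open>\<delta>\<close>
  is a covering of \<open>A B(D)\<close> with radius \<open>\<delta> \<delta>'\<close>.\<close>

lemma noncompactness_mat_mult:
  assumes A: "pos_op R A" and B: "pos_op R B"
  shows "noncompactness R (mat_op R (mat_mult R A B))
    \<le> noncompactness R (mat_op R A) * noncompactness R (mat_op R B)"
proof -
  let ?g = "noncompactness R (mat_op R (mat_mult R A B))"
  have prod: "?g \<le> \<delta> * \<delta>'"
    if \<delta>: "0 < \<delta>" "ball_cover R (mat_op R A) \<delta>" and \<delta>': "0 < \<delta>'" "ball_cover R (mat_op R B) \<delta>'" for \<delta> \<delta>'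
  proof -
    obtain M where M: "finite M" "M \<subseteq> l2 R"
      "\<And>f. f \<in> l2_ball R \<Longrightarrow> \<exists>m\<in>M. \<exists>d\<in>l2_ball R. mat_op R A f = (\<lambda>i. m i + complex_of_real \<delta> * d i)"
      using ball_coverE[OF \<delta>(2,1)] by blast
    obtain M' where M': "finite M'" "M' \<subseteq> l2 R"
      "\<And>f. f \<in> l2_ball R \<Longrightarrow> \<exists>m\<in>M'. \<exists>d\<in>l2_ball R. mat_op R B f = (\<lambda>i. m i + complex_of_real \<delta>' * d i)"
      using ball_coverE[OF \<delta>'(2,1)] by blast
    define N where "N = (\<lambda>(m', m) i. mat_op R A m' i + complex_of_real \<delta>' * m i) ` (M' \<times> M)"
    have N: "finite N" "N \<subseteq> l2 R"
      using M M' by (auto simp: N_def intro!: l2_add l2_scale pos_op_l2 A)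
    have "ball_cover R (mat_op R (mat_mult R A B)) (\<delta> * \<delta>')"
    proof (rule ball_coverI[OF N])
      fix f assume f: "f \<in> l2_ball R"
      then have fl: "f \<in> l2 R" by (simp add: l2_ball_def)
      then show "mat_op R (mat_mult R A B) f \<in> l2 R"
        by (intro pos_op_l2 pos_op_mat_mult A B)
      obtain m' d' where md': "m' \<in> M'" "d' \<in> l2_ball R" "mat_op R B f = (\<lambda>i. m' i + complex_of_real \<delta>' * d' i)"
        using M'(3)[OF f] by blast
      obtain m d where md: "m \<in> M" "d \<in> l2_ball R" "mat_op R A d' = (\<lambda>i. m i + complex_of_real \<delta> * d i)"
        using M(3)[OF md'(2)] by blast
      have l: "m' \<in> l2 R" "d' \<in> l2 R" "d \<in> l2 R" "l2_norm R d \<le> 1" using md md' M' by (auto simp: l2_ball_def)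
      have "mat_op R (mat_mult R A B) f = mat_op R A (\<lambda>i. m' i + complex_of_real \<delta>' * d' i)"
        by (simp add: mat_op_mat_mult A B fl md')
      also have "\<dots> = (\<lambda>i. mat_op R A m' i + complex_of_real \<delta>' * mat_op R A d' i)"
        by (subst mat_op_linear(1)[OF A l(1) l2_scale(1)[OF l(2)]]) (simp add: mat_op_scale)
      finally have eq: "mat_op R (mat_mult R A B) f i - (mat_op R A m' i + complex_of_real \<delta>' * m i)
          = complex_of_real (\<delta> * \<delta>') * d i" for i
        by (simp add: md(3) algebra_simps)
      show "\<exists>n\<in>N. l2_norm R (\<lambda>i. mat_op R (mat_mult R A B) f i - n i) \<le> \<delta> * \<delta>'"
      proof (rule bexI)
        show "(\<lambda>i. mat_op R A m' i + complex_of_real \<delta>' * m i) \<in> N" using md md' by (force simp: N_def)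
        show "l2_norm R (\<lambda>i. mat_op R (mat_mult R A B) f i - (mat_op R A m' i + complex_of_real \<delta>' * m i)) \<le> \<delta> * \<delta>'"
          unfolding eq l2_scale(2)[OF l(3)] using \<delta> \<delta>' l(4) by (simp add: norm_mult mult_left_le)
      qed
    qed (use \<delta> \<delta>' in simp)
    then show ?thesis using \<delta> \<delta>' by (intro noncompactness_le) auto
  qed
  have step: "?g \<le> noncompactness R (mat_op R A) * \<delta>'" if \<delta>': "0 < \<delta>'" "ball_cover R (mat_op R B) \<delta>'" for \<delta>'
  proof -
    have "?g / \<delta>' \<le> noncompactness R (mat_op R A)"
      unfolding noncompactness_ball_cover[of R "mat_op R A"]
      using ball_cover_exists[OF A] prod \<delta>' by (intro cInf_greatest) (auto simp: divide_le_eq)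
    then show ?thesis using \<delta>' by (simp add: divide_le_eq)
  qed
  show ?thesis
  proof (cases "noncompactness R (mat_op R A) = 0")
    case True
    then show ?thesis using step ball_cover_exists[OF B] by auto
  next
    case False
    then have pos: "0 < noncompactness R (mat_op R A)" using noncompactness_nonneg[OF A] by simp
    have "?g / noncompactness R (mat_op R A) \<le> noncompactness R (mat_op R B)"
      unfolding noncompactness_ball_cover[of R "mat_op R B"]
      using ball_cover_exists[OF B] step pos by (intro cInf_greatest) (auto simp: divide_le_eq mult.commute)
    then show ?thesis using pos by (simp add: divide_le_eq mult.commute)
  qed
qed

subsection \<open>Reduction to the norms of row tails\<close>

definition row_tail :: "nat \<Rightarrow> matrix \<Rightarrow> matrix" where
  "row_tail n A = (\<lambda>i j. if n < i then A i j else 0)"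

text \<open>Norms of row tails decrease in \<open>n\<close>; the condition says that their limit is at most \<open>C\<close>.\<close>

definition tail_bound :: "nat set \<Rightarrow> matrix \<Rightarrow> real \<Rightarrow> bool" where
  "tail_bound R A C \<longleftrightarrow> (\<forall>\<epsilon>>0. \<exists>n. form_bound all_pairs R (row_tail n A) (C + \<epsilon>))"

lemma l2_tail_small:
  assumes x: "x \<in> l2 R" and \<epsilon>: "0 < \<epsilon>"
  shows "\<exists>n. \<forall>F. finite F \<and> F \<subseteq> R \<and> (\<forall>i\<in>F. n < i) \<longrightarrow> L2_set (\<lambda>i. cmod (x i)) F \<le> \<epsilon>"
proof -
  let ?f = "\<lambda>i. (cmod (x i))\<^sup>2"
  have sm: "?f summable_on R" using x by (simp add: l2_def)
  obtain G where G: "finite G" "G \<subseteq> R" "dist (sum ?f G) (infsum ?f R) \<le> \<epsilon>\<^sup>2"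
    using infsum_finite_approximation[OF sm, of "\<epsilon>\<^sup>2"] \<epsilon> by auto
  obtain n where n: "\<forall>i\<in>G. i \<le> n" using G(1) finite_nat_set_iff_bounded_le by blast
  have "L2_set (\<lambda>i. cmod (x i)) F \<le> \<epsilon>" if F: "finite F" "F \<subseteq> R" "\<forall>i\<in>F. n < i" for F
  proof -
    have "F \<inter> G = {}" using n F(3) by fastforce
    then have "sum ?f F + sum ?f G = sum ?f (F \<union> G)" using F G by (simp add: sum.union_disjoint)
    also have "\<dots> \<le> infsum ?f R" using sm F G by (intro finite_sum_le_infsum) auto
    finally have "sum ?f F \<le> \<epsilon>\<^sup>2" using G(3) by (simp add: dist_real_def)
    then show ?thesis using \<epsilon> by (simp add: L2_set_def real_le_lsqrt sum_nonneg)
  qed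
  then show ?thesis by blast
qed

lemma row_tail_le: "nonneg_matrix R A \<Longrightarrow> le_on R (row_tail n A) A"
  by (auto simp: le_on_def row_tail_def nonneg_matrixD)

lemma nonneg_row_tail: "nonneg_matrix R A \<Longrightarrow> nonneg_matrix R (row_tail n A)"
  by (auto simp: row_tail_def nonneg_matrix_def)

lemma pos_op_row_tail: "pos_op R A \<Longrightarrow> pos_op R (row_tail n A)"
  by (rule pos_op_dominated[of R A]) (auto simp: row_tail_le nonneg_row_tail pos_op_def)

lemma mat_op_row_tail: "mat_op R (row_tail n A) x i = (if n < i then mat_op R A x i else 0)"
  by (simp add: mat_op_def row_tail_def)

lemma row_tail_antimono:
  assumes "nonneg_matrix R A" "form_bound all_pairs R (row_tail n A) C" "n \<le> m"
  shows "form_bound all_pairs R (row_tail m A) C"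
  by (rule form_bound_mono[OF assms(2)]) (use assms in \<open>auto simp: le_on_def row_tail_def nonneg_matrixD\<close>)

text \<open>Noncompactness is the limit of the norms of the row tails.
  The finitely many centres of a covering have small tails, hence the tails of \<open>A\<close> are bounded
  by the radius up to \<open>\<epsilon>\<close>. Conversely, the first \<open>n\<close> coordinates of \<open>A(D)\<close> form a bounded set in a
  finite dimensional space, which has a finite \<open>\<epsilon>\<close>-net.\<close>

lemma noncompactness_le_iff:
  assumes A: "pos_op R A" and C: "0 \<le> C"
  shows "noncompactness R (mat_op R A) \<le> C \<longleftrightarrow> tail_bound R A C"
proof
  assume le: "noncompactness R (mat_op R A) \<le> C"
  show "tail_bound R A C"
    unfolding tail_bound_def
  proof (intro allI impI)
    fix \<epsilon> :: real assume \<epsilon>: "0 < \<epsilon>"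
    have "\<exists>\<delta>\<in>{\<delta>. 0 < \<delta> \<and> ball_cover R (mat_op R A) \<delta>}. \<delta> < C + \<epsilon>/2"
      using ball_cover_exists[OF A] le \<epsilon> unfolding noncompactness_ball_cover
      by (intro cInf_lessD) auto
    then obtain \<delta> where \<delta>: "0 < \<delta>" "ball_cover R (mat_op R A) \<delta>" "\<delta> < C + \<epsilon>/2" by blast
    obtain M where M: "finite M" "M \<subseteq> l2 R"
      "\<And>f. f \<in> l2_ball R \<Longrightarrow> \<exists>m\<in>M. \<exists>d\<in>l2_ball R. mat_op R A f = (\<lambda>i. m i + complex_of_real \<delta> * d i)"
      using ball_coverE[OF \<delta>(2,1)] by blast
    have "\<forall>m\<in>M. \<exists>n. \<forall>F. finite F \<and> F \<subseteq> R \<and> (\<forall>i\<in>F. n < i) \<longrightarrow> L2_set (\<lambda>i. cmod (m i)) F \<le> \<epsilon>/2"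
      using M \<epsilon> by (intro ballI l2_tail_small) auto
    from bchoice[OF this] obtain \<nu> where \<nu>': "\<forall>m\<in>M. \<forall>F. finite F \<and> F \<subseteq> R \<and> (\<forall>i\<in>F. \<nu> m < i)
        \<longrightarrow> L2_set (\<lambda>i. cmod (m i)) F \<le> \<epsilon>/2" by (elim exE)
    have \<nu>: "L2_set (\<lambda>i. cmod (m i)) F \<le> \<epsilon>/2" if "m \<in> M" "finite F" "F \<subseteq> R" "\<forall>i\<in>F. \<nu> m < i" for m F
      using bspec[OF \<nu>' that(1)] that(2-4) by simp
    obtain n where n: "\<forall>m\<in>M. \<nu> m \<le> n" using M(1) finite_nat_set_iff_bounded_le[of "\<nu> ` M"] by auto
    have "op_norm R (mat_op R (row_tail n A)) \<le> C + \<epsilon>"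
      unfolding op_norm_def
    proof (rule cSup_least)
      show "{l2_norm R (mat_op R (row_tail n A) x) |x. x \<in> l2_ball R} \<noteq> {}"
        by (auto simp: l2_ball_def intro!: exI[of _ "\<lambda>_. 0"])
      fix t assume "t \<in> {l2_norm R (mat_op R (row_tail n A) x) |x. x \<in> l2_ball R}"
      then obtain f where f: "f \<in> l2_ball R" "t = l2_norm R (mat_op R (row_tail n A) f)" by blast
      obtain m d where md: "m \<in> M" "d \<in> l2_ball R" "mat_op R A f = (\<lambda>i. m i + complex_of_real \<delta> * d i)"
        using M(3)[OF f(1)] by blast
      have d: "d \<in> l2 R" "l2_norm R d \<le> 1" using md by (auto simp: l2_ball_def)
      show "t \<le> C + \<epsilon>"
        unfolding f(2)
      proof (rule l2I(2)[OF mat_op_outside])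
        fix F assume F: "finite F" "F \<subseteq> R"
        define G where "G = {i\<in>F. n < i}"
        have G: "finite G" "G \<subseteq> R" "\<forall>i\<in>G. \<nu> m < i" using F n md by (auto simp: G_def)
        have "L2_set (\<lambda>i. cmod (mat_op R (row_tail n A) f i)) F = L2_set (\<lambda>i. cmod (mat_op R A f i)) G"
          unfolding L2_set_def using F
          by (intro arg_cong[of _ _ sqrt] sum.mono_neutral_cong_right) (auto simp: G_def mat_op_row_tail)
        also have "\<dots> \<le> L2_set (\<lambda>i. cmod (m i) + \<delta> * cmod (d i)) G"
          using \<delta> by (intro L2_set_mono) (auto simp: md(3) norm_mult intro: order_trans[OF norm_triangle_ineq])
        also have "\<dots> \<le> L2_set (\<lambda>i. cmod (m i)) G + L2_set (\<lambda>i. \<delta> * cmod (d i)) G"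
          by (rule L2_set_triangle_ineq)
        also have "L2_set (\<lambda>i. \<delta> * cmod (d i)) G = \<delta> * L2_set (\<lambda>i. cmod (d i)) G"
          using \<delta> by (simp add: L2_set_right_distrib)
        also have "L2_set (\<lambda>i. cmod (m i)) G + \<delta> * L2_set (\<lambda>i. cmod (d i)) G \<le> \<epsilon>/2 + \<delta> * 1"
          using \<delta> L2_set_le_l2_norm[OF d(1) G(1,2)] d(2)
          by (intro add_mono mult_left_mono \<nu>[OF md(1) G]) auto
        also have "\<dots> \<le> C + \<epsilon>" using \<delta> by simp
        finally show "L2_set (\<lambda>i. cmod (mat_op R (row_tail n A) f i)) F \<le> C + \<epsilon>" .
      qed
    qed
    then show "\<exists>n. form_bound all_pairs R (row_tail n A) (C + \<epsilon>)"
      using form_bound_mono[OF op_norm_form_bound[OF pos_op_row_tail[OF A]]] by (metis le_on_def order_refl)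
  qed
next
  assume tb: "tail_bound R A C"
  have nn: "nonneg_matrix R A" using A by (simp add: pos_op_def)
  obtain B where B: "0 \<le> B" "form_bound all_pairs R A B" using pos_op_form_bound[OF A] by blast
  have "noncompactness R (mat_op R A) \<le> C + \<epsilon>" if "0 < \<epsilon>" for \<epsilon>
  proof -
    define \<eta> where "\<eta> = \<epsilon>/2"
    have \<eta>: "0 < \<eta>" using that by (simp add: \<eta>_def)
    obtain n where n: "form_bound all_pairs R (row_tail n A) (C + \<eta>)"
      using tb \<eta> unfolding tail_bound_def by blast
    have "compact (cball (0::complex) B)" by simp
    moreover have "0 < \<eta> / (n + 1)" using \<eta> by simp
    ultimately obtain Z where Z: "finite Z" "cball (0::complex) B \<subseteq> (\<Union>z\<in>Z. ball z (\<eta> / (n + 1)))"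
      unfolding compact_eq_totally_bounded by blast
    define M where "M = (\<lambda>g i. if i \<in> R \<and> i \<le> n then g i else 0) ` (PiE {..n} (\<lambda>_. Z))"
    have M_l2: "M \<subseteq> l2 R"
    proof
      fix m assume "m \<in> M"
      then obtain g where m: "m = (\<lambda>i. if i \<in> R \<and> i \<le> n then g i else 0)" by (auto simp: M_def)
      have "(\<lambda>i. (cmod (m i))\<^sup>2) summable_on R"
        by (rule finite_nonzero_values_imp_summable_on) (rule finite_subset[of _ "{..n}"], auto simp: m split: if_splits)
      then show "m \<in> l2 R" by (auto simp: l2_def m)
    qed
    have "ball_cover R (mat_op R A) (C + \<epsilon>)"
    proof (rule ball_coverI[of M])
      show "finite M" using Z(1) by (auto simp: M_def intro!: finite_PiE)
      show "M \<subseteq> l2 R" by (rule M_l2)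
      show "0 < C + \<epsilon>" using C that by simp
      fix f assume f: "f \<in> l2_ball R"
      then have Af: "mat_op R A f \<in> l2 R" by (intro pos_op_l2 A) (simp add: l2_ball_def)
      then show "mat_op R A f \<in> l2 R" .
      have "\<exists>z\<in>Z. cmod (mat_op R A f i - z) \<le> \<eta> / (n + 1)" for i
      proof -
        have "cmod (mat_op R A f i) \<le> l2_norm R (mat_op R A f)" by (rule cmod_le_l2_norm[OF Af])
        also have "\<dots> \<le> B" by (rule op_norm_bdd[OF B(2) nn B(1) f])
        finally have "mat_op R A f i \<in> cball 0 B" by simp
        then obtain z where "z \<in> Z" "mat_op R A f i \<in> ball z (\<eta> / (n + 1))" using Z(2) by blast
        then show ?thesis by (intro bexI[of _ z]) (auto simp: dist_norm norm_minus_commute)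
      qed
      then obtain z where z: "\<And>i. z i \<in> Z" "\<And>i. cmod (mat_op R A f i - z i) \<le> \<eta> / (n + 1)" by metis
      define m where "m = (\<lambda>i. if i \<in> R \<and> i \<le> n then z i else 0)"
      have mM: "m \<in> M"
        unfolding M_def by (rule image_eqI[of _ _ "restrict z {..n}"]) (use z in \<open>auto simp: m_def fun_eq_iff\<close>)
      define p where "p = (\<lambda>i. if i \<in> R \<and> i \<le> n then mat_op R A f i - z i else 0)"
      define q where "q = mat_op R (row_tail n A) f"
      have split: "(\<lambda>i. mat_op R A f i - m i) = (\<lambda>i. p i + q i)"
        by (auto simp: fun_eq_iff p_def q_def m_def mat_op_row_tail mat_op_outside)
      have pF: "L2_set (\<lambda>i. cmod (p i)) F \<le> \<eta>" if "finite F" "F \<subseteq> R" for F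
      proof -
        have "L2_set (\<lambda>i. cmod (p i)) F \<le> (\<Sum>i\<in>F. \<bar>cmod (p i)\<bar>)" by (rule L2_set_le_sum_abs)
        also have "\<dots> = (\<Sum>i\<in>F\<inter>{..n}. \<bar>cmod (p i)\<bar>)"
          by (rule sum.mono_neutral_right) (use that in \<open>auto simp: p_def\<close>)
        also have "\<dots> \<le> (\<Sum>i\<in>F\<inter>{..n}. \<eta> / (n + 1))"
          using z(2) \<eta> by (intro sum_mono) (auto simp: p_def)
        also have "\<dots> \<le> (\<Sum>i\<in>{..n}. \<eta> / (n + 1))"
          using \<eta> by (intro sum_mono2) auto
        also have "\<dots> = \<eta>" by simp
        finally show ?thesis .
      qed
      have p: "p \<in> l2 R" "l2_norm R p \<le> \<eta>" using l2I[of R p \<eta>] pF by (auto simp: p_def)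
      have q: "q \<in> l2 R" "l2_norm R q \<le> C + \<eta>"
        unfolding q_def using f C \<eta>
        by (auto intro!: pos_op_l2 pos_op_row_tail A op_norm_bdd[OF n] nonneg_row_tail nn simp: l2_ball_def)
      have "l2_norm R (\<lambda>i. mat_op R A f i - m i) \<le> C + \<epsilon>"
        unfolding split using l2_add(2)[OF p(1) q(1)] p(2) q(2) by (simp add: \<eta>_def)
      then show "\<exists>m\<in>M. l2_norm R (\<lambda>i. mat_op R A f i - m i) \<le> C + \<epsilon>" using mM by blast
    qed
    then show ?thesis using C that by (intro noncompactness_le) auto
  qed
  then show "noncompactness R (mat_op R A) \<le> C" by (rule field_le_epsilon)
qed

lemma noncompactness_tail_bound:
  "pos_op R A \<Longrightarrow> tail_bound R A (noncompactness R (mat_op R A))"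
  using noncompactness_le_iff noncompactness_nonneg by blast

lemma tail_bound_mono:
  assumes "tail_bound R B C" "le_on R A B"
  shows "tail_bound R A C"
  unfolding tail_bound_def
proof (intro allI impI)
  fix \<epsilon> :: real assume "0 < \<epsilon>"
  then obtain n where "form_bound all_pairs R (row_tail n B) (C + \<epsilon>)"
    using assms(1) unfolding tail_bound_def by blast
  then have "form_bound all_pairs R (row_tail n A) (C + \<epsilon>)"
    by (rule form_bound_mono) (use assms(2) in \<open>auto simp: le_on_def row_tail_def\<close>)
  then show "\<exists>n. form_bound all_pairs R (row_tail n A) (C + \<epsilon>)" by blast
qed

lemma tail_bound_scale:
  assumes "tail_bound R A C" "0 \<le> c"
  shows "tail_bound R (\<lambda>i j. c * A i j) (c * C)"
  unfolding tail_bound_def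
proof (intro allI impI)
  fix \<epsilon> :: real assume \<epsilon>: "0 < \<epsilon>"
  then have "0 < \<epsilon> / (c + 1)" using assms(2) by simp
  then obtain n where "form_bound all_pairs R (row_tail n A) (C + \<epsilon> / (c + 1))"
    using assms(1) unfolding tail_bound_def by blast
  then have "form_bound all_pairs R (\<lambda>i j. c * row_tail n A i j) (c * (C + \<epsilon> / (c + 1)))"
    using assms(2) by (rule form_bound_scale)
  then have "form_bound all_pairs R (row_tail n (\<lambda>i j. c * A i j)) (c * C + \<epsilon>)"
    by (rule form_bound_mono) (use assms(2) \<epsilon> in \<open>auto simp: le_on_def row_tail_def field_simps\<close>)
  then show "\<exists>n. form_bound all_pairs R (row_tail n (\<lambda>i j. c * A i j)) (c * C + \<epsilon>)" by blast
qed

text \<open>Row tails commute with geometric means because at least one exponent is positive, which keeps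
  the cut-off entries at \<open>0\<close>. Continuity of the powers absorbs the \<open>\<epsilon>\<close> in both bounds.\<close>

lemma tail_bound_hmean:
  assumes A: "tail_bound R A a" "nonneg_matrix R A" and B: "tail_bound R B b" "nonneg_matrix R B"
    and e: "0 \<le> \<alpha>" "0 \<le> \<beta>" "\<alpha> + \<beta> = 1" and ab: "0 \<le> a" "0 \<le> b"
  shows "tail_bound R (hmean \<alpha> \<beta> A B) (rpow a \<alpha> * rpow b \<beta>)"
  unfolding tail_bound_def
proof (intro allI impI)
  fix \<epsilon> :: real assume \<epsilon>: "0 < \<epsilon>"
  have "(\<lambda>k. rpow (a + inverse (real (Suc k))) \<alpha> * rpow (b + inverse (real (Suc k))) \<beta>)
      \<longlonglongrightarrow> rpow (a + 0) \<alpha> * rpow (b + 0) \<beta>"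
    using ab e by (intro tendsto_mult tendsto_rpow tendsto_add tendsto_const LIMSEQ_inverse_real_of_nat) auto
  then have "\<forall>\<^sub>F k in sequentially. rpow (a + inverse (real (Suc k))) \<alpha> * rpow (b + inverse (real (Suc k))) \<beta>
      < rpow a \<alpha> * rpow b \<beta> + \<epsilon>"
    by (rule order_tendstoD) (use \<epsilon> in simp)
  then obtain k where k: "rpow (a + inverse (real (Suc k))) \<alpha> * rpow (b + inverse (real (Suc k))) \<beta>
      < rpow a \<alpha> * rpow b \<beta> + \<epsilon>"
    using eventually_happens'[OF sequentially_bot] by blast
  define t where "t = inverse (real (Suc k))"
  have t: "0 < t" by (simp add: t_def)
  obtain n where n: "form_bound all_pairs R (row_tail n A) (a + t)" using A(1) t unfolding tail_bound_def by blast
  obtain m where m: "form_bound all_pairs R (row_tail m B) (b + t)" using B(1) t unfolding tail_bound_def by blast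
  let ?N = "max n m"
  have "form_bound all_pairs R (hmean \<alpha> \<beta> (row_tail ?N A) (row_tail ?N B)) (rpow (a + t) \<alpha> * rpow (b + t) \<beta>)"
    using row_tail_antimono[OF A(2) n, of ?N] row_tail_antimono[OF B(2) m, of ?N] A B ab t e
    by (intro form_bound_hmean_1 nonneg_row_tail) auto
  then have "form_bound all_pairs R (row_tail ?N (hmean \<alpha> \<beta> A B)) (rpow a \<alpha> * rpow b \<beta> + \<epsilon>)"
    by (rule form_bound_mono) (use k in \<open>auto simp: le_on_def row_tail_def hmean_apply t_def\<close>)
  then show "\<exists>n. form_bound all_pairs R (row_tail n (hmean \<alpha> \<beta> A B)) (rpow a \<alpha> * rpow b \<beta> + \<epsilon>)" by blast
qed

text \<open>Rows beyond \<open>n\<close> and columns beyond \<open>n\<close> give the same limit: outside the row tail only finitely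
  many rows remain, and each of them, being square summable, has a small tail.\<close>

lemma tail_bound_adj:
  assumes A: "pos_op R A" and tb: "tail_bound R A C"
  shows "tail_bound R (mat_adj A) C"
  unfolding tail_bound_def
proof (intro allI impI)
  fix \<epsilon> :: real assume \<epsilon>: "0 < \<epsilon>"
  obtain N where N: "form_bound all_pairs R (row_tail N A) (C + \<epsilon>/2)"
    using tb \<epsilon> unfolding tail_bound_def by (meson half_gt_zero)
  \<comment> \<open>the \<open>N + 1\<close> rows \<open>0, \<dots>, N\<close> contribute at most \<open>\<epsilon>/2\<close> together\<close>
  define \<eta> where "\<eta> = \<epsilon> / (2 * (real N + 1))"
  have \<eta>: "0 < \<eta>" using \<epsilon> by (simp add: \<eta>_def)
  have nn: "nonneg_matrix R A" using A by (simp add: pos_op_def)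
  have "\<exists>n. \<forall>F. finite F \<and> F \<subseteq> R \<and> (\<forall>j\<in>F. n < j) \<longrightarrow> L2_set (A i) F \<le> \<eta>" if i: "i \<in> R" for i
  proof -
    have x: "mat_op R (mat_adj A) (unit_vec i) \<in> l2 R"
      using i by (intro pos_op_l2 pos_op_adj A finite_vec_l2) auto
    have "L2_set (\<lambda>j. cmod (mat_op R (mat_adj A) (unit_vec i) j)) F = L2_set (A i) F" if "F \<subseteq> R" for F
      using i that nn by (intro L2_set_cong) (auto simp: mat_op_unit_vec mat_adj_def subset_iff nonneg_matrixD)
    then show ?thesis using l2_tail_small[OF x \<eta>] by simp
  qed
  then have "\<forall>i\<in>R. \<exists>n. \<forall>F. finite F \<and> F \<subseteq> R \<and> (\<forall>j\<in>F. n < j) \<longrightarrow> L2_set (A i) F \<le> \<eta>" by simp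
  from bchoice[OF this] obtain \<nu> where \<nu>': "\<forall>i\<in>R. \<forall>F. finite F \<and> F \<subseteq> R \<and> (\<forall>j\<in>F. \<nu> i < j)
      \<longrightarrow> L2_set (A i) F \<le> \<eta>" by (elim exE)
  have \<nu>: "L2_set (A i) F \<le> \<eta>" if "i \<in> R" "finite F" "F \<subseteq> R" "\<forall>j\<in>F. \<nu> i < j" for i F
    using bspec[OF \<nu>' that(1)] that(2-4) by simp
  obtain n where n: "\<forall>i\<le>N. \<nu> i \<le> n" using finite_nat_set_iff_bounded_le[of "\<nu> ` {..N}"] by auto
  define A' where "A' = (\<lambda>i j. if i \<le> N \<and> n < j then A i j else 0)"
  have A': "form_bound all_pairs R A' (\<epsilon>/2)"
  proof (rule form_boundI)
    fix F and x y :: "nat \<Rightarrow> real"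
    assume *: "finite F" "F \<subseteq> R" "\<And>i. 0 \<le> x i" "\<And>i. 0 \<le> y i"
    have row: "(\<Sum>j\<in>F. A' i j * x j) \<le> \<eta> * L2_set x F" if i: "i \<in> F" "i \<le> N" for i
    proof -
      let ?G = "{j\<in>F. n < j}"
      have "(\<Sum>j\<in>F. A' i j * x j) = (\<Sum>j\<in>?G. A i j * x j)"
        using * i by (intro sum.mono_neutral_cong_right) (auto simp: A'_def)
      also have "\<dots> \<le> (\<Sum>j\<in>?G. \<bar>A i j\<bar> * \<bar>x j\<bar>)" by (intro sum_mono) (metis abs_ge_self abs_mult)
      also have "\<dots> \<le> L2_set (A i) ?G * L2_set x ?G" by (rule L2_set_mult_ineq)
      also have "\<dots> \<le> \<eta> * L2_set x F"
      proof (rule mult_mono)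
        show "L2_set (A i) ?G \<le> \<eta>" using * i n by (intro \<nu>) (auto intro: le_less_trans)
        show "L2_set x ?G \<le> L2_set x F"
          unfolding L2_set_def using * by (intro real_sqrt_le_mono sum_mono2) auto
      qed (use \<eta> in auto)
      finally show ?thesis .
    qed
    have "(\<Sum>i\<in>F. \<Sum>j\<in>F. y i * A' i j * x j) = (\<Sum>i\<in>F. y i * (\<Sum>j\<in>F. A' i j * x j))"
      by (simp add: sum_distrib_left mult.assoc)
    also have "\<dots> = (\<Sum>i\<in>F\<inter>{..N}. y i * (\<Sum>j\<in>F. A' i j * x j))"
      using * by (intro sum.mono_neutral_right) (auto simp: A'_def)
    also have "\<dots> \<le> (\<Sum>i\<in>F\<inter>{..N}. L2_set y F * (\<eta> * L2_set x F))"
      using * \<eta> row by (intro sum_mono mult_mono member_le_L2_set)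
        (auto intro!: sum_nonneg mult_nonneg_nonneg nonneg_matrixD[OF nn] simp: A'_def)
    also have "\<dots> \<le> (\<Sum>i\<in>{..N}. L2_set y F * (\<eta> * L2_set x F))"
      using \<eta> by (intro sum_mono2) auto
    also have "\<dots> = \<epsilon>/2 * (L2_set x F * L2_set y F)" by (simp add: \<eta>_def field_simps)
    finally show "(\<Sum>i\<in>F. \<Sum>j\<in>F. y i * A' i j * x j) \<le> \<epsilon>/2 * (L2_set x F * L2_set y F)" .
  qed
  have "form_bound all_pairs R (\<lambda>i j. row_tail N A i j + A' i j) (C + \<epsilon>/2 + \<epsilon>/2)"
    by (rule form_bound_add[OF N A'])
  then have "form_bound all_pairs R (mat_adj (\<lambda>i j. row_tail N A i j + A' i j)) (C + \<epsilon>/2 + \<epsilon>/2)"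
    by (rule form_bound_adj) (simp add: symp_def)
  then have "form_bound all_pairs R (row_tail n (mat_adj A)) (C + \<epsilon>)"
    by (rule form_bound_mono) (auto simp: le_on_def mat_adj_def row_tail_def A'_def nonneg_matrixD[OF nn])
  then show "\<exists>n. form_bound all_pairs R (row_tail n (mat_adj A)) (C + \<epsilon>)" by blast
qed

section \<open>Monotone functionals that respect geometric means\<close>

text \<open>The common properties of all five quantities. The set \<open>S\<close> collects the admissible values of
  \<open>\<alpha> + \<beta>\<close> in the inequality for geometric means: it is \<open>{1..}\<close> for the norm, which
  bounds every entry, and for the spectral radius, which inherits the inequality from the norms of the
  powers, and \<open>{1}\<close> for the other three.\<close>

locale matrix_functional =
  fixes R :: "nat set" and S :: "real set" and g :: "matrix \<Rightarrow> real"
  assumes S: "1 \<in> S" "S \<subseteq> {1..}"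
    and nonneg: "pos_op R A \<Longrightarrow> 0 \<le> g A"
    and mono: "\<lbrakk>pos_op R A; pos_op R B; le_on R A B\<rbrakk> \<Longrightarrow> g A \<le> g B"
    and scale: "\<lbrakk>pos_op R A; 0 \<le> c\<rbrakk> \<Longrightarrow> g (\<lambda>i j. c * A i j) \<le> c * g A"
    and adj: "pos_op R A \<Longrightarrow> g (mat_adj A) \<le> g A"
    and hmean: "\<lbrakk>pos_op R A; pos_op R B; 0 \<le> \<alpha>; 0 \<le> \<beta>; \<alpha> + \<beta> \<in> S\<rbrakk>
      \<Longrightarrow> g (hmean \<alpha> \<beta> A B) \<le> rpow (g A) \<alpha> * rpow (g B) \<beta>"

text \<open>The norm, the numerical radius and the measure of noncompactness are each the least \<open>C\<close> that
  satisfies a condition \<open>P A C\<close>, and their properties can be read off from those of \<open>P\<close>.\<close>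

lemma matrix_functional_least_bound:
  assumes "1 \<in> S" "S \<subseteq> {1..}"
    and nonneg: "\<And>A. pos_op R A \<Longrightarrow> 0 \<le> g A"
    and bound: "\<And>A. pos_op R A \<Longrightarrow> P A (g A)"
    and least: "\<And>A C. \<lbrakk>pos_op R A; P A C; 0 \<le> C\<rbrakk> \<Longrightarrow> g A \<le> C"
    and mono: "\<And>A B C. \<lbrakk>P B C; le_on R A B\<rbrakk> \<Longrightarrow> P A C"
    and scale: "\<And>A C c. \<lbrakk>P A C; 0 \<le> c\<rbrakk> \<Longrightarrow> P (\<lambda>i j. c * A i j) (c * C)"
    and adj: "\<And>A C. \<lbrakk>pos_op R A; P A C\<rbrakk> \<Longrightarrow> P (mat_adj A) C"
    and hmean: "\<And>A B a b \<alpha> \<beta>. \<lbrakk>P A a; nonneg_matrix R A; P B b; nonneg_matrix R B;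
        0 \<le> \<alpha>; 0 \<le> \<beta>; \<alpha> + \<beta> \<in> S; 0 \<le> a; 0 \<le> b\<rbrakk> \<Longrightarrow> P (hmean \<alpha> \<beta> A B) (rpow a \<alpha> * rpow b \<beta>)"
  shows "matrix_functional R S g"
proof
  fix A B :: matrix
  assume A: "pos_op R A"
  show "0 \<le> g A" using A by (rule nonneg)
  show "g (\<lambda>i j. c * A i j) \<le> c * g A" if "0 \<le> c" for c
    by (rule least[OF pos_op_scale[OF A that] scale[OF bound[OF A] that]]) (simp add: that nonneg A)
  show "g (mat_adj A) \<le> g A"
    by (rule least[OF pos_op_adj[OF A] adj[OF A bound[OF A]] nonneg[OF A]])
  assume B: "pos_op R B"
  show "g A \<le> g B" if "le_on R A B"
    by (rule least[OF A mono[OF bound[OF B] that] nonneg[OF B]])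
  show "g (hmean \<alpha> \<beta> A B) \<le> rpow (g A) \<alpha> * rpow (g B) \<beta>"
    if e: "0 \<le> \<alpha>" "0 \<le> \<beta>" "\<alpha> + \<beta> \<in> S" for \<alpha> \<beta>
  proof (rule least)
    show "pos_op R (hmean \<alpha> \<beta> A B)" using e assms(2) by (intro pos_op_hmean A B) auto
    show "P (hmean \<alpha> \<beta> A B) (rpow (g A) \<alpha> * rpow (g B) \<beta>)"
      using A B e by (intro hmean bound nonneg) (auto simp: pos_op_def)
  qed simp
qed (use assms in auto)

lemma matrix_functional_op_norm:
  assumes R: "R \<noteq> {}"
  shows "matrix_functional R {1..} (\<lambda>A. op_norm R (mat_op R A))"
proof (rule matrix_functional_least_bound[where P = "form_bound all_pairs R"])
  show "0 \<le> op_norm R (mat_op R A)" if "pos_op R A" for A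
    using that form_bound_nonneg[OF op_norm_form_bound[OF that] _ _ R]
    by (auto simp: pos_op_def reflp_def)
qed (auto intro: op_norm_form_bound op_norm_le form_bound_scale form_bound_hmean form_bound_adj form_bound_mono simp: symp_def)

lemma matrix_functional_numerical_radius:
  assumes R: "R \<noteq> {}"
  shows "matrix_functional R {1} (\<lambda>A. numerical_radius R (mat_op R A))"
proof (rule matrix_functional_least_bound[where P = "form_bound (=) R"])
  show "0 \<le> numerical_radius R (mat_op R A)" if "pos_op R A" for A
    using that form_bound_nonneg[OF numerical_radius_least(1)[OF that R] _ _ R]
    by (auto simp: pos_op_def)
qed (auto intro: numerical_radius_least[OF _ R] form_bound_scale form_bound_hmean_1 form_bound_adj form_bound_mono simp: symp_def)

lemma matrix_functional_noncompactness:
  "matrix_functional R {1} (\<lambda>A. noncompactness R (mat_op R A))"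
  by (rule matrix_functional_least_bound[where P = "tail_bound R"])
    (auto intro: noncompactness_nonneg noncompactness_tail_bound tail_bound_mono tail_bound_scale tail_bound_adj tail_bound_hmean
      simp: noncompactness_le_iff[symmetric])

subsection \<open>Asymptotic radii\<close>

text \<open>Fekete's lemma in multiplicative form: if \<open>root m (a m) < c\<close> for a single \<open>m\<close>, then splitting off
  blocks of length \<open>m\<close> gives \<open>a n \<le> c\<^sup>n B\<close> for all \<open>n\<close>, and \<open>root n B\<close> tends to \<open>1\<close>.\<close>

lemma submult_root_limit:
  fixes a :: "nat \<Rightarrow> real"
  assumes a0: "\<And>n. 0 \<le> a n" and sub: "\<And>m n. a (m + n) \<le> a m * a n"
  obtains L where "(\<lambda>n. root n (a n)) \<longlonglongrightarrow> L" "\<And>n. 1 \<le> n \<Longrightarrow> L \<le> root n (a n)"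
proof
  let ?X = "(\<lambda>n. root n (a n)) ` {1..}"
  define L where "L = Inf ?X"
  have bdd: "bdd_below ?X" by (rule bdd_belowI[of _ 0]) (use a0 in auto)
  show lower: "L \<le> root n (a n)" if "1 \<le> n" for n
    unfolding L_def using bdd that by (intro cInf_lower) auto
  have upper: "\<forall>\<^sub>F n in sequentially. root n (a n) < L + \<epsilon>" if \<epsilon>: "0 < \<epsilon>" for \<epsilon>
  proof -
    have "\<exists>t\<in>?X. t < L + \<epsilon>/2" unfolding L_def using \<epsilon> by (intro cInf_lessD) (auto simp: less_add_same_cancel1)
    then obtain m where m: "1 \<le> m" "root m (a m) < L + \<epsilon>/2" by auto
    define c where "c = L + \<epsilon>/2"
    have "0 \<le> root m (a m)" by (rule real_root_pos_pos_le[OF a0])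
    then have c: "0 < c" using m(2) unfolding c_def by linarith
    have am: "a m \<le> c ^ m"
      using power_mono[of "root m (a m)" c m] m a0[of m] by (simp add: c_def)
    \<comment> \<open>bounds the remainders of the division by \<open>m\<close>; the summand \<open>1\<close> makes it positive\<close>
    define B where "B = (\<Sum>s<m. a s / c ^ s) + 1"
    have B: "1 \<le> B" unfolding B_def using a0 c by (auto intro!: sum_nonneg)
    have bound: "a n \<le> c ^ n * B" for n
    proof (induction n rule: less_induct)
      case (less n)
      show ?case
      proof (cases "n < m")
        case True
        then have "a n / c ^ n \<le> (\<Sum>s<m. a s / c ^ s)" using a0 c by (intro member_le_sum) auto
        then have "a n / c ^ n \<le> B" by (simp add: B_def)
        then show ?thesis using c by (simp add: divide_le_eq mult.commute)
      next
        case False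
        then have "a n \<le> a m * a (n - m)" using sub[of m "n - m"] by simp
        also have "\<dots> \<le> c ^ m * (c ^ (n - m) * B)" using False m am a0 c by (intro mult_mono less) auto
        also have "\<dots> = c ^ n * B" using False by (simp flip: power_add mult.assoc)
        finally show ?thesis .
      qed
    qed
    have "(\<lambda>n. c * root n B) \<longlonglongrightarrow> c * 1" using B by (intro tendsto_mult tendsto_const LIMSEQ_root_const) auto
    then have "\<forall>\<^sub>F n in sequentially. c * root n B < L + \<epsilon>" by (rule order_tendstoD) (use \<epsilon> in \<open>simp add: c_def\<close>)
    moreover have "\<forall>\<^sub>F n in sequentially. root n (a n) \<le> c * root n B"
    proof (rule eventually_sequentiallyI)
      fix n :: nat assume n: "1 \<le> n"
      have "root n (a n) \<le> root n (c ^ n * B)" using n bound by (intro real_root_le_mono) auto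
      also have "\<dots> = c * root n B" using n c by (simp add: real_root_mult real_root_power_cancel)
      finally show "root n (a n) \<le> c * root n B" .
    qed
    ultimately show ?thesis by eventually_elim linarith
  qed
  show "(\<lambda>n. root n (a n)) \<longlonglongrightarrow> L"
  proof (rule order_tendstoI)
    fix t assume "t < L"
    then show "\<forall>\<^sub>F n in sequentially. t < root n (a n)"
      by (intro eventually_sequentiallyI[of 1]) (use lower in \<open>force intro: less_le_trans\<close>)
  next
    fix t assume "L < t"
    then show "\<forall>\<^sub>F n in sequentially. root n (a n) < t" using upper[of "t - L"] by simp
  qed
qed

text \<open>For the operator norm this is the spectral radius, for the measure of noncompactness the essential
  spectral radius.\<close>

definition asymp_radius :: "nat set \<Rightarrow> (matrix \<Rightarrow> real) \<Rightarrow> matrix \<Rightarrow> real" where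
  "asymp_radius R g A = lim (\<lambda>n. root n (g (mat_pow R A n)))"

locale submult_functional = matrix_functional +
  assumes submult: "\<lbrakk>pos_op R A; pos_op R B\<rbrakk> \<Longrightarrow> g (mat_mult R A B) \<le> g A * g B"
begin

lemma cong: "\<lbrakk>pos_op R A; pos_op R B; eq_on R A B\<rbrakk> \<Longrightarrow> g A = g B"
  by (intro order_antisym mono) (auto intro: eq_on_imp_le_on)

lemma radius_limit:
  assumes A: "pos_op R A"
  shows "(\<lambda>n. root n (g (mat_pow R A n))) \<longlonglongrightarrow> asymp_radius R g A"
    and "1 \<le> n \<Longrightarrow> asymp_radius R g A \<le> root n (g (mat_pow R A n))"
proof -
  note P = pos_op_mat_pow[OF A]
  have "g (mat_pow R A (m + n)) \<le> g (mat_pow R A m) * g (mat_pow R A n)" for m n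
    using cong[OF P _ mat_pow_add[OF A, of m n]] submult[OF P P, of m n] pos_op_mat_mult[OF P P]
    by simp
  from submult_root_limit[of "\<lambda>n. g (mat_pow R A n)", OF nonneg[OF P] this]
  obtain L where L: "(\<lambda>n. root n (g (mat_pow R A n))) \<longlonglongrightarrow> L" "\<And>n. 1 \<le> n \<Longrightarrow> L \<le> root n (g (mat_pow R A n))"
    by blast
  have "asymp_radius R g A = L" unfolding asymp_radius_def using L(1) by (rule limI)
  then show "(\<lambda>n. root n (g (mat_pow R A n))) \<longlonglongrightarrow> asymp_radius R g A"
    and "1 \<le> n \<Longrightarrow> asymp_radius R g A \<le> root n (g (mat_pow R A n))" using L by auto
qed

lemma radius_nonneg: "pos_op R A \<Longrightarrow> 0 \<le> asymp_radius R g A"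
  using radius_limit(1)[of A] nonneg[OF pos_op_mat_pow[of R A]]
  by (intro LIMSEQ_le_const) (auto intro: real_root_pos_pos_le)

lemma radius_le:
  assumes "pos_op R A" "X \<longlonglongrightarrow> L" "\<And>n. 1 \<le> n \<Longrightarrow> root n (g (mat_pow R A n)) \<le> X n"
  shows "asymp_radius R g A \<le> L"
  using radius_limit(1)[OF assms(1)] assms(2,3) by (intro LIMSEQ_le) auto

text \<open>Each property of \<open>g\<close> is applied to \<open>n\<close>th powers. For geometric means, the \<open>n\<close>th power of the mean is
  dominated by the mean of the \<open>n\<close>th powers.\<close>

lemma matrix_functional_radius: "matrix_functional R S (asymp_radius R g)"
proof
  fix A B :: matrix
  assume A: "pos_op R A"
  note PA = pos_op_mat_pow[OF A]
  show "0 \<le> asymp_radius R g A" using A by (rule radius_nonneg)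
  show "asymp_radius R g (\<lambda>i j. c * A i j) \<le> c * asymp_radius R g A" if c: "0 \<le> c" for c
  proof (rule radius_le[OF pos_op_scale[OF A c] tendsto_mult[OF tendsto_const radius_limit(1)[OF A]]])
    fix n :: nat assume n: "1 \<le> n"
    have "root n (g (mat_pow R (\<lambda>i j. c * A i j) n)) \<le> root n (c ^ n * g (mat_pow R A n))"
      using n c scale[OF PA, of "c ^ n" n] by (intro real_root_le_mono) (auto simp: mat_pow_scale)
    also have "\<dots> = c * root n (g (mat_pow R A n))" using n c by (simp add: real_root_mult real_root_power_cancel)
    finally show "root n (g (mat_pow R (\<lambda>i j. c * A i j) n)) \<le> c * root n (g (mat_pow R A n))" .
  qed
  show "asymp_radius R g (mat_adj A) \<le> asymp_radius R g A"
  proof (rule radius_le[OF pos_op_adj[OF A] radius_limit(1)[OF A]])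
    fix n :: nat assume n: "1 \<le> n"
    have "g (mat_pow R (mat_adj A) n) = g (mat_adj (mat_pow R A n))"
      by (intro cong pos_op_mat_pow pos_op_adj A mat_pow_adj)
    also have "\<dots> \<le> g (mat_pow R A n)" by (rule adj[OF PA])
    finally show "root n (g (mat_pow R (mat_adj A) n)) \<le> root n (g (mat_pow R A n))"
      using n by (intro real_root_le_mono) auto
  qed
  assume B: "pos_op R B"
  note PB = pos_op_mat_pow[OF B]
  show "asymp_radius R g A \<le> asymp_radius R g B" if "le_on R A B"
  proof (rule radius_le[OF A radius_limit(1)[OF B]])
    fix n :: nat assume n: "1 \<le> n"
    show "root n (g (mat_pow R A n)) \<le> root n (g (mat_pow R B n))"
      using n by (intro real_root_le_mono mono PA PB mat_pow_mono that A B) auto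
  qed
  show "asymp_radius R g (hmean \<alpha> \<beta> A B) \<le> rpow (asymp_radius R g A) \<alpha> * rpow (asymp_radius R g B) \<beta>"
    if e: "0 \<le> \<alpha>" "0 \<le> \<beta>" "\<alpha> + \<beta> \<in> S" for \<alpha> \<beta>
  proof -
    have e1: "1 \<le> \<alpha> + \<beta>" using e S by auto
    have H: "pos_op R (hmean \<alpha> \<beta> A B)" by (rule pos_op_hmean[OF A B e(1,2) e1])
    have root0: "0 \<le> root n (g (mat_pow R A n))" "0 \<le> root n (g (mat_pow R B n))" for n
      by (intro real_root_pos_pos_le nonneg PA PB)+
    show ?thesis
    proof (rule radius_le[OF H])
      show "(\<lambda>n. rpow (root n (g (mat_pow R A n))) \<alpha> * rpow (root n (g (mat_pow R B n))) \<beta>)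
        \<longlonglongrightarrow> rpow (asymp_radius R g A) \<alpha> * rpow (asymp_radius R g B) \<beta>"
        by (intro tendsto_mult tendsto_rpow radius_limit(1) A B e root0)
      fix n :: nat assume n: "1 \<le> n"
      have "g (mat_pow R (hmean \<alpha> \<beta> A B) n) \<le> g (hmean \<alpha> \<beta> (mat_pow R A n) (mat_pow R B n))"
        by (intro mono pos_op_mat_pow[OF H] pos_op_hmean PA PB mat_pow_hmean A B e e1)
      also have "\<dots> \<le> rpow (g (mat_pow R A n)) \<alpha> * rpow (g (mat_pow R B n)) \<beta>" by (rule hmean[OF PA PB e])
      finally have "root n (g (mat_pow R (hmean \<alpha> \<beta> A B) n))
          \<le> root n (rpow (g (mat_pow R A n)) \<alpha> * rpow (g (mat_pow R B n)) \<beta>)"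
        using n by (intro real_root_le_mono) auto
      also have "\<dots> = rpow (root n (g (mat_pow R A n))) \<alpha> * rpow (root n (g (mat_pow R B n))) \<beta>"
        using n nonneg PA PB by (simp add: real_root_mult rpow_root)
      finally show "root n (g (mat_pow R (hmean \<alpha> \<beta> A B) n))
          \<le> rpow (root n (g (mat_pow R A n))) \<alpha> * rpow (root n (g (mat_pow R B n))) \<beta>" .
    qed
  qed
qed (use S in auto)

text \<open>The \<open>n + 1\<close>st power of \<open>A B\<close> is \<open>A (B A)\<^sup>n B\<close>, and the two outer factors do not influence the
  growth rate.\<close>

lemma radius_mat_mult_commute_le:
  assumes A: "pos_op R A" and B: "pos_op R B"
  shows "asymp_radius R g (mat_mult R A B) \<le> asymp_radius R g (mat_mult R B A)"
proof (rule dense_ge)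
  fix c assume c: "asymp_radius R g (mat_mult R B A) < c"
  note AB = pos_op_mat_mult[OF A B] and BA = pos_op_mat_mult[OF B A]
  have c0: "0 < c" using radius_nonneg[OF BA] c by simp
  define K where "K = g A * g B / c + 1"
  have K: "1 \<le> K" unfolding K_def using nonneg A B c0 by simp
  have lim: "(\<lambda>n. root n K * c) \<longlonglongrightarrow> 1 * c" using K by (intro tendsto_mult tendsto_const LIMSEQ_root_const) auto
  have "\<forall>\<^sub>F n in sequentially. root n (g (mat_pow R (mat_mult R B A) n)) < c"
    by (rule order_tendstoD(2)[OF radius_limit(1)[OF BA] c])
  then obtain N where N: "\<And>n. N \<le> n \<Longrightarrow> root n (g (mat_pow R (mat_mult R B A) n)) < c"
    by (auto simp: eventually_sequentially)
  have "asymp_radius R g (mat_mult R A B) \<le> root n K * c" if n: "N + 2 \<le> n" for n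
  proof -
    obtain m where m: "n = Suc m" "N \<le> m" "1 \<le> m" using n by (cases n) auto
    let ?P = "mat_pow R (mat_mult R B A) m"
    have P: "pos_op R ?P" by (rule pos_op_mat_pow[OF BA])
    have gP: "g ?P \<le> c ^ m"
      using power_mono[of "root m (g ?P)" c m] N[OF m(2)] nonneg[OF P] m by simp
    have "g (mat_pow R (mat_mult R A B) n) = g (mat_mult R A (mat_mult R ?P B))"
      unfolding m(1) by (intro cong mat_pow_rotate pos_op_mat_pow pos_op_mat_mult A B P)
    also have "\<dots> \<le> g A * g (mat_mult R ?P B)"
      by (intro submult pos_op_mat_mult A B P)
    also have "\<dots> \<le> g A * (g ?P * g B)"
      by (intro mult_left_mono submult nonneg A B P)
    also have "\<dots> \<le> g A * (c ^ m * g B)"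
      by (intro mult_left_mono mult_right_mono gP nonneg A B)
    also have "\<dots> = (K - 1) * c ^ n" using c0 by (simp add: K_def m(1) field_simps)
    also have "\<dots> \<le> K * c ^ n" using c0 by (intro mult_right_mono) auto
    finally have "root n (g (mat_pow R (mat_mult R A B) n)) \<le> root n (K * c ^ n)"
      using m by (intro real_root_le_mono) auto
    also have "\<dots> = root n K * c" using m(1) c0 by (simp add: real_root_mult real_root_power_cancel del: power_Suc)
    finally show ?thesis using radius_limit(2)[OF AB, of n] n by linarith
  qed
  then show "asymp_radius R g (mat_mult R A B) \<le> c"
    using LIMSEQ_le_const[OF lim] by (metis mult_1)
qed

lemma radius_mat_mult_commute:
  "\<lbrakk>pos_op R A; pos_op R B\<rbrakk>
    \<Longrightarrow> asymp_radius R g (mat_mult R A B) = asymp_radius R g (mat_mult R B A)"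
  by (intro order_antisym radius_mat_mult_commute_le)

end

lemma op_norm_mat_mult:
  assumes R: "R \<noteq> {}" and A: "pos_op R A" and B: "pos_op R B"
  shows "op_norm R (mat_op R (mat_mult R A B)) \<le> op_norm R (mat_op R A) * op_norm R (mat_op R B)"
proof -
  interpret matrix_functional R "{1..}" "\<lambda>A. op_norm R (mat_op R A)" using R by (rule matrix_functional_op_norm)
  have "l2_norm R (mat_op R (mat_mult R A B) x) \<le> op_norm R (mat_op R A) * op_norm R (mat_op R B)"
    if x: "x \<in> l2_ball R" for x
  proof -
    have x': "x \<in> l2 R" "l2_norm R x \<le> 1" using x by (auto simp: l2_ball_def)
    have "l2_norm R (mat_op R (mat_mult R A B) x) \<le> op_norm R (mat_op R A) * l2_norm R (mat_op R B x)"
      using x' by (simp add: mat_op_mat_mult A B l2_norm_mat_op_le pos_op_l2)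
    also have "\<dots> \<le> op_norm R (mat_op R A) * (op_norm R (mat_op R B) * l2_norm R x)"
      using x' by (intro mult_left_mono l2_norm_mat_op_le nonneg A B)
    also have "\<dots> \<le> op_norm R (mat_op R A) * (op_norm R (mat_op R B) * 1)"
      using x' by (intro mult_left_mono nonneg A B)
    finally show ?thesis by simp
  qed
  then show ?thesis
    unfolding op_norm_def[of R "mat_op R (mat_mult R A B)"]
    by (intro cSup_least) (auto simp: l2_ball_def intro!: exI[of _ "\<lambda>_. 0"])
qed

lemma submult_op_norm:
  "R \<noteq> {} \<Longrightarrow> submult_functional R {1..} (\<lambda>A. op_norm R (mat_op R A))"
  by (simp add: submult_functional_def matrix_functional_op_norm submult_functional_axioms_def op_norm_mat_mult)

lemma submult_noncompactness:
  "submult_functional R {1} (\<lambda>A. noncompactness R (mat_op R A))"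
  by (simp add: submult_functional_def matrix_functional_noncompactness submult_functional_axioms_def noncompactness_mat_mult)

lemma ess_spectral_radius_asymp:
  assumes A: "pos_op R A"
  shows "ess_spectral_radius R (mat_op R A) = asymp_radius R (\<lambda>A. noncompactness R (mat_op R A)) A"
proof -
  have "noncompactness R (mat_op R A ^^ n) = noncompactness R (mat_op R (mat_pow R A n))" for n
    by (rule noncompactness_cong) (simp add: mat_op_mat_pow A)
  then show ?thesis by (simp add: ess_spectral_radius_def asymp_radius_def)
qed

section \<open>The spectral radius formula\<close>

subsection \<open>Absolutely convergent series of vectors\<close>

lemma l2_sum:
  assumes "finite I" "\<And>n. n \<in> I \<Longrightarrow> v n \<in> l2 R"
  shows "(\<lambda>i. \<Sum>n\<in>I. v n i) \<in> l2 R \<and> l2_norm R (\<lambda>i. \<Sum>n\<in>I. v n i) \<le> (\<Sum>n\<in>I. l2_norm R (v n))"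
  using assms
proof (induction I rule: finite_induct)
  case (insert n I)
  then have IH: "(\<lambda>i. \<Sum>n\<in>I. v n i) \<in> l2 R" "l2_norm R (\<lambda>i. \<Sum>n\<in>I. v n i) \<le> (\<Sum>n\<in>I. l2_norm R (v n))"
    and v: "v n \<in> l2 R" by auto
  show ?case using l2_add[OF v IH(1)] IH(2) insert.hyps by simp
qed simp

lemma l2_series:
  assumes v: "\<And>n. v n \<in> l2 R" and sm: "summable (\<lambda>n. l2_norm R (v n))"
  shows "summable (\<lambda>n. v n i)" and "(\<lambda>i. \<Sum>n. v n i) \<in> l2 R"
    and "l2_norm R (\<lambda>i. \<Sum>n. v n i) \<le> (\<Sum>n. l2_norm R (v n))"
proof -
  have s: "summable (\<lambda>n. v n i)" for i
    by (rule summable_comparison_test'[OF sm]) (rule cmod_le_l2_norm[OF v])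
  then show "summable (\<lambda>n. v n i)" .
  have L: "L2_set (\<lambda>i. cmod (\<Sum>n. v n i)) F \<le> (\<Sum>n. l2_norm R (v n))" if F: "finite F" "F \<subseteq> R" for F
  proof (rule LIMSEQ_le_const2)
    show "(\<lambda>N. L2_set (\<lambda>i. cmod (\<Sum>n<N. v n i)) F) \<longlonglongrightarrow> L2_set (\<lambda>i. cmod (\<Sum>n. v n i)) F"
      unfolding L2_set_def by (intro tendsto_intros summable_LIMSEQ s)
    have "L2_set (\<lambda>i. cmod (\<Sum>n<N. v n i)) F \<le> (\<Sum>n. l2_norm R (v n))" for N
    proof -
      have "L2_set (\<lambda>i. cmod (\<Sum>n<N. v n i)) F \<le> l2_norm R (\<lambda>i. \<Sum>n<N. v n i)"
        using l2_sum[of "{..<N}" v R] v by (intro L2_set_le_l2_norm F) auto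
      also have "\<dots> \<le> (\<Sum>n<N. l2_norm R (v n))" using l2_sum[of "{..<N}" v R] v by auto
      also have "\<dots> \<le> (\<Sum>n. l2_norm R (v n))" by (rule sum_le_suminf[OF sm]) auto
      finally show ?thesis .
    qed
    then show "\<exists>N. \<forall>n\<ge>N. L2_set (\<lambda>i. cmod (\<Sum>m<n. v m i)) F \<le> (\<Sum>n. l2_norm R (v n))" by blast
  qed
  have 0: "(\<Sum>n. v n i) = 0" if "i \<notin> R" for i using l2_outside[OF v that] by simp
  show "(\<lambda>i. \<Sum>n. v n i) \<in> l2 R" "l2_norm R (\<lambda>i. \<Sum>n. v n i) \<le> (\<Sum>n. l2_norm R (v n))"
    using l2I[of R "\<lambda>i. \<Sum>n. v n i" "\<Sum>n. l2_norm R (v n)"] 0 L by blast+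
qed

lemma mat_op_zero: "mat_op R A (\<lambda>_. 0) = (\<lambda>_. 0)"
  by (auto simp: mat_op_def)

lemma mat_op_sum:
  assumes A: "pos_op R A" and "finite I" "\<And>n. n \<in> I \<Longrightarrow> v n \<in> l2 R"
  shows "mat_op R A (\<lambda>i. \<Sum>n\<in>I. v n i) = (\<lambda>i. \<Sum>n\<in>I. mat_op R A (v n) i)"
  using assms(2,3)
proof (induction I rule: finite_induct)
  case (insert n I)
  then show ?case using mat_op_linear(1)[OF A, of "v n" "\<lambda>i. \<Sum>n\<in>I. v n i"] l2_sum[of I v R] by simp
qed (simp add: mat_op_zero)

lemma mat_op_series:
  assumes R: "R \<noteq> {}" and A: "pos_op R A"
    and v: "\<And>n. v n \<in> l2 R" and sm: "summable (\<lambda>n. l2_norm R (v n))"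
  shows "(\<lambda>n. mat_op R A (v n) i) sums mat_op R A (\<lambda>i. \<Sum>n. v n i) i"
proof -
  interpret matrix_functional R "{1..}" "\<lambda>A. op_norm R (mat_op R A)" using R by (rule matrix_functional_op_norm)
  let ?s = "\<lambda>i. \<Sum>n. v n i" and ?C = "op_norm R (mat_op R A)"
  let ?t = "\<lambda>N. (\<Sum>n. l2_norm R (v n)) - (\<Sum>n<N. l2_norm R (v n))"
  note s = l2_series(2)[OF v sm]
  have bound: "cmod (mat_op R A ?s i - (\<Sum>n<N. mat_op R A (v n) i)) \<le> ?C * ?t N" for N
  proof -
    have sN: "(\<lambda>i. \<Sum>n<N. v n i) \<in> l2 R" using l2_sum[of "{..<N}" v R] v by auto
    have smN: "summable (\<lambda>n. l2_norm R (v (n + N)))" using sm by (rule summable_ignore_initial_segment)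
    have "mat_op R A ?s i - (\<Sum>n<N. mat_op R A (v n) i) = mat_op R A (\<lambda>i. ?s i - (\<Sum>n<N. v n i)) i"
      using mat_op_linear(2)[OF A s sN] mat_op_sum[OF A, of "{..<N}" v] v by simp
    also have "(\<lambda>i. ?s i - (\<Sum>n<N. v n i)) = (\<lambda>i. \<Sum>n. v (n + N) i)"
      using suminf_minus_initial_segment[OF l2_series(1)[OF v sm]] by simp
    also have "cmod (mat_op R A (\<lambda>i. \<Sum>n. v (n + N) i) i) \<le> l2_norm R (mat_op R A (\<lambda>i. \<Sum>n. v (n + N) i))"
      by (intro cmod_le_l2_norm pos_op_l2 A l2_series(2)[OF v smN])
    also have "\<dots> \<le> ?C * l2_norm R (\<lambda>i. \<Sum>n. v (n + N) i)"
      by (intro l2_norm_mat_op_le A l2_series(2)[OF v smN])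
    also have "\<dots> \<le> ?C * (\<Sum>n. l2_norm R (v (n + N)))"
      by (intro mult_left_mono l2_series(3)[OF v smN] nonneg A)
    also have "(\<Sum>n. l2_norm R (v (n + N))) = ?t N" by (rule suminf_minus_initial_segment[OF sm])
    finally show ?thesis .
  qed
  have "(\<lambda>N. ?C * ?t N) \<longlonglongrightarrow> ?C * ((\<Sum>n. l2_norm R (v n)) - (\<Sum>n. l2_norm R (v n)))"
    by (intro tendsto_intros summable_LIMSEQ sm)
  then have "(\<lambda>N. ?C * ?t N) \<longlonglongrightarrow> 0" by simp
  then have "(\<lambda>N. mat_op R A ?s i - (\<Sum>n<N. mat_op R A (v n) i)) \<longlonglongrightarrow> 0"
    by (rule Lim_null_comparison[OF always_eventually, rotated]) (use bound in auto)
  then have "(\<lambda>N. mat_op R A ?s i - (mat_op R A ?s i - (\<Sum>n<N. mat_op R A (v n) i))) \<longlonglongrightarrow> mat_op R A ?s i - 0"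
    by (intro tendsto_diff tendsto_const)
  then show ?thesis by (simp add: sums_def)
qed

subsection \<open>The Neumann series\<close>

abbreviation norm_radius :: "nat set \<Rightarrow> matrix \<Rightarrow> real" where
  "norm_radius R \<equiv> asymp_radius R (\<lambda>A. op_norm R (mat_op R A))"

lemma not_in_spectrum:
  assumes R: "R \<noteq> {}" and A: "pos_op R A" and z: "norm_radius R A < cmod z"
  shows "z \<notin> spectrum R (mat_op R A)"
proof -
  interpret submult_functional R "{1..}" "\<lambda>A. op_norm R (mat_op R A)"
    using R by (rule submult_op_norm)
  define T where "T = mat_op R A"
  define a where "a n = op_norm R (mat_op R (mat_pow R A n))" for n
  have a0: "0 \<le> a n" for n unfolding a_def by (intro nonneg pos_op_mat_pow A)
  have z0: "z \<noteq> 0" "0 < cmod z" using z radius_nonneg[OF A] by auto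
  define w where "w = inverse z"
  have w: "cmod w = inverse (cmod z)" by (simp add: w_def norm_inverse)
  have Tn: "(T ^^ n) x \<in> l2 R" "l2_norm R ((T ^^ n) x) \<le> a n * l2_norm R x" if "x \<in> l2 R" for n x
    using that l2_norm_mat_op_le[OF pos_op_mat_pow[OF A] that, of n] mat_op_mat_pow[OF A that, of n]
    by (simp_all add: T_def a_def funpow_l2 A)
  define c where "c n = cmod w ^ Suc n * a n" for n
  have c: "summable c"
  proof -
    obtain q where q: "norm_radius R A < q" "q < cmod z" using z dense by blast
    have q0: "0 < q" using q radius_nonneg[OF A] by linarith
    have "\<forall>\<^sub>F n in sequentially. root n (a n) < q"
      unfolding a_def by (rule order_tendstoD(2)[OF radius_limit(1)[OF A] q(1)])
    then have "\<forall>\<^sub>F n in sequentially. norm (c n) \<le> cmod w * (q / cmod z) ^ n"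
      using eventually_ge_at_top[of 1]
    proof eventually_elim
      case (elim n)
      have "a n = root n (a n) ^ n" using elim a0 by simp
      also have "\<dots> \<le> q ^ n" using elim a0 by (intro power_mono) (auto intro: real_root_pos_pos_le)
      finally have "c n \<le> cmod w ^ Suc n * q ^ n" unfolding c_def by (intro mult_left_mono) auto
      also have "\<dots> = cmod w * (q / cmod z) ^ n" by (simp add: w power_divide power_inverse field_simps)
      finally show ?case using a0 by (simp add: c_def)
    qed
    moreover have "summable (\<lambda>n. cmod w * (q / cmod z) ^ n)"
      using q q0 z0 by (intro summable_mult summable_geometric) (simp add: divide_less_eq)
    ultimately show ?thesis by (rule summable_comparison_test_ev)
  qed
  define v where "v x n = (\<lambda>i. w ^ Suc n * (T ^^ n) x i)" for x n
  have v: "v x n \<in> l2 R" "l2_norm R (v x n) \<le> c n * l2_norm R x" if x: "x \<in> l2 R" for x n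
  proof -
    show "v x n \<in> l2 R" unfolding v_def by (intro l2_scale Tn x)
    have "l2_norm R (v x n) = cmod w ^ Suc n * l2_norm R ((T ^^ n) x)"
      unfolding v_def l2_scale(2)[OF Tn(1)[OF x]] norm_power ..
    also have "\<dots> \<le> cmod w ^ Suc n * (a n * l2_norm R x)" by (intro mult_left_mono Tn x) auto
    finally show "l2_norm R (v x n) \<le> c n * l2_norm R x" by (simp add: c_def)
  qed
  have sm: "summable (\<lambda>n. l2_norm R (v x n))" if x: "x \<in> l2 R" for x
    by (rule summable_comparison_test'[OF summable_mult2[OF c, of "l2_norm R x"]]) (use v[OF x] in auto)
  define S where "S x = (\<lambda>i. \<Sum>n. v x n i)" for x
  have S_l2: "S x \<in> l2 R" if "x \<in> l2 R" for x
    unfolding S_def by (rule l2_series(2)[OF v(1)[OF that] sm[OF that]])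
  have sv: "(\<lambda>n. v x n i) sums S x i" if "x \<in> l2 R" for x i
    unfolding S_def by (rule summable_sums) (rule l2_series(1)[OF v(1)[OF that] sm[OF that]])
  have S_norm: "l2_norm R (S x) \<le> suminf c * l2_norm R x" if x: "x \<in> l2 R" for x
  proof -
    have "l2_norm R (S x) \<le> (\<Sum>n. l2_norm R (v x n))"
      unfolding S_def by (rule l2_series(3)[OF v(1)[OF x] sm[OF x]])
    also have "\<dots> \<le> (\<Sum>n. c n * l2_norm R x)" by (intro suminf_le v x sm summable_mult2 c)
    also have "\<dots> = suminf c * l2_norm R x" using suminf_mult2[OF c] by simp
    finally show ?thesis .
  qed
  have T_add: "(T ^^ n) (\<lambda>i. x i + y i) = (\<lambda>i. (T ^^ n) x i + (T ^^ n) y i)" if "x \<in> l2 R" "y \<in> l2 R" for x y n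
    using that by (induction n) (simp_all add: T_def mat_op_linear(1) A funpow_l2)
  have T_scale: "(T ^^ n) (\<lambda>i. b * x i) = (\<lambda>i. b * (T ^^ n) x i)" for b x n
    by (induction n) (simp_all add: T_def mat_op_scale)
  have S_add: "S (\<lambda>i. x i + y i) = (\<lambda>i. S x i + S y i)" if xy: "x \<in> l2 R" "y \<in> l2 R" for x y
  proof
    fix i
    have "(\<lambda>n. v x n i + v y n i) sums (S x i + S y i)" using xy by (intro sums_add sv)
    moreover have "v x n i + v y n i = v (\<lambda>i. x i + y i) n i" for n
      unfolding v_def T_add[OF xy] by (simp add: algebra_simps)
    ultimately show "S (\<lambda>i. x i + y i) i = S x i + S y i"
      using sv[OF l2_add(1)[OF xy], of i] sums_unique2 by fastforce
  qed
  have S_scale: "S (\<lambda>i. b * x i) = (\<lambda>i. b * S x i)" if x: "x \<in> l2 R" for b x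
  proof
    fix i
    have "(\<lambda>n. b * v x n i) sums (b * S x i)" using x by (intro sums_mult sv)
    moreover have "b * v x n i = v (\<lambda>i. b * x i) n i" for n
      unfolding v_def T_scale by (simp add: algebra_simps)
    ultimately show "S (\<lambda>i. b * x i) i = b * S x i"
      using sv[OF l2_scale(1)[OF x], of b i] sums_unique2 by fastforce
  qed
  \<comment> \<open>both compositions telescope to the zeroth term\<close>
  have shift: "T (v x n) = (\<lambda>i. z * v x (Suc n) i)" for x n
    unfolding v_def using z0 by (simp add: T_def mat_op_scale w_def mult.assoc[symmetric])
  have TS: "z * S x i - T (S x) i = x i" if x: "x \<in> l2 R" for x i
  proof -
    have "(\<lambda>n. T (v x n) i) sums T (S x) i"
      unfolding T_def S_def by (rule mat_op_series[OF R A v(1)[OF x] sm[OF x]])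
    then have "(\<lambda>n. z * v x (Suc n) i) sums T (S x) i" by (simp add: shift)
    moreover have "(\<lambda>n. z * v x (Suc n) i) sums (z * S x i - z * v x 0 i)"
      using sums_mult[OF sv[OF x, of i], of z] sums_Suc_iff[of "\<lambda>n. z * v x n i" "z * S x i - z * v x 0 i"] by simp
    ultimately have "T (S x) i = z * S x i - z * v x 0 i" using sums_unique2 by blast
    then show ?thesis using z0 by (simp add: v_def w_def)
  qed
  have ST: "S (T x) = T (S x)" if x: "x \<in> l2 R" for x
  proof
    fix i
    have Tx: "T x \<in> l2 R" using Tn(1)[OF x, of 1] by simp
    have "v (T x) n = T (v x n)" for n
      unfolding v_def T_def by (simp only: mat_op_scale funpow_swap1)
    then have "(\<lambda>n. T (v x n) i) sums S (T x) i" using sv[OF Tx, of i] by simp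
    moreover have "(\<lambda>n. T (v x n) i) sums T (S x) i"
      unfolding T_def S_def by (rule mat_op_series[OF R A v(1)[OF x] sm[OF x]])
    ultimately show "S (T x) i = T (S x) i" using sums_unique2 by blast
  qed
  have "bounded_operator R S"
    unfolding bounded_operator_def using S_l2 S_add S_scale S_norm by blast
  moreover have "S (\<lambda>i. z * x i - T x i) = x" if x: "x \<in> l2 R" for x
  proof -
    have Tx: "T x \<in> l2 R" using Tn(1)[OF x, of 1] by simp
    have "S (\<lambda>i. z * x i + (-1) * T x i) = (\<lambda>i. z * S x i + (-1) * S (T x) i)"
      by (simp only: S_add[OF l2_scale(1)[OF x] l2_scale(1)[OF Tx]] S_scale[OF x] S_scale[OF Tx])
    then show ?thesis using TS[OF x] by (simp add: ST x)
  qed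
  ultimately show ?thesis
    unfolding spectrum_def T_def[symmetric] using TS by (auto intro!: exI[of _ S])
qed

subsection \<open>The asymptotic radius is a point of the spectrum\<close>

lemma mat_op_matrix_sum:
  assumes "finite I" "\<And>n. n \<in> I \<Longrightarrow> pos_op R (B n)" "\<And>n. n \<in> I \<Longrightarrow> 0 \<le> c n"
  shows "pos_op R (\<lambda>i j. \<Sum>n\<in>I. c n * B n i j)"
    and "x \<in> l2 R \<Longrightarrow> mat_op R (\<lambda>i j. \<Sum>n\<in>I. c n * B n i j) x
      = (\<lambda>i. \<Sum>n\<in>I. complex_of_real (c n) * mat_op R (B n) x i)"
proof -
  have "pos_op R (\<lambda>i j. \<Sum>n\<in>I. c n * B n i j) \<and>
    (x \<in> l2 R \<longrightarrow> mat_op R (\<lambda>i j. \<Sum>n\<in>I. c n * B n i j) x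
      = (\<lambda>i. \<Sum>n\<in>I. complex_of_real (c n) * mat_op R (B n) x i))"
    using assms
  proof (induction I rule: finite_induct)
    case empty
    then show ?case by (auto simp: pos_op_zero mat_op_def)
  next
    case (insert n I)
    let ?B = "\<lambda>i j. \<Sum>n\<in>I. c n * B n i j"
    have P: "pos_op R ?B" "pos_op R (\<lambda>i j. c n * B n i j)"
      using insert by (auto intro: pos_op_scale)
    have "mat_op R (\<lambda>i j. c n * B n i j + ?B i j) x i
        = complex_of_real (c n) * mat_op R (B n) x i + mat_op R ?B x i" if x: "x \<in> l2 R" for i
    proof (cases "i \<in> R")
      case True
      have "mat_op R (\<lambda>i j. c n * B n i j + ?B i j) x i
          = mat_op R (\<lambda>i j. c n * B n i j) x i + mat_op R ?B x i"
        using True infsum_add[OF abs_summable_summable[OF pos_op_row_abs_summable[OF P(2) x True]]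
            abs_summable_summable[OF pos_op_row_abs_summable[OF P(1) x True]]]
        by (simp add: mat_op_def distrib_right)
      then show ?thesis by (simp add: mat_op_def mult.assoc infsum_cmult_right')
    qed (simp add: mat_op_def)
    then show ?case using insert pos_op_add[OF P(2,1)] by auto
  qed
  then show "pos_op R (\<lambda>i j. \<Sum>n\<in>I. c n * B n i j)"
    and "x \<in> l2 R \<Longrightarrow> mat_op R (\<lambda>i j. \<Sum>n\<in>I. c n * B n i j) x
      = (\<lambda>i. \<Sum>n\<in>I. complex_of_real (c n) * mat_op R (B n) x i)" by blast+
qed

text \<open>Positivity replaces complex analysis here. Let \<open>r\<close> be the asymptotic radius and suppose that
  \<open>r - A\<close> has an inverse of norm at most \<open>C\<close>. The partial sums \<open>V\<close>, of arbitrarily high order, of the Neumann series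
  \<open>\<Sum>\<^sub>n \<mu>\<^sup>-\<^sup>n\<^sup>-\<^sup>1 A\<^sup>n\<close> then satisfy \<open>\<parallel>V\<parallel> \<le> 4 C\<close> for all \<open>\<mu> > r\<close> close to \<open>r\<close>. The nonnegative matrix \<open>V\<^sup>2\<close>
  dominates its summand \<open>(k + 1) \<mu>\<^sup>-\<^sup>k\<^sup>-\<^sup>2 A\<^sup>k\<close>, and \<open>\<parallel>A\<^sup>k\<parallel> \<ge> r\<^sup>k\<close>; in the limit \<open>\<mu> \<rightarrow> r\<close> this yields
  \<open>(k + 1) r\<^sup>k \<le> 16 C\<^sup>2 r\<^sup>k\<^sup>+\<^sup>2\<close> for every \<open>k\<close>. That fails for \<open>k = 0\<close> if \<open>r = 0\<close>, and for large \<open>k\<close>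
  otherwise.\<close>

lemma in_spectrum:
  assumes R: "R \<noteq> {}" and A: "pos_op R A"
  shows "complex_of_real (norm_radius R A) \<in> spectrum R (mat_op R A)"
proof (rule ccontr)
  assume contra: "complex_of_real (norm_radius R A) \<notin> spectrum R (mat_op R A)"
  interpret submult_functional R "{1..}" "\<lambda>A. op_norm R (mat_op R A)"
    using R by (rule submult_op_norm)
  define T where "T = mat_op R A"
  define r where "r = norm_radius R A"
  define a where "a n = op_norm R (mat_op R (mat_pow R A n))" for n
  note P = pos_op_mat_pow[OF A]
  have r0: "0 \<le> r" unfolding r_def by (rule radius_nonneg[OF A])
  have ra: "r ^ k \<le> a k" for k
  proof (cases "k = 0")
    case True
    obtain i where i: "i \<in> R" using R by auto
    have "mat_pow R A 0 i i \<le> a 0"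
      using form_bound_entry[OF op_norm_form_bound[OF P[of 0]] _ i i] P[of 0]
      by (simp add: a_def pos_op_def)
    then show ?thesis using True by simp
  next
    case False
    have "r \<le> root k (a k)" unfolding r_def a_def using False by (intro radius_limit(2) A) auto
    then have "r ^ k \<le> root k (a k) ^ k" using r0 by (rule power_mono)
    also have "\<dots> = a k" using False nonneg[OF P] by (simp add: a_def)
    finally show ?thesis .
  qed
  obtain S where S: "bounded_operator R S" "\<And>x. x \<in> l2 R \<Longrightarrow> S (\<lambda>i. complex_of_real r * x i - T x i) = x"
    using contra unfolding spectrum_def r_def T_def by blast
  obtain C0 where "\<And>x. x \<in> l2 R \<Longrightarrow> l2_norm R (S x) \<le> C0 * l2_norm R x"
    using S(1) unfolding bounded_operator_def by blast
  then have C0: "l2_norm R (S x) \<le> max 1 C0 * l2_norm R x" if "x \<in> l2 R" for x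
    using that by (meson l2_norm_nonneg max.cobounded2 mult_right_mono order_trans)
  define C where "C = max 1 C0"
  have C1: "1 \<le> C" by (simp add: C_def)
  have T_l2: "T x \<in> l2 R" if "x \<in> l2 R" for x using that by (simp add: T_def pos_op_l2 A)
  have below: "l2_norm R x \<le> C * l2_norm R (\<lambda>i. complex_of_real r * x i - T x i)" if x: "x \<in> l2 R" for x
    using C0[OF l2_diff(1)[OF l2_scale(1)[OF x, of "complex_of_real r"] T_l2[OF x]]] S(2)[OF x] by (simp add: C_def)
  have key: "real (k + 1) * r ^ k \<le> 16 * C\<^sup>2 * \<mu> ^ (k + 2)"
    if \<mu>: "r < \<mu>" "(\<mu> - r) * C \<le> 1/2" for k \<mu>
  proof -
    have \<mu>0: "0 < \<mu>" using r0 \<mu> by linarith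
    have "\<forall>\<^sub>F n in sequentially. root n (a n) < \<mu>"
      unfolding a_def by (rule order_tendstoD(2)[OF radius_limit(1)[OF A]]) (use \<mu> in \<open>simp add: r_def\<close>)
    then obtain N0 where N0: "\<And>n. N0 \<le> n \<Longrightarrow> root n (a n) < \<mu>" by (auto simp: eventually_sequentially)
    \<comment> \<open>\<open>N > k\<close> makes \<open>A\<^sup>k\<close> a summand of the square, and \<open>\<parallel>A\<^sup>N\<parallel> < \<mu>\<^sup>N\<close> controls the remainder\<close>
    define N where "N = max N0 (k + 1)"
    have N: "k < N" "root N (a N) < \<mu>" using N0[of N] by (auto simp: N_def)
    have a0: "0 \<le> a n" for n unfolding a_def by (rule nonneg[OF P])
    have aN: "a N \<le> \<mu> ^ N"
      using power_mono[of "root N (a N)" \<mu> N] N a0[of N] by (simp add: real_root_pos_pos_le)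
    define c where "c n = inverse \<mu> ^ Suc n" for n
    have c0: "0 \<le> c n" for n using \<mu>0 by (simp add: c_def)
    \<comment> \<open>partial sums of the Neumann series at \<open>\<mu>\<close>, a nonnegative matrix\<close>
    define V where "V = (\<lambda>i j. \<Sum>n<N. c n * mat_pow R A n i j)"
    have V: "pos_op R V" "\<And>x. x \<in> l2 R \<Longrightarrow> mat_op R V x = (\<lambda>i. \<Sum>n<N. complex_of_real (c n) * (T ^^ n) x i)"
      unfolding V_def T_def using P c0 mat_op_matrix_sum[of "{..<N}" R "mat_pow R A" c]
      by (auto simp: mat_op_mat_pow A)
    have Vx: "l2_norm R (mat_op R V x) \<le> 4 * C * l2_norm R x" if x: "x \<in> l2 R" for x
    proof -
      let ?v = "mat_op R V x"
      have v: "?v \<in> l2 R" by (rule pos_op_l2[OF V(1) x])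
      have Tn: "(T ^^ n) x \<in> l2 R" for n unfolding T_def by (rule funpow_l2[OF A x])
      have Tv: "T ?v i = (\<Sum>n<N. complex_of_real (c n) * (T ^^ Suc n) x i)" for i
        unfolding V(2)[OF x] T_def
        by (subst mat_op_sum[OF A]) (auto simp: mat_op_scale intro!: l2_scale funpow_l2 A x)
      define e where "e = (\<lambda>i. complex_of_real (inverse \<mu> ^ N) * (T ^^ N) x i)"
      have e_l2: "e \<in> l2 R" unfolding e_def by (intro l2_scale Tn)
      have "l2_norm R ((T ^^ N) x) \<le> a N * l2_norm R x"
        using l2_norm_mat_op_le[OF P x, of N] mat_op_mat_pow[OF A x, of N] by (simp add: T_def a_def)
      also have "\<dots> \<le> \<mu> ^ N * l2_norm R x" by (intro mult_right_mono aN) simp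
      finally have "inverse \<mu> ^ N * l2_norm R ((T ^^ N) x) \<le> inverse \<mu> ^ N * (\<mu> ^ N * l2_norm R x)"
        using \<mu>0 by (intro mult_left_mono) auto
      then have e: "l2_norm R e \<le> l2_norm R x"
        unfolding e_def l2_scale(2)[OF Tn] norm_of_real using \<mu>0 by (simp add: field_simps)
      have tele: "complex_of_real \<mu> * ?v i - T ?v i = x i - e i" for i
      proof -
        let ?u = "\<lambda>n. complex_of_real (inverse \<mu> ^ n) * (T ^^ n) x i"
        have "complex_of_real \<mu> * ?v i - T ?v i = (\<Sum>n<N. ?u n - ?u (Suc n))"
          unfolding Tv unfolding V(2)[OF x] sum_distrib_left sum_subtractf[symmetric]
          using \<mu>0 by (intro sum.cong) (auto simp: c_def mult.assoc[symmetric] simp flip: of_real_mult)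
        also have "\<dots> = ?u 0 - ?u N" by (rule sum_lessThan_telescope')
        finally show ?thesis by (simp add: e_def)
      qed
      have "(\<lambda>i. complex_of_real r * ?v i - T ?v i)
          = (\<lambda>i. (x i - e i) - complex_of_real (\<mu> - r) * ?v i)"
        by (auto simp: fun_eq_iff tele[symmetric] algebra_simps)
      then have "l2_norm R (\<lambda>i. complex_of_real r * ?v i - T ?v i)
          \<le> l2_norm R (\<lambda>i. x i - e i) + l2_norm R (\<lambda>i. complex_of_real (\<mu> - r) * ?v i)"
        using l2_diff(2)[OF l2_diff(1)[OF x e_l2] l2_scale(1)[OF v]] by simp
      also have "\<dots> \<le> (l2_norm R x + l2_norm R x) + (\<mu> - r) * l2_norm R ?v"
        using l2_diff(2)[OF x e_l2] e \<mu> unfolding l2_scale(2)[OF v] norm_of_real by (intro add_mono) auto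
      finally have "l2_norm R ?v \<le> C * ((l2_norm R x + l2_norm R x) + (\<mu> - r) * l2_norm R ?v)"
        using below[OF v] C1 by (meson mult_left_mono order_trans zero_le_one)
      also have "\<dots> = 2 * C * l2_norm R x + ((\<mu> - r) * C) * l2_norm R ?v" by (simp add: algebra_simps)
      also have "\<dots> \<le> 2 * C * l2_norm R x + 1/2 * l2_norm R ?v" using \<mu>(2) by (intro add_left_mono mult_right_mono) auto
      finally show ?thesis by simp
    qed
    have V_norm: "op_norm R (mat_op R V) \<le> 4 * C"
    proof -
      have "l2_norm R (mat_op R V x) \<le> 4 * C" if "x \<in> l2_ball R" for x
        using order_trans[OF Vx[of x] mult_left_le[of "l2_norm R x" "4 * C"]] that C1 by (simp add: l2_ball_def)
      then show ?thesis
        unfolding op_norm_def by (intro cSup_least) (auto simp: l2_ball_def intro!: exI[of _ "\<lambda>_. 0"])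
    qed
    \<comment> \<open>the coefficient of \<open>A\<^sup>k\<close> in the square of the Neumann series is \<open>(k + 1) \<mu>\<^sup>-\<^sup>k\<^sup>-\<^sup>2\<close>\<close>
    have dom: "le_on R (\<lambda>i j. (real (k + 1) * inverse \<mu> ^ (k + 2)) * mat_pow R A k i j) (mat_mult R V V)"
    proof -
      define W where "W = (\<lambda>i j. \<Sum>p\<in>{..<N} \<times> {..<N}. (c (fst p) * c (snd p)) * mat_pow R A (fst p + snd p) i j)"
      have W: "pos_op R W" "\<And>x. x \<in> l2 R \<Longrightarrow> mat_op R W x
          = (\<lambda>i. \<Sum>p\<in>{..<N} \<times> {..<N}. complex_of_real (c (fst p) * c (snd p)) * (T ^^ (fst p + snd p)) x i)"
        unfolding W_def T_def using P c0
          mat_op_matrix_sum[of "{..<N} \<times> {..<N}" R "\<lambda>p. mat_pow R A (fst p + snd p)" "\<lambda>p. c (fst p) * c (snd p)"]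
        by (auto simp: mat_op_mat_pow A)
      have "eq_on R (mat_mult R V V) W"
      proof (rule eq_on_operatorI)
        fix x assume x: "x \<in> l2 R"
        have Vx: "mat_op R V x \<in> l2 R" by (rule pos_op_l2[OF V(1) x])
        have Tn: "(T ^^ n) (mat_op R V x) i = (\<Sum>m<N. complex_of_real (c m) * (T ^^ (n + m)) x i)" for n i
        proof -
          have l: "(\<lambda>i. \<Sum>m<N. complex_of_real (c m) * (T ^^ m) x i) \<in> l2 R"
            using Vx by (simp add: V(2)[OF x])
          have lm: "(\<lambda>i. complex_of_real (c m) * (T ^^ m) x i) \<in> l2 R" for m
            unfolding T_def by (intro l2_scale funpow_l2 A x)
          have "(T ^^ n) (mat_op R V x) = mat_op R (mat_pow R A n) (\<lambda>i. \<Sum>m<N. complex_of_real (c m) * (T ^^ m) x i)"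
            by (simp add: V(2)[OF x] mat_op_mat_pow A l T_def[symmetric])
          also have "\<dots> = (\<lambda>i. \<Sum>m<N. mat_op R (mat_pow R A n) (\<lambda>i. complex_of_real (c m) * (T ^^ m) x i) i)"
            using lm by (intro mat_op_sum P) auto
          also have "\<dots> = (\<lambda>i. \<Sum>m<N. complex_of_real (c m) * (T ^^ (n + m)) x i)"
            by (simp add: mat_op_scale mat_op_mat_pow A funpow_l2 x T_def funpow_add)
          finally show ?thesis by simp
        qed
        show "mat_op R (mat_mult R V V) x = mat_op R W x"
        proof
          fix i
          have "mat_op R (mat_mult R V V) x i = (\<Sum>n<N. complex_of_real (c n) * (T ^^ n) (mat_op R V x) i)"
            by (simp only: mat_op_mat_mult(1)[OF V(1) V(1) x] V(2)[OF Vx])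
          also have "\<dots> = (\<Sum>n<N. \<Sum>m<N. complex_of_real (c n * c m) * (T ^^ (n + m)) x i)"
            by (simp add: Tn sum_distrib_left mult.assoc)
          also have "\<dots> = mat_op R W x i"
            by (simp add: W(2)[OF x] sum.cartesian_product case_prod_beta)
          finally show "mat_op R (mat_mult R V V) x i = mat_op R W x i" .
        qed
      qed
      moreover have "real (k + 1) * inverse \<mu> ^ (k + 2) * mat_pow R A k i j \<le> W i j" if ij: "i \<in> R" "j \<in> R" for i j
      proof -
        let ?f = "\<lambda>p. (c (fst p) * c (snd p)) * mat_pow R A (fst p + snd p) i j"
        let ?D = "(\<lambda>n. (n, k - n)) ` {..k}"
        have "sum ?f ?D = (\<Sum>n\<le>k. ?f (n, k - n))" by (subst sum.reindex) (auto simp: inj_on_def)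
        also have "\<dots> = (\<Sum>n\<le>k. inverse \<mu> ^ (k + 2) * mat_pow R A k i j)"
          by (intro sum.cong) (auto simp: c_def simp flip: power_add power_Suc)
        also have "\<dots> = real (k + 1) * inverse \<mu> ^ (k + 2) * mat_pow R A k i j" by simp
        finally have "real (k + 1) * inverse \<mu> ^ (k + 2) * mat_pow R A k i j = sum ?f ?D" by simp
        also have "\<dots> \<le> W i j"
          unfolding W_def using N(1) ij
          by (intro sum_mono2) (auto intro!: mult_nonneg_nonneg c0 pos_op_nonneg[OF P])
        finally show ?thesis .
      qed
      ultimately show ?thesis by (auto simp: le_on_def eq_on_def)
    qed
    define d where "d = real (k + 1) * inverse \<mu> ^ (k + 2)"
    have d: "0 < d" using \<mu>0 by (simp add: d_def)
    have dP: "pos_op R (\<lambda>i j. d * mat_pow R A k i j)" using d by (intro pos_op_scale P) auto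
    have "a k = op_norm R (mat_op R (\<lambda>i j. inverse d * (d * mat_pow R A k i j)))"
      using d by (simp add: a_def mult.assoc[symmetric])
    also have "\<dots> \<le> inverse d * op_norm R (mat_op R (\<lambda>i j. d * mat_pow R A k i j))"
      using d by (intro scale[OF dP]) auto
    also have "\<dots> \<le> inverse d * op_norm R (mat_op R (mat_mult R V V))"
      using d dom[folded d_def]
      by (intro mult_left_mono mono[OF dP pos_op_mat_mult[OF V(1) V(1)]]) auto
    also have "\<dots> \<le> inverse d * (4 * C * (4 * C))"
      using d V_norm C1 nonneg[OF V(1)] order_trans[OF submult[OF V(1) V(1)] mult_mono[OF V_norm V_norm]]
      by (intro mult_left_mono) auto
    finally have "d * a k \<le> 16 * C\<^sup>2" using d by (simp add: field_simps power2_eq_square)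
    then have "d * r ^ k \<le> 16 * C\<^sup>2" using mult_left_mono[OF ra[of k], of d] d by linarith
    then show ?thesis using \<mu>0 by (simp add: d_def field_simps)
  qed
  have limit: "real (k + 1) * r ^ k \<le> 16 * C\<^sup>2 * r ^ (k + 2)" for k
  proof (rule LIMSEQ_le_const)
    let ?l = "\<lambda>n. r + inverse (2 * C) * inverse (real (Suc n))"
    have "?l \<longlonglongrightarrow> r + inverse (2 * C) * 0"
      by (intro tendsto_add tendsto_mult tendsto_const LIMSEQ_inverse_real_of_nat)
    then have "(\<lambda>n. 16 * C\<^sup>2 * ?l n ^ (k + 2)) \<longlonglongrightarrow> 16 * C\<^sup>2 * (r + inverse (2 * C) * 0) ^ (k + 2)"
      by (intro tendsto_mult tendsto_power tendsto_const)
    then show "(\<lambda>n. 16 * C\<^sup>2 * ?l n ^ (k + 2)) \<longlonglongrightarrow> 16 * C\<^sup>2 * r ^ (k + 2)" by simp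
    have "real (k + 1) * r ^ k \<le> 16 * C\<^sup>2 * ?l n ^ (k + 2)" for n
    proof (rule key)
      show "r < ?l n" using C1 by simp
      have "(?l n - r) * C = 1/2 * inverse (real (Suc n))" using C1 by simp
      also have "\<dots> \<le> 1/2 * 1" by (intro mult_left_mono) (auto simp: inverse_le_1_iff)
      finally show "(?l n - r) * C \<le> 1/2" by simp
    qed
    then show "\<exists>N. \<forall>n\<ge>N. real (k + 1) * r ^ k \<le> 16 * C\<^sup>2 * ?l n ^ (k + 2)" by blast
  qed
  show False
  proof (cases "r = 0")
    case True
    then show False using limit[of 0] by simp
  next
    case False
    obtain k :: nat where k: "16 * C\<^sup>2 * r\<^sup>2 < real k" using reals_Archimedean2 by blast
    have "r ^ k * real (k + 1) \<le> r ^ k * (16 * C\<^sup>2 * r\<^sup>2)" using limit[of k] by (simp add: power_add power2_eq_square mult_ac)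
    then have "real (k + 1) \<le> 16 * C\<^sup>2 * r\<^sup>2" using False r0 by simp
    then show False using k by simp
  qed
qed

lemma spectral_radius_asymp:
  assumes R: "R \<noteq> {}" and A: "pos_op R A"
  shows "spectral_radius R (mat_op R A) = norm_radius R A"
proof -
  interpret submult_functional R "{1..}" "\<lambda>A. op_norm R (mat_op R A)"
    using R by (rule submult_op_norm)
  show ?thesis
    unfolding spectral_radius_def
  proof (rule cSup_eq_maximum)
    show "norm_radius R A \<in> {cmod z |z. z \<in> spectrum R (mat_op R A)}"
      using in_spectrum[OF R A] radius_nonneg[OF A] by (auto intro!: exI[of _ "complex_of_real (norm_radius R A)"])
    show "t \<le> norm_radius R A" if "t \<in> {cmod z |z. z \<in> spectrum R (mat_op R A)}" for t
      using that not_in_spectrum[OF R A] by force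
  qed
qed

section \<open>Weighted geometric symmetrisations\<close>

lemma bdd_above_entries:
  assumes A: "pos_op R A"
  shows "bdd_above {A i j | i j. i \<in> R \<and> j \<in> R}"
proof -
  obtain C where "form_bound all_pairs R A C" using pos_op_form_bound[OF A] by blast
  then show ?thesis using A
    by (intro bdd_aboveI[of _ C]) (auto simp: pos_op_def intro: form_bound_entry)
qed

lemma le_sup_norm: "\<lbrakk>pos_op R A; i \<in> R; j \<in> R\<rbrakk> \<Longrightarrow> A i j \<le> sup_norm R A"
  unfolding sup_norm_def by (rule cSup_upper) (auto intro: bdd_above_entries)

lemma sup_norm_nonneg: "\<lbrakk>R \<noteq> {}; pos_op R A\<rbrakk> \<Longrightarrow> 0 \<le> sup_norm R A"
  using le_sup_norm[of R A] pos_op_nonneg[of R A] by (meson equals0I order_trans)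

lemma pos_op_sym2:
  "\<lbrakk>pos_op R K; 0 \<le> \<alpha>; 0 \<le> \<beta>; 1 \<le> \<alpha> + \<beta>\<rbrakk> \<Longrightarrow> pos_op R (sym2 \<alpha> \<beta> K)"
  unfolding sym2_hmean by (intro pos_op_hmean pos_op_adj)

context matrix_functional
begin

lemma functional_adj: "pos_op R A \<Longrightarrow> g (mat_adj A) = g A"
  using adj[of A] adj[of "mat_adj A"] pos_op_adj[of R A] by simp

lemma functional_prod_sym2:
  assumes "Ks \<noteq> []" "\<forall>K\<in>set Ks. pos_op R K" and e: "0 \<le> \<alpha>" "0 \<le> \<beta>" "1 \<le> \<alpha> + \<beta>"
  shows "g (mat_prod R (map (sym2 \<alpha> \<beta>) Ks)) \<le> g (hmean \<alpha> \<beta> (mat_prod R Ks) (mat_adj (mat_prod R (rev Ks))))"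
  using assms
  by (intro mono mat_prod_sym2 pos_op_hmean pos_op_adj pos_op_mat_prod)
    (auto intro: pos_op_sym2)

lemma functional_sum_sym2:
  assumes "\<forall>K\<in>set Ks. pos_op R K" and e: "0 \<le> \<alpha>" "0 \<le> \<beta>" "1 \<le> \<alpha> + \<beta>"
  shows "g (mat_sum (map (sym2 \<alpha> \<beta>) Ks)) \<le> g (sym2 \<alpha> \<beta> (mat_sum Ks))"
  using assms
  by (intro mono mat_sum_sym2 pos_op_sym2 pos_op_mat_sum)
    (auto intro: pos_op_sym2)

lemma functional_hmean_adj:
  assumes A: "pos_op R A" and B: "pos_op R B" and e: "0 \<le> \<alpha>" "0 \<le> \<beta>" "\<alpha> + \<beta> \<in> S"
  shows "g (hmean \<alpha> \<beta> A (mat_adj B)) \<le> rpow (g A) \<alpha> * rpow (g B) \<beta>"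
  using hmean[OF A pos_op_adj[OF B] e] by (simp add: functional_adj B)

lemma functional_sym2:
  assumes A: "pos_op R A" and e: "0 \<le> \<alpha>" "0 \<le> \<beta>" "\<alpha> + \<beta> \<in> S"
  shows "g (sym2 \<alpha> \<beta> A) \<le> rpow (g A) (\<alpha> + \<beta>)"
  using functional_hmean_adj[OF A A e] nonneg[OF A] e by (simp add: sym2_hmean rpow_add)

text \<open>Entrywise, \<open>a\<^sup>\<alpha> b\<^sup>\<beta>\<close> is the convex geometric mean of \<open>a\<close> and \<open>b\<close> times its own power
  with exponent \<open>\<alpha> + \<beta> - 1\<close>, which the largest entry bounds.\<close>

lemma functional_hmean_sup_norm:
  assumes A: "pos_op R A" and B: "pos_op R B"
    and e: "0 \<le> \<alpha>" "0 \<le> \<beta>" "1 \<le> \<alpha> + \<beta>"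
    and m: "0 \<le> m" "\<And>i j. i \<in> R \<Longrightarrow> j \<in> R \<Longrightarrow> A i j \<le> m" "\<And>i j. i \<in> R \<Longrightarrow> j \<in> R \<Longrightarrow> B i j \<le> m"
  shows "g (hmean \<alpha> \<beta> A (mat_adj B))
    \<le> rpow m (\<alpha> + \<beta> - 1) * g (hmean (\<alpha>/(\<alpha>+\<beta>)) (\<beta>/(\<alpha>+\<beta>)) A (mat_adj B))"
proof -
  let ?H = "hmean (\<alpha>/(\<alpha>+\<beta>)) (\<beta>/(\<alpha>+\<beta>)) A (mat_adj B)"
  have H: "pos_op R ?H"
    using e by (intro pos_op_hmean A pos_op_adj B) (auto simp flip: add_divide_distrib)
  have mm: "rpow m (\<alpha>/(\<alpha>+\<beta>)) * rpow m (\<beta>/(\<alpha>+\<beta>)) = m"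
    using rpow_add[of m "\<alpha>/(\<alpha>+\<beta>)" "\<beta>/(\<alpha>+\<beta>)"] e m(1) by (simp flip: add_divide_distrib)
  have "le_on R (hmean \<alpha> \<beta> A (mat_adj B)) (\<lambda>i j. rpow m (\<alpha> + \<beta> - 1) * ?H i j)"
  proof (rule le_onI)
    fix i j assume ij: "i \<in> R" "j \<in> R"
    show "hmean \<alpha> \<beta> A (mat_adj B) i j \<le> rpow m (\<alpha> + \<beta> - 1) * ?H i j"
      using hmean_le_scaled[OF e, of "A i j" m "B j i" m] ij m
        pos_op_nonneg[OF A] pos_op_nonneg[OF B]
      by (simp add: hmean_apply mat_adj_def mm)
  qed
  then have "g (hmean \<alpha> \<beta> A (mat_adj B)) \<le> g (\<lambda>i j. rpow m (\<alpha> + \<beta> - 1) * ?H i j)"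
    using e by (intro mono pos_op_hmean pos_op_scale H A pos_op_adj B) auto
  also have "\<dots> \<le> rpow m (\<alpha> + \<beta> - 1) * g ?H" by (intro scale H) auto
  finally show ?thesis .
qed

lemma functional_hmean_normalised:
  assumes A: "pos_op R A" and B: "pos_op R B" and e: "0 \<le> \<alpha>" "0 \<le> \<beta>" "1 \<le> \<alpha> + \<beta>"
  shows "g (hmean (\<alpha>/(\<alpha>+\<beta>)) (\<beta>/(\<alpha>+\<beta>)) A (mat_adj B)) \<le> rpow (g A) (\<alpha>/(\<alpha>+\<beta>)) * rpow (g B) (\<beta>/(\<alpha>+\<beta>))"
  using e S(1) by (intro functional_hmean_adj A B) (auto simp flip: add_divide_distrib)

lemma functional_hmean_chain:
  assumes R: "R \<noteq> {}" and A: "pos_op R A" and B: "pos_op R B"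
    and e: "0 \<le> \<alpha>" "0 \<le> \<beta>" "1 \<le> \<alpha> + \<beta>"
  defines "\<delta> \<equiv> rpow (max (sup_norm R A) (sup_norm R B)) (\<alpha> + \<beta> - 1)"
  shows "g (hmean \<alpha> \<beta> A (mat_adj B)) \<le> \<delta> * g (hmean (\<alpha>/(\<alpha>+\<beta>)) (\<beta>/(\<alpha>+\<beta>)) A (mat_adj B))"
    and "\<delta> * g (hmean (\<alpha>/(\<alpha>+\<beta>)) (\<beta>/(\<alpha>+\<beta>)) A (mat_adj B))
      \<le> \<delta> * rpow (g A) (\<alpha>/(\<alpha>+\<beta>)) * rpow (g B) (\<beta>/(\<alpha>+\<beta>))"
proof -
  show "g (hmean \<alpha> \<beta> A (mat_adj B)) \<le> \<delta> * g (hmean (\<alpha>/(\<alpha>+\<beta>)) (\<beta>/(\<alpha>+\<beta>)) A (mat_adj B))"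
    unfolding \<delta>_def using R
    by (intro functional_hmean_sup_norm A B e) (auto intro: le_max_iff_disj[THEN iffD2] le_sup_norm sup_norm_nonneg A B)
  show "\<delta> * g (hmean (\<alpha>/(\<alpha>+\<beta>)) (\<beta>/(\<alpha>+\<beta>)) A (mat_adj B))
      \<le> \<delta> * rpow (g A) (\<alpha>/(\<alpha>+\<beta>)) * rpow (g B) (\<beta>/(\<alpha>+\<beta>))"
    using mult_left_mono[OF functional_hmean_normalised[OF A B e], of \<delta>] by (simp add: \<delta>_def mult.assoc)
qed

lemma sym1_hmean:
  assumes "1 \<le> \<alpha> + (\<beta>::real)"
  shows "sym1 (\<alpha>/(\<alpha>+\<beta>)) K = hmean (\<alpha>/(\<alpha>+\<beta>)) (\<beta>/(\<alpha>+\<beta>)) K (mat_adj K)"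
proof -
  have "1 - \<alpha>/(\<alpha>+\<beta>) = \<beta>/(\<alpha>+\<beta>)" using assms by (simp add: field_simps)
  then show ?thesis by (simp add: sym1_def)
qed

lemma functional_sym2_chain:
  assumes R: "R \<noteq> {}" and A: "pos_op R A" and e: "0 \<le> \<alpha>" "0 \<le> \<beta>" "1 \<le> \<alpha> + \<beta>"
  shows "g (sym2 \<alpha> \<beta> A) \<le> rpow (sup_norm R A) (\<alpha> + \<beta> - 1) * g (sym1 (\<alpha>/(\<alpha>+\<beta>)) A)"
    and "rpow (sup_norm R A) (\<alpha> + \<beta> - 1) * g (sym1 (\<alpha>/(\<alpha>+\<beta>)) A) \<le> rpow (sup_norm R A) (\<alpha> + \<beta> - 1) * g A"
proof -
  show "g (sym2 \<alpha> \<beta> A) \<le> rpow (sup_norm R A) (\<alpha> + \<beta> - 1) * g (sym1 (\<alpha>/(\<alpha>+\<beta>)) A)"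
    using functional_hmean_chain(1)[OF R A A e] by (simp add: sym2_hmean sym1_hmean[OF e(3)])
  have "rpow (g A) (\<alpha>/(\<alpha>+\<beta>)) * rpow (g A) (\<beta>/(\<alpha>+\<beta>)) = g A"
    using rpow_add[of "g A" "\<alpha>/(\<alpha>+\<beta>)" "\<beta>/(\<alpha>+\<beta>)"] e nonneg[OF A] by (simp flip: add_divide_distrib)
  then have "g (sym1 (\<alpha>/(\<alpha>+\<beta>)) A) \<le> g A"
    using functional_hmean_normalised[OF A A e] by (simp add: sym1_hmean[OF e(3)])
  then show "rpow (sup_norm R A) (\<alpha> + \<beta> - 1) * g (sym1 (\<alpha>/(\<alpha>+\<beta>)) A) \<le> rpow (sup_norm R A) (\<alpha> + \<beta> - 1) * g A"
    by (intro mult_left_mono) auto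
qed

end

text \<open>The locale constrains a functional on positive operators only, so its properties transfer along an
  equality that holds there.\<close>

lemma matrix_functional_cong:
  assumes "matrix_functional R S h" "\<And>A. pos_op R A \<Longrightarrow> g A = h A"
  shows "matrix_functional R S g"
proof -
  interpret h: matrix_functional R S h by fact
  show ?thesis
  proof
    fix A B :: matrix
    assume A: "pos_op R A"
    note eq = assms(2)
    show "0 \<le> g A" using h.nonneg[OF A] eq[OF A] by simp
    show "g (\<lambda>i j. c * A i j) \<le> c * g A" if "0 \<le> c" for c
      using h.scale[OF A that] eq[OF A] eq[OF pos_op_scale[OF A that]] by simp
    show "g (mat_adj A) \<le> g A"
      using h.adj[OF A] eq[OF A] eq[OF pos_op_adj[OF A]] by simp
    assume B: "pos_op R B"
    show "g A \<le> g B" if "le_on R A B" using h.mono[OF A B that] eq[OF A] eq[OF B] by simp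
    show "g (hmean \<alpha> \<beta> A B) \<le> rpow (g A) \<alpha> * rpow (g B) \<beta>" if e: "0 \<le> \<alpha>" "0 \<le> \<beta>" "\<alpha> + \<beta> \<in> S" for \<alpha> \<beta>
    proof -
      have "pos_op R (hmean \<alpha> \<beta> A B)" using e h.S by (intro pos_op_hmean A B) auto
      then show ?thesis using h.hmean[OF A B e] eq A B by simp
    qed
  qed (use h.S in auto)
qed

lemma matrix_functional_weaken:
  assumes "matrix_functional R S g" "1 \<in> S'" "S' \<subseteq> S"
  shows "matrix_functional R S' g"
proof -
  interpret matrix_functional R S g by fact
  show ?thesis by unfold_locales (use assms(2,3) S nonneg mono scale adj hmean in auto)
qed

lemma matrix_functional_spectral_radius:
  assumes R: "R \<noteq> {}"
  shows "matrix_functional R {1..} (\<lambda>A. spectral_radius R (mat_op R A))"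
  using submult_functional.matrix_functional_radius[OF submult_op_norm[OF R]]
  by (rule matrix_functional_cong) (rule spectral_radius_asymp[OF R])

lemma matrix_functional_ess_spectral_radius:
  "matrix_functional R {1} (\<lambda>A. ess_spectral_radius R (mat_op R A))"
  using submult_functional.matrix_functional_radius[OF submult_noncompactness]
  by (rule matrix_functional_cong) (rule ess_spectral_radius_asymp)

lemma spectral_radius_mat_mult_commute:
  assumes R: "R \<noteq> {}" and "pos_op R A" "pos_op R B"
  shows "spectral_radius R (mat_op R (mat_mult R A B)) = spectral_radius R (mat_op R (mat_mult R B A))"
  using assms submult_functional.radius_mat_mult_commute[OF submult_op_norm[OF R] assms(2,3)]
  by (simp add: spectral_radius_asymp pos_op_mat_mult)

lemma ess_spectral_radius_mat_mult_commute:
  assumes "pos_op R A" "pos_op R B"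
  shows "ess_spectral_radius R (mat_op R (mat_mult R A B)) = ess_spectral_radius R (mat_op R (mat_mult R B A))"
  using assms submult_functional.radius_mat_mult_commute[OF submult_noncompactness assms]
  by (simp add: ess_spectral_radius_asymp pos_op_mat_mult)

theorem proposition2p3:
  fixes R :: "nat set" and K :: matrix and Ks :: "matrix list" and \<alpha> \<beta> :: real
  assumes R: "index_set R"
    and K: "nonneg_matrix R K" "defines_operator R K"
    and Ks: "Ks \<noteq> []" "\<forall>L\<in>set Ks. nonneg_matrix R L \<and> defines_operator R L"
    and exponents: "\<alpha> \<ge> 0" "\<beta> \<ge> 0" "\<alpha> + \<beta> \<ge> 1"
  shows
    \<comment> \<open>(1)\<close>
    "(\<forall>\<rho>\<in>{spectral_radius R, op_norm R}.
        \<rho> (mat_op R (mat_prod R (map (sym2 \<alpha> \<beta>) Ks)))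
          \<le> \<rho> (mat_op R (hadamard (hadamard_pow (mat_prod R Ks) \<alpha>)
                                   (hadamard_pow (mat_adj (mat_prod R (rev Ks))) \<beta>)))
      \<and> \<rho> (mat_op R (hadamard (hadamard_pow (mat_prod R Ks) \<alpha>)
                               (hadamard_pow (mat_adj (mat_prod R (rev Ks))) \<beta>)))
          \<le> rpow (\<rho> (mat_op R (mat_prod R Ks))) \<alpha> * rpow (\<rho> (mat_op R (mat_prod R (rev Ks)))) \<beta>
      \<and> \<rho> (mat_op R (sym2 \<alpha> \<beta> K)) \<le> rpow (\<rho> (mat_op R K)) (\<alpha> + \<beta>)
      \<and> \<rho> (mat_op R (mat_sum (map (sym2 \<alpha> \<beta>) Ks))) \<le> \<rho> (mat_op R (sym2 \<alpha> \<beta> (mat_sum Ks)))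
      \<and> \<rho> (mat_op R (sym2 \<alpha> \<beta> (mat_sum Ks))) \<le> rpow (\<rho> (mat_op R (mat_sum Ks))) (\<alpha> + \<beta>))
     \<and>
     \<comment> \<open>(2)\<close>
     (\<forall>K1 K2. nonneg_matrix R K1 \<and> defines_operator R K1 \<and>
              nonneg_matrix R K2 \<and> defines_operator R K2 \<longrightarrow>
        spectral_radius R (mat_op R (mat_mult R (sym2 \<alpha> \<beta> K1) (sym2 \<alpha> \<beta> K2)))
          \<le> rpow (spectral_radius R (mat_op R (mat_mult R K1 K2))) (\<alpha> + \<beta>))
     \<and>
     \<comment> \<open>(3)\<close>
     (\<forall>\<rho>\<in>{spectral_radius R, ess_spectral_radius R, noncompactness R, op_norm R, numerical_radius R}.
        let \<delta> = rpow (max (sup_norm R (mat_prod R Ks)) (sup_norm R (mat_prod R (rev Ks)))) (\<alpha> + \<beta> - 1)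
        in
        \<rho> (mat_op R (mat_prod R (map (sym2 \<alpha> \<beta>) Ks)))
          \<le> \<rho> (mat_op R (hadamard (hadamard_pow (mat_prod R Ks) \<alpha>)
                                   (hadamard_pow (mat_adj (mat_prod R (rev Ks))) \<beta>)))
      \<and> \<rho> (mat_op R (hadamard (hadamard_pow (mat_prod R Ks) \<alpha>)
                               (hadamard_pow (mat_adj (mat_prod R (rev Ks))) \<beta>)))
          \<le> \<delta> * \<rho> (mat_op R (hadamard (hadamard_pow (mat_prod R Ks) (\<alpha> / (\<alpha> + \<beta>)))
                                       (hadamard_pow (mat_adj (mat_prod R (rev Ks))) (\<beta> / (\<alpha> + \<beta>)))))
      \<and> \<delta> * \<rho> (mat_op R (hadamard (hadamard_pow (mat_prod R Ks) (\<alpha> / (\<alpha> + \<beta>)))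
                                   (hadamard_pow (mat_adj (mat_prod R (rev Ks))) (\<beta> / (\<alpha> + \<beta>)))))
          \<le> \<delta> * rpow (\<rho> (mat_op R (mat_prod R Ks))) (\<alpha> / (\<alpha> + \<beta>))
              * rpow (\<rho> (mat_op R (mat_prod R (rev Ks)))) (\<beta> / (\<alpha> + \<beta>))
      \<and> \<rho> (mat_op R (sym2 \<alpha> \<beta> K))
          \<le> rpow (sup_norm R K) (\<alpha> + \<beta> - 1) * \<rho> (mat_op R (sym1 (\<alpha> / (\<alpha> + \<beta>)) K))
      \<and> rpow (sup_norm R K) (\<alpha> + \<beta> - 1) * \<rho> (mat_op R (sym1 (\<alpha> / (\<alpha> + \<beta>)) K))
          \<le> rpow (sup_norm R K) (\<alpha> + \<beta> - 1) * \<rho> (mat_op R K)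
      \<and> \<rho> (mat_op R (mat_sum (map (sym2 \<alpha> \<beta>) Ks))) \<le> \<rho> (mat_op R (sym2 \<alpha> \<beta> (mat_sum Ks)))
      \<and> \<rho> (mat_op R (sym2 \<alpha> \<beta> (mat_sum Ks)))
          \<le> rpow (sup_norm R (mat_sum Ks)) (\<alpha> + \<beta> - 1)
              * \<rho> (mat_op R (sym1 (\<alpha> / (\<alpha> + \<beta>)) (mat_sum Ks)))
      \<and> rpow (sup_norm R (mat_sum Ks)) (\<alpha> + \<beta> - 1)
            * \<rho> (mat_op R (sym1 (\<alpha> / (\<alpha> + \<beta>)) (mat_sum Ks)))
          \<le> rpow (sup_norm R (mat_sum Ks)) (\<alpha> + \<beta> - 1) * \<rho> (mat_op R (mat_sum Ks)))
     \<and>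
     \<comment> \<open>(4)\<close>
     (\<forall>\<rho>\<in>{spectral_radius R, ess_spectral_radius R}.
      \<forall>K1 K2. nonneg_matrix R K1 \<and> defines_operator R K1 \<and>
              nonneg_matrix R K2 \<and> defines_operator R K2 \<longrightarrow>
        (let \<eta> = rpow (max (sup_norm R (mat_mult R K1 K2)) (sup_norm R (mat_mult R K2 K1))) (\<alpha> + \<beta> - 1)
         in
         \<rho> (mat_op R (mat_mult R (sym2 \<alpha> \<beta> K1) (sym2 \<alpha> \<beta> K2)))
           \<le> \<rho> (mat_op R (hadamard (hadamard_pow (mat_mult R K1 K2) \<alpha>)
                                    (hadamard_pow (mat_adj (mat_mult R K2 K1)) \<beta>)))
       \<and> \<rho> (mat_op R (hadamard (hadamard_pow (mat_mult R K1 K2) \<alpha>)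
                                (hadamard_pow (mat_adj (mat_mult R K2 K1)) \<beta>)))
           \<le> \<eta> * \<rho> (mat_op R (hadamard (hadamard_pow (mat_mult R K1 K2) (\<alpha> / (\<alpha> + \<beta>)))
                                        (hadamard_pow (mat_adj (mat_mult R K2 K1)) (\<beta> / (\<alpha> + \<beta>)))))
       \<and> \<eta> * \<rho> (mat_op R (hadamard (hadamard_pow (mat_mult R K1 K2) (\<alpha> / (\<alpha> + \<beta>)))
                                    (hadamard_pow (mat_adj (mat_mult R K2 K1)) (\<beta> / (\<alpha> + \<beta>)))))
           \<le> \<eta> * \<rho> (mat_op R (mat_mult R K1 K2))))"
proof -
  have ne: "R \<noteq> {}" using R by (auto simp: index_set_def)
  have KP: "pos_op R K" and KsP: "\<forall>L\<in>set Ks. pos_op R L"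
    using K Ks by (auto simp: pos_op_def)
  have AP: "pos_op R (mat_prod R Ks)" and BP: "pos_op R (mat_prod R (rev Ks))"
    and MP: "pos_op R (mat_sum Ks)"
    using KsP by (auto intro: pos_op_mat_prod pos_op_mat_sum)
  note e = exponents
  have F1: "matrix_functional R {1..} (\<lambda>A. \<rho> (mat_op R A))" if "\<rho> \<in> {spectral_radius R, op_norm R}" for \<rho>
    using that matrix_functional_spectral_radius[OF ne] matrix_functional_op_norm[OF ne] by auto
  have F3: "matrix_functional R {1} (\<lambda>A. \<rho> (mat_op R A))"
    if \<rho>: "\<rho> \<in> {spectral_radius R, ess_spectral_radius R, noncompactness R, op_norm R, numerical_radius R}" for \<rho>
  proof -
    consider "\<rho> \<in> {spectral_radius R, op_norm R}" | "\<rho> = ess_spectral_radius R" | "\<rho> = noncompactness R"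
      | "\<rho> = numerical_radius R" using \<rho> by auto
    then show ?thesis
    proof cases
      case 1
      show ?thesis by (rule matrix_functional_weaken[OF F1[OF 1]]) auto
    qed (simp_all add: matrix_functional_ess_spectral_radius matrix_functional_noncompactness
        matrix_functional_numerical_radius[OF ne])
  qed
  have commute: "\<rho> (mat_op R (mat_mult R K2 K1)) = \<rho> (mat_op R (mat_mult R K1 K2))"
    if "\<rho> \<in> {spectral_radius R, ess_spectral_radius R}" "pos_op R K1" "pos_op R K2" for \<rho> K1 K2
    using that(1) spectral_radius_mat_mult_commute[OF ne that(3,2)] ess_spectral_radius_mat_mult_commute[OF that(3,2)]
    by auto
  show ?thesis
  proof (intro conjI ballI allI impI, goal_cases)
    case (1 \<rho>)
    interpret matrix_functional R "{1..}" "\<lambda>A. \<rho> (mat_op R A)" by (rule F1) (rule 1)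
    show ?case by (rule functional_prod_sym2[OF Ks(1) KsP e])
  next
    case (2 \<rho>)
    interpret matrix_functional R "{1..}" "\<lambda>A. \<rho> (mat_op R A)" by (rule F1) (rule 2)
    show ?case using e by (intro functional_hmean_adj AP BP) auto
  next
    case (3 \<rho>)
    interpret matrix_functional R "{1..}" "\<lambda>A. \<rho> (mat_op R A)" by (rule F1) (rule 3)
    show ?case using e by (intro functional_sym2 KP) auto
  next
    case (4 \<rho>)
    interpret matrix_functional R "{1..}" "\<lambda>A. \<rho> (mat_op R A)" by (rule F1) (rule 4)
    show ?case by (rule functional_sum_sym2[OF KsP e])
  next
    case (5 \<rho>)
    interpret matrix_functional R "{1..}" "\<lambda>A. \<rho> (mat_op R A)" by (rule F1) (rule 5)
    show ?case using e by (intro functional_sym2 MP) auto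
  next
    case (6 K1 K2)
    then have P: "pos_op R K1" "pos_op R K2" by (auto simp: pos_op_def)
    have KL: "\<forall>L\<in>set [K1, K2]. pos_op R L" using P by simp
    note M = pos_op_mat_mult[OF P] pos_op_mat_mult[OF P(2,1)]
    interpret matrix_functional R "{1..}" "\<lambda>A. spectral_radius R (mat_op R A)" by (rule F1) simp
    have "spectral_radius R (mat_op R (mat_mult R (sym2 \<alpha> \<beta> K1) (sym2 \<alpha> \<beta> K2)))
        \<le> spectral_radius R (mat_op R (hmean \<alpha> \<beta> (mat_mult R K1 K2) (mat_adj (mat_mult R K2 K1))))"
      using functional_prod_sym2[OF _ KL e] by simp
    also have "\<dots> \<le> rpow (spectral_radius R (mat_op R (mat_mult R K1 K2))) \<alpha>
        * rpow (spectral_radius R (mat_op R (mat_mult R K2 K1))) \<beta>"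
      using e by (intro functional_hmean_adj M) auto
    also have "\<dots> = rpow (spectral_radius R (mat_op R (mat_mult R K1 K2))) (\<alpha> + \<beta>)"
      using e nonneg[OF M(1)] by (simp add: commute P rpow_add)
    finally show ?case .
  next
    case (7 \<rho>)
    interpret matrix_functional R "{1}" "\<lambda>A. \<rho> (mat_op R A)" by (rule F3) (rule 7)
    show ?case
      unfolding Let_def
      by (intro conjI functional_prod_sym2[OF Ks(1) KsP e] functional_hmean_chain[OF ne AP BP e]
          functional_sym2_chain[OF ne KP e] functional_sum_sym2[OF KsP e] functional_sym2_chain[OF ne MP e])
  next
    case (8 \<rho> K1 K2)
    then have P: "pos_op R K1" "pos_op R K2" by (auto simp: pos_op_def)
    have KL: "\<forall>L\<in>set [K1, K2]. pos_op R L" using P by simp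
    note M = pos_op_mat_mult[OF P] pos_op_mat_mult[OF P(2,1)]
    interpret matrix_functional R "{1}" "\<lambda>A. \<rho> (mat_op R A)" by (rule F3) (use 8(1) in auto)
    have prod: "\<rho> (mat_op R (mat_mult R (sym2 \<alpha> \<beta> K1) (sym2 \<alpha> \<beta> K2)))
        \<le> \<rho> (mat_op R (hmean \<alpha> \<beta> (mat_mult R K1 K2) (mat_adj (mat_mult R K2 K1))))"
      using functional_prod_sym2[OF _ KL e] by simp
    have "rpow (\<rho> (mat_op R (mat_mult R K1 K2))) (\<alpha>/(\<alpha>+\<beta>)) * rpow (\<rho> (mat_op R (mat_mult R K2 K1))) (\<beta>/(\<alpha>+\<beta>))
        = \<rho> (mat_op R (mat_mult R K1 K2))"
      using rpow_add[of "\<rho> (mat_op R (mat_mult R K1 K2))" "\<alpha>/(\<alpha>+\<beta>)" "\<beta>/(\<alpha>+\<beta>)"] e nonneg[OF M(1)]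
      by (simp add: commute[OF 8(1) P] flip: add_divide_distrib)
    then have last: "\<rho> (mat_op R (hmean (\<alpha>/(\<alpha>+\<beta>)) (\<beta>/(\<alpha>+\<beta>)) (mat_mult R K1 K2) (mat_adj (mat_mult R K2 K1))))
        \<le> \<rho> (mat_op R (mat_mult R K1 K2))"
      using functional_hmean_normalised[OF M e] by simp
    show ?case
      unfolding Let_def
      by (intro conjI prod functional_hmean_chain(1)[OF ne M e] mult_left_mono[OF last]) simp
  qed
qed

end
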